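(* Let $m\in(0,1)\cup\mathbb{N}$, $0<\alpha<2m<n$, $\frac{n-\alpha}{n-2m}<p<\infty$, $q_c=\frac{n(p-1)}{2m-\alpha}$. Let $F:\mathbb{R}\to\mathbb{R}$ satisfy $F(0)=0$, $|F(a)-F(b)|\le C|a-b|(|a|^{p-1}+|b|^{p-1})$ for some constant $C>0$ and all $a,b\in\mathbb{R}$, and $F(\lambda a)=\lambda^pF(a)$ for all $\lambda>0$, $a\in\mathbb{R}$. Let $w_0\in L^{q_c,\infty}(\mathbb{R}^n)$ be sufficiently small and such that $w_0(\sigma\cdot)=\sigma^{-\frac{2m-\alpha}{p-1}}w_0$ for all $\sigma>0$, and let $w$ be the small global self-similar solution of $$u(t)=e^{-t(-\Delta)^m}u_0+\int_0^t e^{-(t-\tau)(-\Delta)^m}|\cdot|^{-\alpha}F(u(\tau))\,d\tau,\qquad t>0, \tag{I}$$ with initial data $w(0)=w_0$. Set $u_0=w_0+\varphi$, where $\varphi$ belongs to the closure of the Schwartz space $\mathcal S(\mathbb{R}^n)$ in $L^{q_c,\infty}(\mathbb{R}^n)$, and assume that $u_0$ is sufficiently small in $L^{q_c,\infty}(\mathbb{R}^n)$. If $u$ is the small global-in-time solution of (I) with initial data $u_0$, then $$\lim_{t\to\infty}\|u(t)-w(t)\|_{L^{q_c,\infty}}=0.$$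
   Context: $e^{-t(-\Delta)^m}$ is convolution with the kernel $g_m(\cdot,t)$, $\widehat{g_m}(\xi,t)=e^{-t|\xi|^{2m}}$. For measurable $f$ on $\mathbb{R}^n$ let $f^*(\lambda)=\inf\{\tau>0:|\{|f|>\tau\}|\le\lambda\}$ and $f^{**}(s)=\frac1s\int_0^s f^*(\lambda)\,d\lambda$; for $1<q<\infty$, $\|f\|_{L^{q,\infty}}=\sup_{s>0}s^{1/q}f^{**}(s)$. $C_b([0,\infty);\mathcal X)$ is the space of bounded continuous functions with values in $\mathcal X$, with $[u]_{\mathcal X}=\sup_{t>0}\|u(t)\|_{\mathcal X}$; for $L^{q_c,\infty}$ the convergence to the initial data as $t\to0^+$ (continuity at $t=0$) is in the weak-$\star$ sense. Small global solution: there exist $\varepsilon,\vartheta>0$ such that for $\|u_0\|_{L^{q_c,\infty}}<\varepsilon$ equation (I) has exactly one solution in $\{u\in C_b([0,\infty);L^{q_c,\infty}(\mathbb{R}^n)):[u]_{L^{q_c,\infty}}\le2\vartheta\}$ (with $\vartheta$ proportional to $\varepsilon$, $\varepsilon$ taken as small as needed); this is the solution meant. When the datum is homogeneous of degree $-\frac{2m-\alpha}{p-1}$ this solution is self-similar, i.e. it equals $\sigma^{\frac{2m-\alpha}{p-1}}w(\sigma x,\sigma^{2m}t)$ for every $\sigma>0$. *)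

theory Defs
  imports "HOL-Analysis.Analysis"
begin

text \<open>
  Functions on \<open>\<real>\<^sup>n\<close> are total functions on \<^typ>\<open>real^'n\<close>, so \<open>n = CARD('n)\<close>; elements of the
  function spaces are representatives, and identities between them are stated almost everywhere.
  Rearrangements and Lorentz norms take values in \<^typ>\<open>ennreal\<close>, with \<open>\<infinity>\<close> outside the space.
\<close>

section \<open>Lorentz spaces\<close>

definition rearrangement :: "(real^'n \<Rightarrow> real) \<Rightarrow> real \<Rightarrow> ennreal" where
  "rearrangement f l =
     (INF \<tau>\<in>{\<tau>. 0 < \<tau> \<and> emeasure lebesgue {x. \<tau> < \<bar>f x\<bar>} \<le> ennreal l}. ennreal \<tau>)"

definition avg_rearrangement :: "(real^'n \<Rightarrow> real) \<Rightarrow> real \<Rightarrow> ennreal" where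
  "avg_rearrangement f s = ennreal (1 / s) * (\<integral>\<^sup>+ l\<in>{0<..<s}. rearrangement f l \<partial>lborel)"

definition weak_norm :: "real \<Rightarrow> (real^'n \<Rightarrow> real) \<Rightarrow> ennreal" where
  "weak_norm q f = (SUP s\<in>{0<..}. ennreal (s powr (1 / q)) * avg_rearrangement f s)"

definition weak_L :: "real \<Rightarrow> (real^'n \<Rightarrow> real) set" where
  "weak_L q = {f. f \<in> borel_measurable lebesgue \<and> weak_norm q f < \<infinity>}"

text \<open>The Lorentz space \<open>L\<^bsup>r,1\<^esup>\<close>; for \<open>1 < q < \<infinity>\<close> and \<open>r = q / (q - 1)\<close> it is the predual of
  \<open>L\<^bsup>q,\<infinity>\<^esup>\<close> and hence defines the weak-star topology there.\<close>

definition lorentz_1 :: "real \<Rightarrow> (real^'n \<Rightarrow> real) set" where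
  "lorentz_1 r = {f. f \<in> borel_measurable lebesgue \<and>
     (\<integral>\<^sup>+ s\<in>{0<..}. ennreal (s powr (1 / r - 1)) * avg_rearrangement f s \<partial>lborel) < \<infinity>}"

section \<open>Schwartz functions\<close>

definition partial_deriv :: "'n \<Rightarrow> (real^'n \<Rightarrow> real) \<Rightarrow> real^'n \<Rightarrow> real" where
  "partial_deriv i f x = frechet_derivative f (at x) (axis i 1)"

text \<open>A list of indices plays the role of a multi-index. Differentiability of all iterated partial
  derivatives amounts to smoothness.\<close>

definition schwartz :: "(real^'n \<Rightarrow> real) set" where
  "schwartz = {f. \<forall>is. (\<forall>x. foldr partial_deriv is f differentiable (at x)) \<and>
     (\<forall>k::nat. bounded (range (\<lambda>x. norm x ^ k * foldr partial_deriv is f x)))}"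

definition schwartz_closure :: "real \<Rightarrow> (real^'n \<Rightarrow> real) set" where
  "schwartz_closure q = {f \<in> weak_L q. \<forall>\<delta>>0. \<exists>\<psi>\<in>schwartz. weak_norm q (\<lambda>x. f x - \<psi> x) < ennreal \<delta>}"

section \<open>The semigroup and the integral equation\<close>

text \<open>The kernel with Fourier transform \<open>exp (- t * norm \<xi> powr (2 * m))\<close>, given by Fourier inversion
  for the convention in which the transform of \<open>g\<close> at \<open>\<xi>\<close> is \<open>\<integral> exp (- \<i> x \<bullet> \<xi>) g x dx\<close>.
  The integral is real since the symbol is even.\<close>

definition heat_kernel :: "real \<Rightarrow> real \<Rightarrow> real^'n \<Rightarrow> real" where
  "heat_kernel m t x =
     Re (LINT \<xi>|lborel. cis (x \<bullet> \<xi>) * complex_of_real (exp (- t * norm \<xi> powr (2 * m))))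
       / (2 * pi) ^ CARD('n)"

definition heat_semigroup :: "real \<Rightarrow> real \<Rightarrow> (real^'n \<Rightarrow> real) \<Rightarrow> real^'n \<Rightarrow> real" where
  "heat_semigroup m t f x = (LINT y|lebesgue. heat_kernel m t (x - y) * f y)"

definition duhamel_integrand ::
  "real \<Rightarrow> real \<Rightarrow> (real \<Rightarrow> real) \<Rightarrow> (real \<Rightarrow> real^'n \<Rightarrow> real) \<Rightarrow> real \<Rightarrow> real^'n \<Rightarrow> real \<Rightarrow> real" where
  "duhamel_integrand m \<alpha> F u t x \<tau> =
     heat_semigroup m (t - \<tau>) (\<lambda>y. norm y powr (- \<alpha>) * F (u \<tau> y)) x"

text \<open>The time integral is a Lebesgue integral at almost every \<open>x\<close>. At the scaling-critical exponent
  it need not converge as a Bochner integral with values in \<open>L\<^bsup>q,\<infinity>\<^esup>\<close>. Integrability is stated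
  because a non-integrable function has integral \<open>0\<close> by convention.\<close>

definition integral_solution ::
  "real \<Rightarrow> real \<Rightarrow> (real \<Rightarrow> real) \<Rightarrow> (real^'n \<Rightarrow> real) \<Rightarrow> (real \<Rightarrow> real^'n \<Rightarrow> real) \<Rightarrow> bool" where
  "integral_solution m \<alpha> F u0 u \<longleftrightarrow>
     (AE x in lebesgue. u 0 x = u0 x) \<and>
     (\<forall>t>0. AE x in lebesgue.
        set_integrable lborel {0<..<t} (duhamel_integrand m \<alpha> F u t x) \<and>
        u t x = heat_semigroup m t u0 x + (LINT \<tau>:{0<..<t}|lborel. duhamel_integrand m \<alpha> F u t x \<tau>))"

section \<open>Bounded continuous functions of time and small solutions\<close>

definition sup_weak_norm :: "real \<Rightarrow> (real \<Rightarrow> real^'n \<Rightarrow> real) \<Rightarrow> ennreal" where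
  "sup_weak_norm q u = (SUP t\<in>{0<..}. weak_norm q (u t))"

text \<open>\<open>C\<^sub>b([0,\<infinity>); L\<^bsup>q,\<infinity>\<^esup>)\<close>: continuous in norm at every positive time, weak-star continuous at time \<open>0\<close>.\<close>

definition bounded_cont :: "real \<Rightarrow> (real \<Rightarrow> real^'n \<Rightarrow> real) set" where
  "bounded_cont q = {u.
     (\<forall>t\<ge>0. u t \<in> weak_L q) \<and>
     sup_weak_norm q u < \<infinity> \<and>
     (\<forall>s>0. ((\<lambda>t. weak_norm q (\<lambda>x. u t x - u s x)) \<longlongrightarrow> 0) (at s)) \<and>
     (\<forall>\<psi>\<in>lorentz_1 (q / (q - 1)).
        ((\<lambda>t. LINT x|lebesgue. u t x * \<psi> x) \<longlongrightarrow> (LINT x|lebesgue. u 0 x * \<psi> x)) (at_right 0))}"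

text \<open>Membership in the ball of radius \<open>2 * \<theta>\<close> in which the small global solution is sought. For data of
  norm below a small \<open>\<epsilon>\<close> and \<open>\<theta>\<close> a suitable multiple of \<open>\<epsilon>\<close> there is exactly one such \<open>u\<close>, up to
  null sets at each time; neither existence nor uniqueness is built into the predicate.\<close>

definition small_solution ::
  "real \<Rightarrow> real \<Rightarrow> (real \<Rightarrow> real) \<Rightarrow> real \<Rightarrow> real \<Rightarrow> (real^'n \<Rightarrow> real) \<Rightarrow> (real \<Rightarrow> real^'n \<Rightarrow> real) \<Rightarrow> bool" where
  "small_solution m \<alpha> F q \<theta> u0 u \<longleftrightarrow>
     u \<in> bounded_cont q \<and> sup_weak_norm q u \<le> ennreal (2 * \<theta>) \<and> integral_solution m \<alpha> F u0 u"

section \<open>Homogeneity and self-similarity\<close>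

definition homogeneous_ae :: "real \<Rightarrow> (real^'n \<Rightarrow> real) \<Rightarrow> bool" where
  "homogeneous_ae d f \<longleftrightarrow> (\<forall>\<sigma>>0. AE x in lebesgue. f (\<sigma> *\<^sub>R x) = \<sigma> powr d * f x)"

definition self_similar :: "real \<Rightarrow> real \<Rightarrow> (real \<Rightarrow> real^'n \<Rightarrow> real) \<Rightarrow> bool" where
  "self_similar m b w \<longleftrightarrow>
     (\<forall>\<sigma>>0. \<forall>t\<ge>0. AE x in lebesgue. w t x = \<sigma> powr b * w (\<sigma> powr (2 * m) * t) (\<sigma> *\<^sub>R x))"

end

theory Submission
  imports Defs "HOL-Real_Asymp.Real_Asymp"
begin

text \<open>
  Write \<open>G(t)\<close> for the semigroup, \<open>q\<close> for \<open>qc\<close>, \<open>n\<close> for the dimension and \<open>v = u - w\<close>. Subtracting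
  the two integral equations gives
  \<open>v(t) = G(t) \<phi> + \<integral>\<^sub>0\<^sup>t G(t - \<tau>) h(\<tau>) d\<tau>\<close> with \<open>h = |x| powr -\<alpha> * (F(u) - F(w))\<close>.

  The linear part tends to \<open>0\<close>: \<open>G(t)\<close> is bounded on \<open>L\<^bsup>q,\<infinity>\<^esup>\<close> uniformly in \<open>t\<close>, so that \<open>\<phi>\<close> may be
  replaced by a Schwartz function, and for an integrable function the decay follows from the decay of
  the kernel in \<open>L\<^bsup>\<infinity>\<^esup>\<close> (\<open>heat_semigroup_schwartz_closure_decay\<close>).

  For the source, Hoelder's inequality in weak spaces bounds \<open>h\<close> in \<open>L\<^bsup>r,\<infinity>\<^esup>\<close> by \<open>|v|\<close> times the power
  \<open>p - 1\<close> of the sizes of \<open>u\<close> and \<open>w\<close>, where \<open>1/r = \<alpha>/n + p/q\<close> (\<open>nonlinearity_weak_type\<close>). The scaling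
  of the equation makes this \<open>1/q + 2m/n\<close>, which is critical: the norm of \<open>G(s)\<close> from \<open>L\<^bsup>r,\<infinity>\<^esup>\<close> to
  \<open>L\<^bsup>q,\<infinity>\<^esup>\<close> is of order \<open>1/s\<close>, and the integral of the norms diverges. The time integral is nevertheless
  bounded. On \<open>L\<^bsup>r,\<infinity>\<^esup>\<close> the operators \<open>G(s)\<close> are uniformly bounded, and into \<open>L\<^bsup>\<infinity>\<^esup>\<close> they decay like
  \<open>s powr -e\<close> with \<open>e = n/(2mr) > 1\<close>. Estimating a level set of the integral, one uses the first bound
  for \<open>t - \<tau> < d\<close> and the second one for \<open>t - \<tau> \<ge> d\<close>, and chooses \<open>d\<close> depending on the height of the
  level; the outcome is exactly a bound in \<open>L\<^bsup>q,\<infinity>\<^esup>\<close> (\<open>weak_type_time_integral_critical\<close>).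

  Suppose now that \<open>v\<close> has size at most \<open>A\<close> on \<open>(T, \<infinity>)\<close>. The part of the integral over \<open>(0, T)\<close> tends
  to \<open>0\<close> as \<open>t \<rightarrow> \<infinity>\<close>, and the part over \<open>(T, t)\<close> is at most a constant times \<open>A * M powr (p - 1)\<close>,
  where \<open>M\<close> bounds \<open>u\<close> and \<open>w\<close> (\<open>difference_contraction\<close>). If \<open>M\<close> is small, \<open>v\<close> is eventually of size at
  most \<open>A/2\<close>, and iteration gives the limit \<open>0\<close>.

  Two points need care. All that is used of the kernel is that at time \<open>1\<close> it is continuous, bounded
  and integrable; all other times follow by scaling. Integrability is proved by integration by parts if
  \<open>m\<close> is an integer. If \<open>0 < m < 1\<close>, the symbol is not smooth at the origin; it is a limit of products
  of convex combinations of Gaussians, because \<open>1 - (1 - x) powr m\<close> has nonnegative Taylor coefficients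
  with sum \<open>1\<close>, and the transforms of all Gaussians have the same \<open>L\<^sup>1\<close> norm. Secondly, a solution need
  not be jointly measurable in time and space. The integrand \<open>G(t - \<tau>) h(\<tau>)\<close> is, since it is continuous in
  space at every time and measurable in time at almost every point
  (\<open>Caratheodory_jointly_measurable\<close>).
\<close>

section \<open>Weak-type bounds\<close>

text \<open>Membership in \<open>L\<^bsup>q,\<infinity>\<^esup>\<close> expressed by level sets. Up to the factor \<open>q / (q - 1)\<close> this is
\<^const>\<open>weak_norm\<close>, but sums, products and time integrals are handled by inclusions between level sets
instead of rearrangements. The values are in \<^typ>\<open>ennreal\<close> so that integrals of absolute values can be
inserted before they are known to be finite.\<close>

definition weak_type :: "real \<Rightarrow> real \<Rightarrow> ('a::euclidean_space \<Rightarrow> ennreal) \<Rightarrow> bool" where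
  "weak_type q A f \<longleftrightarrow> f \<in> borel_measurable lebesgue \<and>
     (\<forall>l>0. emeasure lebesgue {x. ennreal l < f x} \<le> ennreal ((A / l) powr q))"

abbreviation weak_bound :: "real \<Rightarrow> real \<Rightarrow> ('a::euclidean_space \<Rightarrow> real) \<Rightarrow> bool" where
  "weak_bound q A f \<equiv> weak_type q A (\<lambda>x. ennreal \<bar>f x\<bar>)"

abbreviation L1_norm :: "('a::euclidean_space \<Rightarrow> real) \<Rightarrow> ennreal" where
  "L1_norm f \<equiv> \<integral>\<^sup>+ x. ennreal \<bar>f x\<bar> \<partial>lborel"

lemma weak_type_measurable [dest]: "weak_type q A f \<Longrightarrow> f \<in> borel_measurable lebesgue"
  by (simp add: weak_type_def)

lemma weak_typeD: "weak_type q A f \<Longrightarrow> 0 < l \<Longrightarrow> emeasure lebesgue {x. ennreal l < f x} \<le> ennreal ((A / l) powr q)"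
  by (simp add: weak_type_def)

lemma superlevel_sets [measurable]:
  fixes f :: "'a::euclidean_space \<Rightarrow> ennreal"
  assumes [measurable]: "f \<in> borel_measurable lebesgue"
  shows "{x. ennreal l < f x} \<in> sets lebesgue"
proof -
  have "{x. ennreal l < f x} = {x \<in> space lebesgue. ennreal l < f x}" by simp
  also have "\<dots> \<in> sets lebesgue" by measurable
  finally show ?thesis .
qed

lemma weak_type_mono:
  assumes f: "weak_type q A f" and "0 \<le> A" "A \<le> B" "0 \<le> q"
    and g: "g \<in> borel_measurable lebesgue" "AE x in lebesgue. g x \<le> f x"
  shows "weak_type q B g"
  unfolding weak_type_def
proof (intro conjI allI impI g)
  fix l :: real assume l: "0 < l"
  have "emeasure lebesgue {x. ennreal l < g x} \<le> emeasure lebesgue {x. ennreal l < f x}"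
    using g f by (intro emeasure_mono_AE superlevel_sets) auto
  also have "\<dots> \<le> ennreal ((A / l) powr q)" using weak_typeD[OF f l] .
  also have "\<dots> \<le> ennreal ((B / l) powr q)"
    using assms l by (intro ennreal_leI powr_mono2 divide_right_mono) auto
  finally show "emeasure lebesgue {x. ennreal l < g x} \<le> ennreal ((B / l) powr q)" .
qed

text \<open>If the level set at height \<open>l\<close> has measure above \<open>s\<close>, then the rearrangement is at least \<open>l\<close> on
\<open>(0, s)\<close>, hence so is its average, and the norm is at least \<open>s powr (1 / q) * l\<close>.\<close>

lemma weak_norm_imp_weak_type:
  fixes f :: "real^'n \<Rightarrow> real"
  assumes f: "f \<in> borel_measurable lebesgue" and le: "weak_norm q f \<le> ennreal A"
    and A: "0 \<le> A" and q: "0 < q"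
  shows "weak_bound q A f"
  unfolding weak_type_def
proof (intro conjI allI impI)
  show "(\<lambda>x. ennreal \<bar>f x\<bar>) \<in> borel_measurable lebesgue" using f by measurable
  fix l :: real assume l: "0 < l"
  have eq: "{x. ennreal l < ennreal \<bar>f x\<bar>} = {x. l < \<bar>f x\<bar>}"
    using l by (auto simp: ennreal_less_iff)
  show "emeasure lebesgue {x. ennreal l < ennreal \<bar>f x\<bar>} \<le> ennreal ((A / l) powr q)"
    unfolding eq
  proof (rule dense_le)
    fix y assume y: "y < emeasure lebesgue {x. l < \<bar>f x\<bar>}"
    have "y < top" using y by (rule less_le_trans) simp
    hence s: "y = ennreal (enn2real y)" "0 \<le> enn2real y" by simp_all
    define s where "s = enn2real y"
    note s = s[folded s_def]
    show "y \<le> ennreal ((A / l) powr q)"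
    proof (cases "s = 0")
      case False
      hence s0: "0 < s" using s by simp
      have re: "ennreal l \<le> rearrangement f a" if "a \<in> {0<..<s}" for a
        unfolding rearrangement_def
      proof (rule INF_greatest)
        fix \<tau> assume \<tau>: "\<tau> \<in> {\<tau>. 0 < \<tau> \<and> emeasure lebesgue {x. \<tau> < \<bar>f x\<bar>} \<le> ennreal a}"
        show "ennreal l \<le> ennreal \<tau>"
        proof (rule ccontr)
          assume "\<not> ennreal l \<le> ennreal \<tau>"
          hence "\<tau> < l" by (metis ennreal_leI not_le)
          have "emeasure lebesgue {x. l < \<bar>f x\<bar>} \<le> emeasure lebesgue {x. \<tau> < \<bar>f x\<bar>}"
          proof (rule emeasure_mono)
            have "{x. \<tau> < \<bar>f x\<bar>} = {x \<in> space lebesgue. \<tau> < \<bar>f x\<bar>}" by simp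
            also have "\<dots> \<in> sets lebesgue" using f by measurable
            finally show "{x. \<tau> < \<bar>f x\<bar>} \<in> sets lebesgue" .
          qed (use \<open>\<tau> < l\<close> in auto)
          also have "\<dots> \<le> ennreal a" using \<tau> by simp
          also have "\<dots> \<le> y" using that s by (simp add: ennreal_leI)
          finally show False using y by simp
        qed
      qed
      have "ennreal (s * l) = ennreal l * emeasure lborel {0<..<s}"
        using s0 l by (simp add: ennreal_mult' mult.commute)
      also have "\<dots> = (\<integral>\<^sup>+ a\<in>{0<..<s}. ennreal l \<partial>lborel)"
        by (subst nn_integral_cmult_indicator) auto
      also have "\<dots> \<le> (\<integral>\<^sup>+ a\<in>{0<..<s}. rearrangement f a \<partial>lborel)"
        using re by (intro nn_integral_mono) (auto simp: indicator_def)
      finally have I: "ennreal (s * l) \<le> (\<integral>\<^sup>+ a\<in>{0<..<s}. rearrangement f a \<partial>lborel)" .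
      have "ennreal l = ennreal (1 / s) * ennreal (s * l)"
        using s0 l by (simp flip: ennreal_mult')
      also have "\<dots> \<le> avg_rearrangement f s"
        unfolding avg_rearrangement_def using I by (intro mult_left_mono) auto
      finally have "ennreal (s powr (1 / q)) * ennreal l \<le> ennreal (s powr (1 / q)) * avg_rearrangement f s"
        by (intro mult_left_mono) auto
      also have "\<dots> \<le> weak_norm q f"
        unfolding weak_norm_def using s0 by (intro SUP_upper) auto
      also have "\<dots> \<le> ennreal A" by fact
      finally have "s powr (1 / q) * l \<le> A"
        using A l by (simp add: ennreal_mult'[symmetric])
      hence "s powr (1 / q) \<le> A / l" using l by (simp add: field_simps)
      hence "(s powr (1 / q)) powr q \<le> (A / l) powr q"
        using q by (intro powr_mono2) auto
      hence "s \<le> (A / l) powr q" using s0 q by (simp add: powr_powr)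
      thus ?thesis using s by (simp add: ennreal_leI)
    qed (use s in simp)
  qed
qed

lemma nn_integral_powr_0:
  fixes a s :: real
  assumes "0 < a" "0 < s"
  shows "(\<integral>\<^sup>+ l\<in>{0<..<s}. ennreal (l powr (a - 1)) \<partial>lborel) = ennreal (s powr a / a)"
proof -
  have ae: "AE l in lborel. l \<noteq> 0 \<and> l \<noteq> s"
    using AE_lborel_singleton[of 0] AE_lborel_singleton[of s] by eventually_elim simp
  have "((\<lambda>x. x powr (a - 1)) has_integral (s powr (a - 1 + 1) / (a - 1 + 1))) {0..s}"
    using has_integral_powr_from_0[of "a - 1" s] assms by simp
  hence I: "((\<lambda>x. x powr (a - 1)) has_integral (s powr a / a)) {0..s}" by simp
  have "(\<integral>\<^sup>+ l. ennreal (indicator {0..s} l * (l powr (a - 1))) \<partial>lborel) = ennreal (s powr a / a)"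
    using I by (intro nn_integral_has_integral_lebesgue) auto
  moreover have "(\<integral>\<^sup>+ l\<in>{0<..<s}. ennreal (l powr (a - 1)) \<partial>lborel) = (\<integral>\<^sup>+ l. ennreal (indicator {0..s} l * (l powr (a - 1))) \<partial>lborel)"
    using ae by (intro nn_integral_cong_AE) (auto simp: indicator_def)
  ultimately show ?thesis by simp
qed

text \<open>The level set bound says that the rearrangement is at most \<open>A * l powr (- 1 / q)\<close>, which is integrable
at \<open>0\<close> because \<open>q > 1\<close>; its average produces the factor \<open>q / (q - 1)\<close>.\<close>

lemma weak_type_imp_weak_norm:
  fixes f :: "real^'n \<Rightarrow> real"
  assumes f: "weak_bound q A f" and A: "0 < A" and q: "1 < q"
  shows "weak_norm q f \<le> ennreal (q / (q - 1) * A)"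
  unfolding weak_norm_def
proof (rule SUP_least)
  fix s :: real assume "s \<in> {0<..}"
  hence s: "0 < s" by simp
  define a where "a = 1 - 1 / q"
  have a: "0 < a" "1 / q = 1 - a" "q / (q - 1) = 1 / a" and aq: "(1 - a) * q = 1"
    using q by (auto simp: a_def field_simps)
  have re: "rearrangement f l \<le> ennreal (A * l powr (a - 1))" if "l \<in> {0<..<s}" for l
    unfolding rearrangement_def
  proof (rule INF_lower)
    have l: "0 < l" using that by simp
    define t where "t = A * l powr (a - 1)"
    have t: "0 < t" unfolding t_def using A l by (intro mult_pos_pos) simp_all
    have "emeasure lebesgue {x. t < \<bar>f x\<bar>} = emeasure lebesgue {x. ennreal t < ennreal \<bar>f x\<bar>}"
      using t by (intro arg_cong[where f = "emeasure lebesgue"]) (auto simp: ennreal_less_iff)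
    also have "\<dots> \<le> ennreal ((A / t) powr q)"
      using f t by (rule weak_typeD)
    also have "(A / t) powr q = l"
    proof -
      have "A / t = inverse (l powr (a - 1))" using A by (simp add: t_def field_simps)
      also have "\<dots> = l powr (1 - a)" by (simp flip: powr_minus)
      finally show ?thesis using aq l by (simp add: powr_powr)
    qed
    finally have "emeasure lebesgue {x. t < \<bar>f x\<bar>} \<le> ennreal l" .
    with t show "A * l powr (a - 1) \<in> {\<tau>. 0 < \<tau> \<and> emeasure lebesgue {x. \<tau> < \<bar>f x\<bar>} \<le> ennreal l}"
      unfolding t_def by (intro CollectI conjI)
  qed
  have "(\<integral>\<^sup>+ l\<in>{0<..<s}. rearrangement f l \<partial>lborel) \<le>
      (\<integral>\<^sup>+ l. ennreal A * (ennreal (l powr (a - 1)) * indicator {0<..<s} l) \<partial>lborel)"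
  proof (rule nn_integral_mono)
    fix l :: real
    show "rearrangement f l * indicator {0<..<s} l \<le>
        ennreal A * (ennreal (l powr (a - 1)) * indicator {0<..<s} l)"
      using re[of l] A by (cases "l \<in> {0<..<s}") (simp_all add: ennreal_mult')
  qed
  also have "\<dots> = ennreal A * ennreal (s powr a / a)"
    using a s by (subst nn_integral_cmult) (auto simp: nn_integral_powr_0)
  finally have I: "(\<integral>\<^sup>+ l\<in>{0<..<s}. rearrangement f l \<partial>lborel) \<le> ennreal (A * (s powr a / a))"
    using ennreal_mult'[of A "s powr a / a"] A by (simp only: less_imp_le)
  have "ennreal (s powr (1 / q)) * avg_rearrangement f s \<le>
      ennreal (s powr (1 - a)) * (ennreal (1 / s) * ennreal (A * (s powr a / a)))"
    unfolding avg_rearrangement_def a(2) using I by (intro mult_left_mono) auto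
  also have "\<dots> = ennreal (s powr (1 - a) * (1 / s * (A * (s powr a / a))))"
    using s A by (simp only: ennreal_mult'[symmetric] powr_ge_zero zero_le_divide_1_iff less_imp_le)
  also have "s powr (1 - a) * (1 / s * (A * (s powr a / a))) = q / (q - 1) * A"
    using s a by (simp add: powr_diff)
  finally show "ennreal (s powr (1 / q)) * avg_rearrangement f s \<le> ennreal (q / (q - 1) * A)" .
qed

lemma double_le_powr:
  fixes x :: real
  assumes "1 \<le> q" "0 \<le> x"
  shows "2 * x powr q \<le> (2 * x) powr q"
proof -
  have "2 powr 1 \<le> 2 powr q" using assms by (intro powr_mono) auto
  hence "2 * x powr q \<le> 2 powr q * x powr q" by (intro mult_right_mono) auto
  thus ?thesis using assms by (simp add: powr_mult)
qed

text \<open>The common shape of the estimates for sums and products: a level set is covered by a level set of each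
of two functions, both of the measure that one wants.\<close>

lemma weak_type_union:
  fixes f g h :: "'a::euclidean_space \<Rightarrow> ennreal"
  assumes f: "f \<in> borel_measurable lebesgue" and g: "g \<in> borel_measurable lebesgue"
    and incl: "{x. ennreal l < h x} \<subseteq> {x. ennreal a < f x} \<union> {x. ennreal b < g x}"
    and "emeasure lebesgue {x. ennreal a < f x} \<le> ennreal (B powr q)"
    and "emeasure lebesgue {x. ennreal b < g x} \<le> ennreal (B powr q)"
    and q: "1 \<le> q" and B: "0 \<le> B"
  shows "emeasure lebesgue {x. ennreal l < h x} \<le> ennreal ((2 * B) powr q)"
proof -
  have "emeasure lebesgue {x. ennreal l < h x} \<le>
      emeasure lebesgue ({x. ennreal a < f x} \<union> {x. ennreal b < g x})"
    using incl f g by (intro emeasure_mono sets.Un superlevel_sets) auto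
  also have "\<dots> \<le> emeasure lebesgue {x. ennreal a < f x} + emeasure lebesgue {x. ennreal b < g x}"
    using f g by (intro emeasure_subadditive superlevel_sets)
  also have "\<dots> \<le> ennreal (B powr q) + ennreal (B powr q)"
    using assms by (intro add_mono)
  also have "\<dots> = ennreal (2 * B powr q)" by (simp flip: ennreal_plus)
  also have "\<dots> \<le> ennreal ((2 * B) powr q)"
    using q B by (intro ennreal_leI double_le_powr)
  finally show ?thesis .
qed

lemma weak_type_add:
  assumes f: "weak_type q A f" and g: "weak_type q A g" and q: "1 \<le> q" and A: "0 \<le> A"
  shows "weak_type q (4 * A) (\<lambda>x. f x + g x)"
  unfolding weak_type_def
proof (intro conjI allI impI)
  show "(\<lambda>x. f x + g x) \<in> borel_measurable lebesgue" using f g by (intro borel_measurable_add) auto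
  fix l :: real assume l: "0 < l"
  have incl: "{x. ennreal l < f x + g x} \<subseteq> {x. ennreal (l/2) < f x} \<union> {x. ennreal (l/2) < g x}"
  proof (rule subsetI, rule ccontr)
    fix x assume x: "x \<in> {x. ennreal l < f x + g x}"
      "x \<notin> {x. ennreal (l/2) < f x} \<union> {x. ennreal (l/2) < g x}"
    hence "f x + g x \<le> ennreal (l/2) + ennreal (l/2)" by (intro add_mono) auto
    also have "\<dots> = ennreal l" using l by (simp flip: ennreal_plus)
    finally show False using x by simp
  qed
  have "emeasure lebesgue {x. ennreal l < f x + g x} \<le> ennreal ((2 * (A / (l/2))) powr q)"
    using f g l q A by (intro weak_type_union[OF _ _ incl] weak_typeD) auto
  thus "emeasure lebesgue {x. ennreal l < f x + g x} \<le> ennreal ((4 * A / l) powr q)"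
    by simp
qed

text \<open>Hoelder's inequality for weak spaces. The height \<open>l\<close> of the product is split as \<open>a * (l / a)\<close> with \<open>a\<close>
chosen such that both level sets have the same measure bound.\<close>

lemma weak_type_mult:
  assumes f: "weak_type q1 A f" and g: "weak_type q2 B g"
    and q: "1 \<le> q" "0 < q1" "0 < q2" "1 / q = 1 / q1 + 1 / q2" and A: "0 < A" "0 < B"
  shows "weak_type q (2 * (A * B)) (\<lambda>x. f x * g x)"
  unfolding weak_type_def
proof (intro conjI allI impI)
  show "(\<lambda>x. f x * g x) \<in> borel_measurable lebesgue" using f g by (intro borel_measurable_times_ennreal weak_type_measurable)
  fix l :: real assume l: "0 < l"
  define s where "s = A * B / l"
  \<comment> \<open>chosen such that \<open>(A / a) powr q1\<close> and \<open>(B / (l / a)) powr q2\<close> both equal \<open>s powr q\<close>\<close>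
  define a where "a = A * s powr (- (q / q1))"
  have s: "0 < s" and a: "0 < a" using A l by (auto simp: s_def a_def)
  have "A / a = s powr (q / q1)" using A s by (simp add: a_def powr_minus field_simps)
  hence A1: "(A / a) powr q1 = s powr q" using q s by (simp add: powr_powr)
  have e: "1 - q / q1 = q / q2"
  proof -
    have "q * (1 / q) = q / q1 + q / q2" unfolding q(4) by (simp add: distrib_left)
    moreover have "q * (1 / q) = 1" using q(1) by simp
    ultimately show ?thesis by simp
  qed
  have "B / (l / a) = s * s powr (- (q / q1))" using l by (simp add: a_def s_def field_simps)
  also have "\<dots> = s powr (1 - q / q1)" using s by (simp add: powr_minus powr_diff field_simps)
  finally have "B / (l / a) = s powr (q / q2)" using e by simp
  hence B1: "(B / (l / a)) powr q2 = s powr q" using q s by (simp add: powr_powr)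
  have incl: "{x. ennreal l < f x * g x} \<subseteq> {x. ennreal a < f x} \<union> {x. ennreal (l / a) < g x}"
  proof (rule subsetI, rule ccontr)
    fix x assume x: "x \<in> {x. ennreal l < f x * g x}"
      "x \<notin> {x. ennreal a < f x} \<union> {x. ennreal (l / a) < g x}"
    hence "f x * g x \<le> ennreal a * ennreal (l / a)" by (intro mult_mono) auto
    also have "\<dots> = ennreal l" using l a by (simp flip: ennreal_mult')
    finally show False using x by simp
  qed
  have "emeasure lebesgue {x. ennreal l < f x * g x} \<le> ennreal ((2 * s) powr q)"
  proof (rule weak_type_union[OF _ _ incl])
    show "emeasure lebesgue {x. ennreal a < f x} \<le> ennreal (s powr q)"
      using weak_typeD[OF f a] unfolding A1 .
    have "0 < l / a" using l a by simp
    thus "emeasure lebesgue {x. ennreal (l / a) < g x} \<le> ennreal (s powr q)"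
      using weak_typeD[OF g] unfolding B1[symmetric] by blast
  qed (use f g q s in auto)
  thus "emeasure lebesgue {x. ennreal l < f x * g x} \<le> ennreal ((2 * (A * B) / l) powr q)"
    by (simp add: s_def)
qed

lemma weak_type_cmult:
  assumes f: "weak_type q A f" and c: "0 < c" 
  shows "weak_type q (c * A) (\<lambda>x. ennreal c * f x)"
  unfolding weak_type_def
proof (intro conjI allI impI)
  show "(\<lambda>x. ennreal c * f x) \<in> borel_measurable lebesgue" using f by (intro borel_measurable_times_ennreal) auto
  fix l :: real assume l: "0 < l"
  have iff: "ennreal l < ennreal c * y \<longleftrightarrow> ennreal (l / c) < y" for y
  proof (cases y)
    case (real r)
    thus ?thesis using c l by (simp add: ennreal_mult'[symmetric] ennreal_less_iff field_simps)
  next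
    case top
    thus ?thesis using c by (simp add: ennreal_mult_top)
  qed
  have "emeasure lebesgue {x. ennreal l < ennreal c * f x} \<le> ennreal ((A / (l / c)) powr q)"
    unfolding iff using f l c by (intro weak_typeD) auto
  thus "emeasure lebesgue {x. ennreal l < ennreal c * f x} \<le> ennreal ((c * A / l) powr q)"
    by (simp add: mult.commute)
qed

text \<open>Interpolation with \<open>L\<^bsup>\<infinity>\<^esup>\<close>: only heights below \<open>L\<close> matter, and there
\<open>(A / l) powr r \<le> (A / l) powr r * (L / l) powr (q - r)\<close>. A small sup bound therefore makes the
\<open>L\<^bsup>q,\<infinity>\<^esup>\<close> size small.\<close>

lemma weak_type_bounded:
  assumes f: "weak_type r A f" and L: "0 < L" "AE x in lebesgue. f x \<le> ennreal L"
    and q: "0 < r" "r < q" and A: "0 < A"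
  shows "weak_type q ((A powr r * L powr (q - r)) powr (1 / q)) f"
  unfolding weak_type_def
proof (intro conjI allI impI)
  show [measurable]: "f \<in> borel_measurable lebesgue" using f by auto
  fix l :: real assume l: "0 < l"
  show "emeasure lebesgue {x. ennreal l < f x} \<le> ennreal (((A powr r * L powr (q - r)) powr (1 / q) / l) powr q)"
  proof (cases "l < L")
    case True
    have "emeasure lebesgue {x. ennreal l < f x} \<le> ennreal ((A / l) powr r)"
      using f l by (rule weak_typeD)
    also have "(A / l) powr r \<le> (A / l) powr r * (L / l) powr (q - r)"
    proof -
      have "1 \<le> (L / l) powr (q - r)" using True l q by (intro ge_one_powr_ge_zero) auto
      thus ?thesis using mult_left_mono[of 1 "(L / l) powr (q - r)" "(A / l) powr r"] by simp
    qed
    also have "\<dots> = A powr r * L powr (q - r) / l powr q"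
      using l A L q by (simp add: powr_divide powr_diff)
    also have "\<dots> = ((A powr r * L powr (q - r)) powr (1 / q) / l) powr q"
      using l q by (simp add: powr_divide powr_powr)
    finally show ?thesis by (simp add: ennreal_leI)
  next
    case False
    have "emeasure lebesgue {x. ennreal l < f x} = emeasure lebesgue ({}::'a set)"
    proof (rule emeasure_eq_AE)
      show "AE x in lebesgue. (x \<in> {x. ennreal l < f x}) = (x \<in> {})"
        using L(2)
      proof eventually_elim
        fix x assume "f x \<le> ennreal L"
        also have "\<dots> \<le> ennreal l" using False by (intro ennreal_leI) simp
        finally show "(x \<in> {x. ennreal l < f x}) = (x \<in> {})" by simp
      qed
    qed (auto intro: superlevel_sets)
    thus ?thesis by simp
  qed
qed

lemma nn_integral_imp_weak_type_1:
  assumes f: "f \<in> borel_measurable lebesgue" and "(\<integral>\<^sup>+ x. f x \<partial>lebesgue) \<le> ennreal A" and A: "0 \<le> A"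
  shows "weak_type 1 A f"
  unfolding weak_type_def
proof (intro conjI allI impI f)
  fix l :: real assume l: "0 < l"
  have "emeasure lebesgue {x. ennreal l < f x} \<le> emeasure lebesgue {x \<in> space lebesgue. 1 \<le> ennreal (1 / l) * f x}"
  proof (rule emeasure_mono)
    show "{x. ennreal l < f x} \<subseteq> {x \<in> space lebesgue. 1 \<le> ennreal (1 / l) * f x}"
    proof safe
      fix x assume "ennreal l < f x"
      hence "ennreal (1 / l) * ennreal l \<le> ennreal (1 / l) * f x" by (intro mult_left_mono) auto
      thus "1 \<le> ennreal (1 / l) * f x" using l by (simp flip: ennreal_mult')
    qed simp
  qed (use f in measurable)
  also have "\<dots> \<le> ennreal (1 / l) * (\<integral>\<^sup>+ x. f x \<partial>lebesgue)"
    using nn_integral_Markov_inequality[of f UNIV lebesgue "ennreal (1 / l)"] f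
    by (simp cong: conj_cong)
  also have "\<dots> \<le> ennreal (1 / l) * ennreal A"
    using assms(2) by (intro mult_left_mono) auto
  also have "\<dots> = ennreal ((A / l) powr 1)" using l A by (simp flip: ennreal_mult')
  finally show "emeasure lebesgue {x. ennreal l < f x} \<le> ennreal ((A / l) powr 1)" .
qed

lemma weak_type_powr:
  assumes f: "weak_bound q A u" and s: "0 < s" and A: "0 \<le> A" and u: "u \<in> borel_measurable lebesgue"
  shows "weak_type (q / s) (A powr s) (\<lambda>x. ennreal (\<bar>u x\<bar> powr s))"
  unfolding weak_type_def
proof (intro conjI allI impI)
  show "(\<lambda>x. ennreal (\<bar>u x\<bar> powr s)) \<in> borel_measurable lebesgue" using u by measurable
  fix l :: real assume l: "0 < l"
  have iff: "ennreal l < ennreal (\<bar>y\<bar> powr s) \<longleftrightarrow> ennreal (l powr (1 / s)) < ennreal \<bar>y\<bar>" for y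
  proof -
    have "ennreal l < ennreal (\<bar>y\<bar> powr s) \<longleftrightarrow> (l powr (1 / s)) powr s < \<bar>y\<bar> powr s"
      using l s by (simp add: powr_powr ennreal_less_iff)
    also have "\<dots> \<longleftrightarrow> l powr (1 / s) < \<bar>y\<bar>"
      using s by (simp add: powr_less_cancel_iff powr_less_mono2 not_less powr_mono2 flip: not_le)
        (metis abs_ge_zero linorder_not_less powr_ge_zero powr_less_mono2 powr_mono2 less_imp_le)
    finally show ?thesis by (simp add: ennreal_less_iff)
  qed
  have "emeasure lebesgue {x. ennreal l < ennreal (\<bar>u x\<bar> powr s)} \<le> ennreal ((A / l powr (1 / s)) powr q)"
    unfolding iff using f l by (intro weak_typeD) auto
  also have "(A / l powr (1 / s)) powr q = (A powr s / l) powr (q / s)"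
    using A l s by (simp add: powr_divide powr_powr)
  finally show "emeasure lebesgue {x. ennreal l < ennreal (\<bar>u x\<bar> powr s)} \<le> ennreal ((A powr s / l) powr (q / s))" .
qed

text \<open>The level sets are balls, so the weight \<open>|x| powr -a\<close> lies in \<open>L\<^bsup>n/a,\<infinity>\<^esup>\<close> and in no strong Lebesgue space.\<close>

lemma weak_type_norm_powr:
  assumes a: "0 < a"
  obtains c where "0 < c" "weak_type (real DIM('a) / a) c (\<lambda>y::'a::euclidean_space. ennreal (norm y powr (- a)))"
proof -
  define V where "V = measure lborel (ball (0::'a) 1)"
  have V: "0 < V" unfolding V_def by (simp add: content_ball unit_ball_vol_pos)
  define N where "N = real DIM('a)"
  have N: "0 < N" by (simp add: N_def)
  have "weak_type (N / a) (V powr (a / N)) (\<lambda>y::'a. ennreal (norm y powr (- a)))"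
    unfolding weak_type_def
  proof (intro conjI allI impI)
    show "(\<lambda>y::'a. ennreal (norm y powr - a)) \<in> borel_measurable lebesgue"
      by (intro measurable_completion) measurable
    fix l :: real assume l: "0 < l"
    let ?\<rho> = "l powr (- (1 / a))"
    have "{x::'a. ennreal l < ennreal (norm x powr (- a))} \<subseteq> ball 0 ?\<rho>"
    proof
      fix x :: 'a assume "x \<in> {x. ennreal l < ennreal (norm x powr (- a))}"
      hence x: "l < norm x powr (- a)" using l by (simp add: ennreal_less_iff)
      show "x \<in> ball 0 ?\<rho>"
      proof (rule ccontr)
        assume "x \<notin> ball 0 ?\<rho>"
        hence "?\<rho> \<le> norm x" by simp
        hence "norm x powr (- a) \<le> ?\<rho> powr (- a)" using a l by (intro powr_mono2') auto
        also have "\<dots> = l" using a l by (simp add: powr_powr)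
        finally show False using x by simp
      qed
    qed
    hence "emeasure lebesgue {x::'a. ennreal l < ennreal (norm x powr (- a))} \<le> emeasure lebesgue (ball (0::'a) ?\<rho>)"
      by (intro emeasure_mono) auto
    also have "\<dots> = emeasure lborel (ball (0::'a) ?\<rho>)" by simp
    also have "\<dots> = ennreal (V * ?\<rho> ^ DIM('a))"
      using l by (simp add: emeasure_ball V_def content_ball)
    also have "V * ?\<rho> ^ DIM('a) = (V powr (a / N) / l) powr (N / a)"
    proof -
      have "?\<rho> ^ DIM('a) = l powr (- (N / a))"
        using l by (simp add: powr_powr N_def flip: powr_realpow)
      thus ?thesis using l a N V by (simp add: powr_divide powr_powr powr_minus field_simps)
    qed
    finally show "emeasure lebesgue {x::'a. ennreal l < ennreal (norm x powr (- a))} \<le> ennreal ((V powr (a / N) / l) powr (N / a))" .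
  qed
  thus ?thesis using that[of "V powr (a / N)"] V by (simp add: N_def)
qed

lemma weak_type_diff:
  fixes u w :: "'a::euclidean_space \<Rightarrow> real"
  assumes u: "u \<in> borel_measurable lebesgue" "weak_bound q A u"
    and w: "w \<in> borel_measurable lebesgue" "weak_bound q A w"
    and q: "1 \<le> q" and A: "0 \<le> A"
  shows "weak_bound q (4 * A) (\<lambda>x. u x - w x)"
proof (rule weak_type_mono)
  show "weak_type q (4 * A) (\<lambda>x. ennreal \<bar>u x\<bar> + ennreal \<bar>w x\<bar>)"
    using u(2) w(2) q A by (rule weak_type_add)
  show "(\<lambda>x. ennreal \<bar>u x - w x\<bar>) \<in> borel_measurable lebesgue"
    using u(1) w(1) by measurable
  show "AE x in lebesgue. ennreal \<bar>u x - w x\<bar> \<le> ennreal \<bar>u x\<bar> + ennreal \<bar>w x\<bar>"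
    by (intro AE_I2) (simp add: ennreal_leI flip: ennreal_plus)
qed (use A q in auto)

section \<open>Convolution with integrable bounded kernels\<close>

definition tail_const :: "real \<Rightarrow> real" where "tail_const r = 2 / (1 - 2 powr (1 - r))"

lemma tail_const_pos: "1 < r \<Longrightarrow> 0 < tail_const r"
  by (simp add: tail_const_def powr_less_one)

text \<open>For \<open>r > 1\<close> the part of \<open>f\<close> above height \<open>l\<close> is integrable. Cutting it at the heights \<open>2 ^ k * l\<close> bounds
the integral by a geometric series of ratio \<open>2 powr (1 - r)\<close>.\<close>

lemma weak_type_tail:
  fixes f :: "'a::euclidean_space \<Rightarrow> real"
  assumes f: "weak_bound r A f" and fm[measurable]: "f \<in> borel_measurable lebesgue"
    and r: "1 < r" and A: "0 < A" and l: "0 < l"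
  shows "(\<integral>\<^sup>+ x. ennreal \<bar>f x\<bar> * indicator {x. l < \<bar>f x\<bar>} x \<partial>lebesgue) \<le>
    ennreal (tail_const r * A powr r * l powr (1 - r))"
proof -
  define E where "E k = {x \<in> space lebesgue. 2 ^ k * l < \<bar>f x\<bar>}" for k :: nat
  have [measurable]: "E k \<in> sets lebesgue" for k unfolding E_def by measurable
  define c where "c = 2 * A powr r * l powr (1 - r)"
  define z where "z = 2 powr (1 - r)"
  have z: "0 < z" "z < 1" using r by (auto simp: z_def powr_less_one)
  have c: "0 \<le> c" by (simp add: c_def)
  have pt: "ennreal \<bar>f x\<bar> * indicator {x. l < \<bar>f x\<bar>} x \<le> (\<Sum>k. ennreal (2 ^ (k + 1) * l) * indicator (E k) x)" for x
  proof (cases "l < \<bar>f x\<bar>")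
    case True
    define P where "P j \<longleftrightarrow> \<bar>f x\<bar> \<le> 2 ^ (j + 1) * l" for j :: nat
    \<comment> \<open>the least \<open>k\<close> with \<open>|f x| \<le> 2 ^ (k + 1) * l\<close> gives a term of the series above \<open>|f x|\<close>\<close>
    obtain n where "\<bar>f x\<bar> / l < 2 ^ n" using real_arch_pow[of 2 "\<bar>f x\<bar> / l"] by auto
    hence "\<bar>f x\<bar> \<le> 2 ^ n * l" using l by (simp add: field_simps)
    also have "\<dots> \<le> 2 ^ (n + 1) * l" using l by simp
    finally have "P n" by (simp add: P_def)
    define k where "k = (LEAST j. P j)"
    have Pk: "P k" unfolding k_def using \<open>P n\<close> by (rule LeastI)
    have "2 ^ k * l < \<bar>f x\<bar>"
    proof (cases k)
      case (Suc j)
      hence "\<not> P j" unfolding k_def by (intro not_less_Least) simp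
      thus ?thesis using Suc by (simp add: P_def)
    qed (use True in simp)
    hence xE: "x \<in> E k" by (simp add: E_def)
    have "ennreal \<bar>f x\<bar> * indicator {x. l < \<bar>f x\<bar>} x \<le> (\<Sum>k\<in>{k}. ennreal (2 ^ (k + 1) * l) * indicator (E k) x)"
      using Pk True xE by (simp add: P_def ennreal_leI)
    also have "\<dots> \<le> (\<Sum>k. ennreal (2 ^ (k + 1) * l) * indicator (E k) x)"
      by (intro sum_le_suminf) auto
    finally show ?thesis .
  qed simp
  have termk: "ennreal (2 ^ (k + 1) * l) * emeasure lebesgue (E k) \<le> ennreal (c * z ^ k)" for k
  proof -
    have E: "E k = {x. ennreal (2 ^ k * l) < ennreal \<bar>f x\<bar>}"
      using l by (auto simp: E_def ennreal_less_iff)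
    have "ennreal (2 ^ (k + 1) * l) * emeasure lebesgue (E k) \<le>
        ennreal (2 ^ (k + 1) * l) * ennreal ((A / (2 ^ k * l)) powr r)"
      unfolding E using f l by (intro mult_left_mono weak_typeD) auto
    also have "\<dots> = ennreal (2 ^ (k + 1) * l * (A / (2 ^ k * l)) powr r)"
      using l by (simp add: ennreal_mult')
    also have "2 ^ (k + 1) * l * (A / (2 ^ k * l)) powr r = c * z ^ k"
    proof -
      have p: "(2::real) ^ k = 2 powr k" by (simp add: powr_realpow)
      have zk: "z ^ k = 2 powr k / (2 powr k) powr r"
        unfolding z_def by (simp add: powr_realpow[symmetric] powr_powr powr_diff[symmetric] algebra_simps)
      have "(A / (2 ^ k * l)) powr r = A powr r / ((2 powr k) powr r * l powr r)"
        using A l by (simp add: powr_divide powr_mult p)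
      moreover have "l powr (1 - r) = l / l powr r" using l by (simp add: powr_diff)
      ultimately show ?thesis unfolding zk c_def using l by (simp add: p mult_ac)
    qed
    finally show ?thesis .
  qed
  have "(\<integral>\<^sup>+ x. ennreal \<bar>f x\<bar> * indicator {x. l < \<bar>f x\<bar>} x \<partial>lebesgue) \<le>
      (\<integral>\<^sup>+ x. (\<Sum>k. ennreal (2 ^ (k + 1) * l) * indicator (E k) x) \<partial>lebesgue)"
    by (intro nn_integral_mono pt)
  also have "\<dots> = (\<Sum>k. \<integral>\<^sup>+ x. ennreal (2 ^ (k + 1) * l) * indicator (E k) x \<partial>lebesgue)"
    by (intro nn_integral_suminf) measurable
  also have "\<dots> = (\<Sum>k. ennreal (2 ^ (k + 1) * l) * emeasure lebesgue (E k))"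
    by (intro suminf_cong nn_integral_cmult_indicator) measurable
  also have "\<dots> \<le> (\<Sum>k. ennreal (c * z ^ k))"
    by (intro suminf_le termk) auto
  also have "\<dots> = ennreal (\<Sum>k. c * z ^ k)"
    using c z by (intro suminf_ennreal2 summable_mult summable_geometric) auto
  also have "(\<Sum>k. c * z ^ k) = c * (1 / (1 - z))"
    using z by (subst suminf_mult) (auto intro: summable_geometric simp: suminf_geometric)
  also have "c * (1 / (1 - z)) = tail_const r * A powr r * l powr (1 - r)"
    by (simp add: c_def tail_const_def z_def)
  finally show ?thesis .
qed

text \<open>The constant of Minkowski's inequality in \<open>L\<^bsup>r,\<infinity>\<^esup>\<close>, both for convolutions with an integrable kernel and for
integrals over a bounded time interval.\<close>

definition mink_const :: "real \<Rightarrow> real" where "mink_const r = 2 * tail_const r powr (1 / r)"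

lemma mink_const_pos: "1 < r \<Longrightarrow> 0 < mink_const r"
  using tail_const_pos[of r] by (simp add: mink_const_def)

text \<open>The weak spaces are normable for \<open>r > 1\<close>, and this is the way in which the triangle inequality is used:
\<open>g\<close> is an average, with total weight \<open>b\<close>, of functions of size \<open>A\<close> in \<open>L\<^bsup>r,\<infinity>\<^esup>\<close>. Cutting these at
height \<open>l\<close> leaves \<open>b * l\<close> and the average \<open>E\<close> of the tails. At \<open>l = l0 / (2 * b)\<close> only \<open>E\<close>
can lift \<open>g\<close> above \<open>l0\<close>, and Markov's inequality applies to it.\<close>

lemma weak_type_truncation:
  fixes g :: "'a::euclidean_space \<Rightarrow> ennreal"
  assumes g: "g \<in> borel_measurable lebesgue" and r: "1 < r" and A: "0 < A" and b: "0 < b"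
    and split: "\<And>l. 0 < l \<Longrightarrow> \<exists>E\<in>borel_measurable lebesgue. (\<forall>x. g x \<le> ennreal (b * l) + E x) \<and>
      (\<integral>\<^sup>+ x. E x \<partial>lebesgue) \<le> ennreal (b * (tail_const r * A powr r * l powr (1 - r)))"
  shows "weak_type r (mink_const r * b * A) g"
  unfolding weak_type_def
proof (intro conjI allI impI g)
  fix l0 :: real assume l0: "0 < l0"
  define l where "l = l0 / (2 * b)"
  have l: "0 < l" "l0 = b * l + b * l" "0 < b * l" using l0 b by (auto simp: l_def)
  obtain E where Em: "E \<in> borel_measurable lebesgue" and gE: "\<And>x. g x \<le> ennreal (b * l) + E x"
    and EI: "(\<integral>\<^sup>+ x. E x \<partial>lebesgue) \<le> ennreal (b * (tail_const r * A powr r * l powr (1 - r)))"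
    using split[OF l(1)] by blast
  have "{x. ennreal l0 < g x} \<subseteq> {x. ennreal (b * l) < E x}"
  proof (rule subsetI, rule ccontr)
    fix x assume x: "x \<in> {x. ennreal l0 < g x}" "x \<notin> {x. ennreal (b * l) < E x}"
    have "g x \<le> ennreal (b * l) + ennreal (b * l)"
      using x by (intro order_trans[OF gE] add_left_mono) auto
    also have "\<dots> = ennreal l0" using l by (simp flip: ennreal_plus)
    finally show False using x by simp
  qed
  hence "emeasure lebesgue {x. ennreal l0 < g x} \<le> emeasure lebesgue {x. ennreal (b * l) < E x}"
    using Em by (intro emeasure_mono superlevel_sets)
  also have "\<dots> \<le> ennreal ((b * (tail_const r * A powr r * l powr (1 - r)) / (b * l)) powr 1)"
    using b tail_const_pos[OF r] by (intro weak_typeD nn_integral_imp_weak_type_1 Em EI l) auto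
  also have "(b * (tail_const r * A powr r * l powr (1 - r)) / (b * l)) powr 1 = tail_const r * (A powr r / l powr r)"
    using b l tail_const_pos[OF r] by (simp add: powr_diff)
  also have "\<dots> = (mink_const r * b * A / l0) powr r"
    using b l0 A r tail_const_pos[OF r] unfolding l_def mink_const_def
    by (simp add: powr_divide powr_mult powr_powr)
  finally show "emeasure lebesgue {x. ennreal l0 < g x} \<le> ennreal ((mink_const r * b * A / l0) powr r)" .
qed

lemma nn_integral_lborel_affine:
  fixes f :: "'a::euclidean_space \<Rightarrow> ennreal"
  assumes [measurable]: "f \<in> borel_measurable borel" and c: "c \<noteq> 0"
  shows "(\<integral>\<^sup>+ x. f x \<partial>lborel) = ennreal (\<bar>c\<bar> ^ DIM('a)) * (\<integral>\<^sup>+ x. f (t + c *\<^sub>R x) \<partial>lborel)"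
  by (subst lborel_affine[OF c, of t])
    (simp add: nn_integral_density nn_integral_distr nn_integral_cmult)

lemma nn_integral_lborel_reflect:
  fixes f :: "'a::euclidean_space \<Rightarrow> ennreal"
  assumes "f \<in> borel_measurable borel"
  shows "(\<integral>\<^sup>+ y. f (x - y) \<partial>lborel) = (\<integral>\<^sup>+ y. f y \<partial>lborel)"
  using nn_integral_lborel_affine[OF assms, of "-1" x] by simp

lemma nn_integral_lborel_shift:
  fixes f :: "'a::euclidean_space \<Rightarrow> ennreal"
  assumes "f \<in> borel_measurable borel"
  shows "(\<integral>\<^sup>+ x. f (x - y) \<partial>lborel) = (\<integral>\<^sup>+ x. f x \<partial>lborel)"
  using nn_integral_lborel_affine[OF assms, of 1 "-y"] by simp

text \<open>The convolution of the absolute values. It dominates the convolution without any integrability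
assumption, and Tonelli's theorem applies to it.\<close>

definition conv_abs :: "('a::euclidean_space \<Rightarrow> real) \<Rightarrow> ('a \<Rightarrow> real) \<Rightarrow> 'a \<Rightarrow> ennreal" where
  "conv_abs k f x = (\<integral>\<^sup>+ y. ennreal \<bar>k (x - y)\<bar> * ennreal \<bar>f y\<bar> \<partial>lebesgue)"

lemma conv_abs_borel:
  fixes k f :: "'a::euclidean_space \<Rightarrow> real"
  assumes k[measurable]: "k \<in> borel_measurable borel" and f: "f \<in> borel_measurable lebesgue"
  obtains g where "g \<in> borel_measurable borel" "AE y in lborel. f y = g y"
    "conv_abs k f = (\<lambda>x. \<integral>\<^sup>+ y. ennreal \<bar>k (x - y)\<bar> * ennreal \<bar>g y\<bar> \<partial>lborel)"
proof -
  obtain g where g: "g \<in> borel_measurable lborel" "AE y in lborel. f y = g y"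
    using completion_ex_borel_measurable_real[OF f] by auto
  have "conv_abs k f x = (\<integral>\<^sup>+ y. ennreal \<bar>k (x - y)\<bar> * ennreal \<bar>g y\<bar> \<partial>lborel)" for x
  proof -
    have "conv_abs k f x = (\<integral>\<^sup>+ y. ennreal \<bar>k (x - y)\<bar> * ennreal \<bar>g y\<bar> \<partial>lebesgue)"
      unfolding conv_abs_def using AE_completion[OF g(2)] by (intro nn_integral_cong_AE) auto
    thus ?thesis by (simp add: nn_integral_completion)
  qed
  with g that show ?thesis by auto
qed

lemma conv_abs_measurable [measurable]:
  assumes "k \<in> borel_measurable borel" and "f \<in> borel_measurable lebesgue"
  shows "conv_abs k f \<in> borel_measurable borel"
proof -
  note [measurable] = assms(1)
  obtain g where [measurable]: "g \<in> borel_measurable borel" and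
    eq: "conv_abs k f = (\<lambda>x. \<integral>\<^sup>+ y. ennreal \<bar>k (x - y)\<bar> * ennreal \<bar>g y\<bar> \<partial>lborel)"
    using conv_abs_borel[OF assms] by metis
  show ?thesis unfolding eq by measurable
qed

lemma nn_integral_conv_abs:
  assumes "k \<in> borel_measurable borel" and "f \<in> borel_measurable lebesgue"
  shows "(\<integral>\<^sup>+ x. conv_abs k f x \<partial>lborel) =
    L1_norm k * (\<integral>\<^sup>+ x. ennreal \<bar>f x\<bar> \<partial>lebesgue)"
proof -
  note [measurable] = assms(1)
  obtain g where [measurable]: "g \<in> borel_measurable borel" and ae: "AE y in lborel. f y = g y" and
    eq: "conv_abs k f = (\<lambda>x. \<integral>\<^sup>+ y. ennreal \<bar>k (x - y)\<bar> * ennreal \<bar>g y\<bar> \<partial>lborel)"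
    using conv_abs_borel[OF assms] by metis
  have "(\<integral>\<^sup>+ x. conv_abs k f x \<partial>lborel) =
      (\<integral>\<^sup>+ y. \<integral>\<^sup>+ x. ennreal \<bar>k (x - y)\<bar> * ennreal \<bar>g y\<bar> \<partial>lborel \<partial>lborel)"
    unfolding eq by (rule lborel_pair.Fubini'[symmetric]) measurable
  also have "\<dots> = (\<integral>\<^sup>+ y. L1_norm k * ennreal \<bar>g y\<bar> \<partial>lborel)"
    using nn_integral_lborel_shift[of "\<lambda>x. ennreal \<bar>k x\<bar>"]
    by (intro nn_integral_cong) (simp add: nn_integral_multc)
  also have "\<dots> = L1_norm k * L1_norm g"
    by (simp add: nn_integral_cmult)
  also have "L1_norm g = (\<integral>\<^sup>+ y. ennreal \<bar>g y\<bar> \<partial>lebesgue)"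
    by (simp add: nn_integral_completion)
  also have "\<dots> = (\<integral>\<^sup>+ y. ennreal \<bar>f y\<bar> \<partial>lebesgue)"
    using AE_completion[OF ae] by (intro nn_integral_cong_AE) auto
  finally show ?thesis .
qed

text \<open>The part of \<open>f\<close> below the height \<open>l\<close> contributes at most \<open>l\<close> times the \<open>L\<^sup>1\<close> norm of the kernel. This
reduces statements about \<open>L\<^bsup>r,\<infinity>\<^esup>\<close> to the integrable part of \<open>f\<close> above \<open>l\<close>.\<close>

lemma conv_abs_split:
  fixes k f :: "'a::euclidean_space \<Rightarrow> real"
  assumes k[measurable]: "k \<in> borel_measurable borel" and f[measurable]: "f \<in> borel_measurable lebesgue"
    and B: "L1_norm k \<le> ennreal B" "0 \<le> B" and l: "0 < l"
  shows "conv_abs k f x \<le> ennreal (B * l) + conv_abs k (\<lambda>y. f y * indicator {y. l < \<bar>f y\<bar>} y) x"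
proof -
  have km[measurable]: "(\<lambda>y. k (x - y)) \<in> borel_measurable lebesgue"
    by (intro measurable_completion) measurable
  have "conv_abs k f x \<le> (\<integral>\<^sup>+ y. ennreal l * ennreal \<bar>k (x - y)\<bar> +
      ennreal \<bar>k (x - y)\<bar> * ennreal \<bar>f y * indicator {y. l < \<bar>f y\<bar>} y\<bar> \<partial>lebesgue)"
    unfolding conv_abs_def
  proof (rule nn_integral_mono)
    fix y
    show "ennreal \<bar>k (x - y)\<bar> * ennreal \<bar>f y\<bar> \<le> ennreal l * ennreal \<bar>k (x - y)\<bar> +
      ennreal \<bar>k (x - y)\<bar> * ennreal \<bar>f y * indicator {y. l < \<bar>f y\<bar>} y\<bar>"
    proof (cases "l < \<bar>f y\<bar>")
      case False
      thus ?thesis by (simp add: mult.commute[of "ennreal l"] mult_left_mono ennreal_leI)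
    qed simp
  qed
  also have "\<dots> = ennreal l * (\<integral>\<^sup>+ y. ennreal \<bar>k (x - y)\<bar> \<partial>lebesgue) + conv_abs k (\<lambda>y. f y * indicator {y. l < \<bar>f y\<bar>} y) x"
    unfolding conv_abs_def by (simp add: nn_integral_add nn_integral_cmult)
  also have "(\<integral>\<^sup>+ y. ennreal \<bar>k (x - y)\<bar> \<partial>lebesgue) = L1_norm k"
    using nn_integral_lborel_reflect[of "\<lambda>x. ennreal \<bar>k x\<bar>" x] by (simp add: nn_integral_completion)
  also have "ennreal l * L1_norm k \<le> ennreal l * ennreal B"
    using B by (intro mult_left_mono) auto
  also have "\<dots> = ennreal (B * l)" using l B by (simp add: ennreal_mult' mult.commute)
  finally show ?thesis by simp
qed

lemma weak_type_conv_abs: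
  fixes k f :: "'a::euclidean_space \<Rightarrow> real"
  assumes k: "k \<in> borel_measurable borel" and fm: "f \<in> borel_measurable lebesgue"
    and B: "L1_norm k \<le> ennreal B" "0 < B"
    and f: "weak_bound r A f" and r: "1 < r" and A: "0 < A"
  shows "weak_type r (mink_const r * B * A) (conv_abs k f)"
proof (rule weak_type_truncation[OF _ r A B(2)])
  show "conv_abs k f \<in> borel_measurable lebesgue"
    using conv_abs_measurable[OF k fm] by (intro measurable_completion) simp
  fix l :: real assume l: "0 < l"
  define fb where "fb y = f y * indicator {y. l < \<bar>f y\<bar>} y" for y
  have "{y \<in> space lebesgue. l < \<bar>f y\<bar>} \<in> sets lebesgue" using fm by measurable
  hence fbm: "fb \<in> borel_measurable lebesgue" unfolding fb_def using fm by simp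
  show "\<exists>E\<in>borel_measurable lebesgue. (\<forall>x. conv_abs k f x \<le> ennreal (B * l) + E x) \<and>
      (\<integral>\<^sup>+ x. E x \<partial>lebesgue) \<le> ennreal (B * (tail_const r * A powr r * l powr (1 - r)))"
  proof (intro bexI[of _ "conv_abs k fb"] conjI allI)
    show "conv_abs k fb \<in> borel_measurable lebesgue"
      using conv_abs_measurable[OF k fbm] by (intro measurable_completion) simp
    show "conv_abs k f x \<le> ennreal (B * l) + conv_abs k fb x" for x
      unfolding fb_def using k fm B l by (intro conv_abs_split) auto
    have "(\<integral>\<^sup>+ x. conv_abs k fb x \<partial>lebesgue) = (\<integral>\<^sup>+ x. conv_abs k fb x \<partial>lborel)"
      by (simp add: nn_integral_completion)
    also have "\<dots> = L1_norm k * (\<integral>\<^sup>+ x. ennreal \<bar>fb x\<bar> \<partial>lebesgue)"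
      by (rule nn_integral_conv_abs[OF k fbm])
    also have "(\<integral>\<^sup>+ x. ennreal \<bar>fb x\<bar> \<partial>lebesgue) = (\<integral>\<^sup>+ x. ennreal \<bar>f x\<bar> * indicator {x. l < \<bar>f x\<bar>} x \<partial>lebesgue)"
      by (intro nn_integral_cong) (auto simp: fb_def indicator_def)
    also have "L1_norm k * \<dots> \<le> ennreal B * ennreal (tail_const r * A powr r * l powr (1 - r))"
      using B weak_type_tail[OF f fm r A l] by (intro mult_mono) auto
    also have "\<dots> = ennreal (B * (tail_const r * A powr r * l powr (1 - r)))" using B by (simp add: ennreal_mult')
    finally show "(\<integral>\<^sup>+ x. conv_abs k fb x \<partial>lebesgue) \<le> ennreal (B * (tail_const r * A powr r * l powr (1 - r)))" .
  qed
qed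

text \<open>A bounded integrable kernel maps \<open>L\<^bsup>r,\<infinity>\<^esup>\<close> to \<open>L\<^bsup>\<infinity>\<^esup>\<close>. The cutting height \<open>l\<close> is left free, to be
optimised later against the scaling of the kernel.\<close>

lemma conv_abs_le:
  fixes k f :: "'a::euclidean_space \<Rightarrow> real"
  assumes k: "k \<in> borel_measurable borel" and fm: "f \<in> borel_measurable lebesgue"
    and B: "L1_norm k \<le> ennreal B" "0 \<le> B"
    and S: "\<And>x. \<bar>k x\<bar> \<le> S"
    and f: "weak_bound r A f" and r: "1 < r" and A: "0 < A" and l: "0 < l"
  shows "conv_abs k f x \<le> ennreal (B * l + S * (tail_const r * A powr r * l powr (1 - r)))"
proof -
  have S0: "0 \<le> S" using S[of 0] by linarith
  have m: "(\<lambda>y. ennreal \<bar>f y\<bar> * indicator {y. l < \<bar>f y\<bar>} y) \<in> borel_measurable lebesgue"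
    using fm by measurable
  have "conv_abs k (\<lambda>y. f y * indicator {y. l < \<bar>f y\<bar>} y) x \<le>
      (\<integral>\<^sup>+ y. ennreal S * (ennreal \<bar>f y\<bar> * indicator {y. l < \<bar>f y\<bar>} y) \<partial>lebesgue)"
    unfolding conv_abs_def using S by (intro nn_integral_mono mult_mono) (auto simp: indicator_def ennreal_leI)
  also have "\<dots> = ennreal S * (\<integral>\<^sup>+ y. ennreal \<bar>f y\<bar> * indicator {y. l < \<bar>f y\<bar>} y \<partial>lebesgue)"
    using m by (rule nn_integral_cmult)
  also have "\<dots> \<le> ennreal S * ennreal (tail_const r * A powr r * l powr (1 - r))"
    using weak_type_tail[OF f fm r A l] by (intro mult_left_mono) auto
  also have "\<dots> = ennreal (S * (tail_const r * A powr r * l powr (1 - r)))"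
    using S0 by (simp add: ennreal_mult')
  finally have 1: "conv_abs k (\<lambda>y. f y * indicator {y. l < \<bar>f y\<bar>} y) x \<le> \<dots>" .
  have "conv_abs k f x \<le> ennreal (B * l) + conv_abs k (\<lambda>y. f y * indicator {y. l < \<bar>f y\<bar>} y) x"
    using k fm B l by (rule conv_abs_split)
  also have "\<dots> \<le> ennreal (B * l) + ennreal (S * (tail_const r * A powr r * l powr (1 - r)))"
    using 1 by (intro add_left_mono)
  also have "\<dots> = ennreal (B * l + S * (tail_const r * A powr r * l powr (1 - r)))"
    using B l S0 tail_const_pos[OF r] by (intro ennreal_plus[symmetric]) auto
  finally show ?thesis .
qed

text \<open>\<open>|u n| + |v| - |u n - v|\<close> lies between \<open>0\<close> and \<open>2 * |v|\<close>, so dominated convergence applies to it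
although no common bound for the \<open>u n\<close> is available.\<close>

lemma Scheffe_dominated:
  fixes u :: "nat \<Rightarrow> 'a \<Rightarrow> real"
  assumes u: "\<And>n. integrable M (u n)" and v: "integrable M v"
    and lim: "\<And>x. (\<lambda>n. u n x) \<longlonglongrightarrow> v x"
    and eq: "\<And>n. (LINT x|M. \<bar>u n x\<bar>) = (LINT x|M. \<bar>v x\<bar>)"
  shows "(\<lambda>n. LINT x|M. \<bar>u n x - v x\<bar>) \<longlonglongrightarrow> 0"
proof -
  have "(\<lambda>n. LINT x|M. \<bar>u n x\<bar> + \<bar>v x\<bar> - \<bar>u n x - v x\<bar>) \<longlonglongrightarrow> (LINT x|M. \<bar>v x\<bar> + \<bar>v x\<bar> - \<bar>v x - v x\<bar>)"
  proof (rule integral_dominated_convergence[where w = "\<lambda>x. 2 * \<bar>v x\<bar>"])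
    show "AE x in M. (\<lambda>n. \<bar>u n x\<bar> + \<bar>v x\<bar> - \<bar>u n x - v x\<bar>) \<longlonglongrightarrow> \<bar>v x\<bar> + \<bar>v x\<bar> - \<bar>v x - v x\<bar>"
      by (intro AE_I2 tendsto_intros lim)
  qed (use u v in auto)
  hence "(\<lambda>n. 2 * (LINT x|M. \<bar>v x\<bar>) - (LINT x|M. \<bar>u n x\<bar> + \<bar>v x\<bar> - \<bar>u n x - v x\<bar>)) \<longlonglongrightarrow>
      2 * (LINT x|M. \<bar>v x\<bar>) - (LINT x|M. \<bar>v x\<bar> + \<bar>v x\<bar> - \<bar>v x - v x\<bar>)"
    by (intro tendsto_intros)
  moreover have "(LINT x|M. \<bar>u n x\<bar> + \<bar>v x\<bar> - \<bar>u n x - v x\<bar>) =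
      2 * (LINT x|M. \<bar>v x\<bar>) - (LINT x|M. \<bar>u n x - v x\<bar>)" for n
    using u[of n] v eq[of n] by simp
  ultimately show ?thesis by simp
qed

lemma integrable_lborel_reflect:
  fixes k :: "'a::euclidean_space \<Rightarrow> real"
  assumes "integrable lborel k"
  shows "integrable lborel (\<lambda>y. k (x - y))"
    "(LINT y|lborel. k (x - y)) = (LINT y|lborel. k y)"
proof -
  have km[measurable]: "k \<in> borel_measurable borel" using assms by auto
  have "(\<integral>\<^sup>+ y. ennreal (norm (k (x - y))) \<partial>lborel) = (\<integral>\<^sup>+ y. ennreal (norm (k y)) \<partial>lborel)"
    by (rule nn_integral_lborel_reflect[of "\<lambda>y. ennreal (norm (k y))"]) measurable
  thus "integrable lborel (\<lambda>y. k (x - y))"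
    using assms by (auto simp: integrable_iff_bounded)
  have d: "lborel = distr lborel borel (\<lambda>y. x + (-1) *\<^sub>R y)"
    using lborel_affine[of "-1" x] by (simp add: density_1)
  have "(LINT y|lborel. k y) = (LINT y|distr lborel borel (\<lambda>y. x + (-1) *\<^sub>R y). k y)"
    using d by simp
  also have "\<dots> = (LINT y|lborel. k (x - y))" by (subst integral_distr) auto
  finally show "(LINT y|lborel. k (x - y)) = (LINT y|lborel. k y)" by simp
qed

lemma integrable_lebesgueI:
  fixes k :: "'a::euclidean_space \<Rightarrow> real"
  assumes "integrable lborel k" shows "integrable lebesgue k"
  using assms by (subst integrable_completion) auto

lemma continuous_convolution_L1:
  fixes k f :: "'a::euclidean_space \<Rightarrow> real"
  assumes k: "continuous_on UNIV k" "\<And>x. \<bar>k x\<bar> \<le> S" and f: "integrable lebesgue f"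
  shows "integrable lebesgue (\<lambda>y. k (x - y) * f y)"
    and "continuous_on UNIV (\<lambda>x. LINT y|lebesgue. k (x - y) * f y)"
proof -
  have kb[measurable]: "k \<in> borel_measurable borel" using k(1) by (rule borel_measurable_continuous_onI)
  have km: "(\<lambda>y. k (x - y)) \<in> borel_measurable lebesgue" for x
    by (intro measurable_completion) measurable
  have fm: "f \<in> borel_measurable lebesgue" using f by auto
  have bnd: "norm (k (x - y) * f y) \<le> S * \<bar>f y\<bar>" for x y
    using k(2)[of "x - y"] by (simp add: abs_mult mult_right_mono)
  have S: "0 \<le> S" using k(2)[of 0] by linarith
  show "integrable lebesgue (\<lambda>y. k (x - y) * f y)"
    by (rule Bochner_Integration.integrable_bound[where f = "\<lambda>y. S * \<bar>f y\<bar>"])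
      (use f km fm bnd S in \<open>auto simp: abs_mult\<close>)
  show "continuous_on UNIV (\<lambda>x. LINT y|lebesgue. k (x - y) * f y)"
    unfolding continuous_on_sequentially comp_def
  proof (intro allI ballI impI, elim conjE)
    fix X :: "nat \<Rightarrow> 'a" and x assume X: "X \<longlonglongrightarrow> x"
    show "(\<lambda>n. LINT y|lebesgue. k (X n - y) * f y) \<longlonglongrightarrow> (LINT y|lebesgue. k (x - y) * f y)"
    proof (rule integral_dominated_convergence[where w = "\<lambda>y. S * \<bar>f y\<bar>"])
      show "AE y in lebesgue. (\<lambda>n. k (X n - y) * f y) \<longlonglongrightarrow> k (x - y) * f y"
      proof (intro AE_I2 tendsto_mult tendsto_const)
        fix y
        have "(\<lambda>n. X n - y) \<longlonglongrightarrow> x - y" by (intro tendsto_intros X)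
        moreover have "isCont k (x - y)" using k(1) by (simp add: continuous_on_eq_continuous_at)
        ultimately show "(\<lambda>n. k (X n - y)) \<longlonglongrightarrow> k (x - y)" by (rule isCont_tendsto_compose[rotated])
      qed
    qed (use f km fm bnd in auto)
  qed
qed

text \<open>Translates of the kernel converge pointwise and have equal \<open>L\<^sup>1\<close> norm, hence they converge in
\<open>L\<^sup>1\<close>. This takes the place of a pointwise bound on the decay of the kernel, which is proved below for
integer powers only.\<close>

lemma continuous_convolution_bounded:
  fixes k f :: "'a::euclidean_space \<Rightarrow> real"
  assumes k: "continuous_on UNIV k" "integrable lborel k"
    and f: "f \<in> borel_measurable lebesgue" "\<And>y. \<bar>f y\<bar> \<le> l"
  shows "integrable lebesgue (\<lambda>y. k (x - y) * f y)"
    and "continuous_on UNIV (\<lambda>x. LINT y|lebesgue. k (x - y) * f y)"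
proof -
  have ki: "integrable lebesgue (\<lambda>y. k (x - y))" for x
    using k(2) by (intro integrable_lebesgueI integrable_lborel_reflect)
  have l: "0 \<le> l" using f(2)[of 0] by linarith
  have I: "integrable lebesgue (\<lambda>y. k (x - y) * f y)" for x
    by (rule Bochner_Integration.integrable_bound[where f = "\<lambda>y. l * \<bar>k (x - y)\<bar>"])
      (use ki[of x] f l in \<open>auto simp: abs_mult mult.commute[of l] intro!: mult_left_mono\<close>)
  show "integrable lebesgue (\<lambda>y. k (x - y) * f y)" by (rule I)
  show "continuous_on UNIV (\<lambda>x. LINT y|lebesgue. k (x - y) * f y)"
    unfolding continuous_on_sequentially comp_def
  proof (intro allI ballI impI, elim conjE)
    fix X :: "nat \<Rightarrow> 'a" and x assume X: "X \<longlonglongrightarrow> x"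
    have S: "(\<lambda>n. LINT y|lborel. \<bar>k (X n - y) - k (x - y)\<bar>) \<longlonglongrightarrow> 0"
    proof (rule Scheffe_dominated)
      fix y
      have "(\<lambda>n. X n - y) \<longlonglongrightarrow> x - y" by (intro tendsto_intros X)
      moreover have "isCont k (x - y)" using k(1) by (simp add: continuous_on_eq_continuous_at)
      ultimately show "(\<lambda>n. k (X n - y)) \<longlonglongrightarrow> k (x - y)" by (rule isCont_tendsto_compose[rotated])
    next
      have "integrable lborel (\<lambda>y. \<bar>k y\<bar>)" using k(2) by simp
      thus "(LINT y|lborel. \<bar>k (X n - y)\<bar>) = (LINT y|lborel. \<bar>k (x - y)\<bar>)" for n
        using integrable_lborel_reflect(2)[of "\<lambda>y. \<bar>k y\<bar>"] by simp
    qed (use k(2) integrable_lborel_reflect(1) in auto)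
    have "(\<lambda>n. (LINT y|lebesgue. k (X n - y) * f y) - (LINT y|lebesgue. k (x - y) * f y)) \<longlonglongrightarrow> 0"
    proof (rule Lim_null_comparison)
      show "(\<lambda>n. l * (LINT y|lborel. \<bar>k (X n - y) - k (x - y)\<bar>)) \<longlonglongrightarrow> 0"
        using tendsto_mult_left[OF S, of l] by simp
      show "\<forall>\<^sub>F n in sequentially. norm ((LINT y|lebesgue. k (X n - y) * f y) - (LINT y|lebesgue. k (x - y) * f y)) \<le>
          l * (LINT y|lborel. \<bar>k (X n - y) - k (x - y)\<bar>)"
      proof (rule always_eventually, rule allI)
        fix n
        have d: "integrable lborel (\<lambda>y. \<bar>k (X n - y) - k (x - y)\<bar>)"
          by (intro integrable_abs Bochner_Integration.integrable_diff integrable_lborel_reflect(1) k(2))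
        have "(LINT y|lebesgue. k (X n - y) * f y) - (LINT y|lebesgue. k (x - y) * f y) =
            (LINT y|lebesgue. k (X n - y) * f y - k (x - y) * f y)"
          by (intro Bochner_Integration.integral_diff[symmetric] I)
        also have "norm \<dots> \<le> (LINT y|lebesgue. norm (k (X n - y) * f y - k (x - y) * f y))"
          by (rule integral_norm_bound)
        also have "\<dots> \<le> (LINT y|lebesgue. l * \<bar>k (X n - y) - k (x - y)\<bar>)"
        proof (rule integral_mono)
          show "integrable lebesgue (\<lambda>y. norm (k (X n - y) * f y - k (x - y) * f y))"
            by (intro integrable_norm Bochner_Integration.integrable_diff I)
          show "integrable lebesgue (\<lambda>y. l * \<bar>k (X n - y) - k (x - y)\<bar>)"
            using integrable_lebesgueI[OF d] by simp
          fix y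
          have "norm (k (X n - y) * f y - k (x - y) * f y) = \<bar>f y\<bar> * \<bar>k (X n - y) - k (x - y)\<bar>"
            by (simp add: abs_mult[symmetric] algebra_simps)
          also have "\<dots> \<le> l * \<bar>k (X n - y) - k (x - y)\<bar>" using f(2) by (intro mult_right_mono) auto
          finally show "norm (k (X n - y) * f y - k (x - y) * f y) \<le> l * \<bar>k (X n - y) - k (x - y)\<bar>" .
        qed
        also have "\<dots> = l * (LINT y|lborel. \<bar>k (X n - y) - k (x - y)\<bar>)"
          using d by (subst integral_completion) auto
        finally show "norm ((LINT y|lebesgue. k (X n - y) * f y) - (LINT y|lebesgue. k (x - y) * f y)) \<le>
          l * (LINT y|lborel. \<bar>k (X n - y) - k (x - y)\<bar>)" .
      qed
    qed
    thus "(\<lambda>n. LINT y|lebesgue. k (X n - y) * f y) \<longlonglongrightarrow> (LINT y|lebesgue. k (x - y) * f y)"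
      by (simp add: LIM_zero_iff)
  qed
qed

text \<open>Cutting \<open>f\<close> at height \<open>1\<close> gives an integrable and a bounded part, to which the two preceding lemmas
apply.\<close>

lemma continuous_convolution_weak_type:
  fixes k f :: "'a::euclidean_space \<Rightarrow> real"
  assumes k: "continuous_on UNIV k" "integrable lborel k" "\<And>x. \<bar>k x\<bar> \<le> S"
    and f: "f \<in> borel_measurable lebesgue" "weak_bound r A f"
    and r: "1 < r" and A: "0 < A"
  shows "integrable lebesgue (\<lambda>y. k (x - y) * f y)"
    and "continuous_on UNIV (\<lambda>x. LINT y|lebesgue. k (x - y) * f y)"
proof -
  note [measurable] = f(1)
  define fb where "fb y = f y * indicator {y. 1 < \<bar>f y\<bar>} y" for y
  define fs where "fs y = f y * indicator {y. \<bar>f y\<bar> \<le> 1} y" for y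
  have fbm: "fb \<in> borel_measurable lebesgue" and fsm: "fs \<in> borel_measurable lebesgue"
  proof -
    have "{y. 1 < \<bar>f y\<bar>} = {y \<in> space lebesgue. 1 < \<bar>f y\<bar>}" "{y. \<bar>f y\<bar> \<le> 1} = {y \<in> space lebesgue. \<bar>f y\<bar> \<le> 1}" by auto
    thus "fb \<in> borel_measurable lebesgue" "fs \<in> borel_measurable lebesgue"
      unfolding fb_def fs_def by (simp_all only:) measurable
  qed
  have "(\<integral>\<^sup>+ x. ennreal (norm (fb x)) \<partial>lebesgue) = (\<integral>\<^sup>+ x. ennreal \<bar>f x\<bar> * indicator {x. 1 < \<bar>f x\<bar>} x \<partial>lebesgue)"
    by (intro nn_integral_cong) (auto simp: fb_def indicator_def)
  also have "\<dots> \<le> ennreal (tail_const r * A powr r * 1 powr (1 - r))"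
    using weak_type_tail[OF f(2,1) r A, of 1] by simp
  also have "\<dots> < \<infinity>" by simp
  finally have fb: "integrable lebesgue fb" using fbm by (intro integrableI_bounded)
  have fs: "\<bar>fs y\<bar> \<le> 1" for y by (auto simp: fs_def indicator_def)
  have sum: "k (x - y) * f y = k (x - y) * fb y + k (x - y) * fs y" for x y
    by (auto simp: fs_def fb_def indicator_def)
  note b = continuous_convolution_L1[OF k(1,3) fb] and s = continuous_convolution_bounded[OF k(1,2) fsm fs]
  show "integrable lebesgue (\<lambda>y. k (x - y) * f y)"
    unfolding sum by (intro Bochner_Integration.integrable_add b s)
  show "continuous_on UNIV (\<lambda>x. LINT y|lebesgue. k (x - y) * f y)"
    unfolding sum by (subst Bochner_Integration.integral_add[OF b(1) s(1)]) (intro continuous_on_add b s)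
qed

lemma convolution_le_conv_abs:
  "ennreal \<bar>LINT y|lebesgue. k (x - y) * f y\<bar> \<le> conv_abs k f x"
proof (cases "integrable lebesgue (\<lambda>y. k (x - y) * f y)")
  case True
  hence "ennreal (norm (LINT y|lebesgue. k (x - y) * f y)) \<le> (\<integral>\<^sup>+ y. ennreal (norm (k (x - y) * f y)) \<partial>lebesgue)"
    by (rule integral_norm_bound_ennreal)
  thus ?thesis by (simp add: conv_abs_def abs_mult ennreal_mult')
next
  case False
  thus ?thesis by (simp add: not_integrable_integral_eq)
qed

section \<open>Time integrals\<close>

text \<open>The points \<open>x\<close> at which \<open>D\<close> is measurable in time are dense, so by continuity in \<open>x\<close> measurability in time
holds at all points. Then \<open>D\<close> is a limit of the functions \<open>D t (s n x)\<close>, where the simple functions \<open>s n\<close>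
approximate the identity.\<close>

lemma Caratheodory_jointly_measurable:
  fixes D :: "real \<Rightarrow> 'a::euclidean_space \<Rightarrow> real"
  assumes cont: "\<And>t. continuous_on UNIV (D t)"
    and meas: "AE x in lborel. (\<lambda>t. D t x) \<in> borel_measurable lborel"
  shows "(\<lambda>(t, x). D t x) \<in> borel_measurable (lborel \<Otimes>\<^sub>M lborel)"
proof -
  have Dlim: "(\<lambda>n. D t (X n)) \<longlonglongrightarrow> D t x" if "X \<longlonglongrightarrow> x" for X x t
    using cont[of t] that by (auto simp: continuous_on_eq_continuous_at intro: isCont_tendsto_compose)
  have all: "(\<lambda>t. D t x) \<in> borel_measurable lborel" for x
  proof -
    let ?G = "{x. (\<lambda>t. D t x) \<in> borel_measurable lborel}"
    have "\<exists>y\<in>?G. dist y x < 1 / Suc n" for n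
    proof (rule ccontr)
      assume no: "\<not> ?thesis"
      obtain N where N0: "N \<in> null_sets lborel"
          "\<And>x. x \<in> space lborel - N \<Longrightarrow> (\<lambda>t. D t x) \<in> borel_measurable lborel"
        using AE_E3[OF meas] by blast
      have N: "N \<in> null_sets lborel" "- ?G \<subseteq> N" using N0 by auto
      \<comment> \<open>a ball that misses the good points would be a null set\<close>
      have "ball x (1 / Suc n) \<subseteq> - ?G" using no by (auto simp: dist_commute)
      hence "ball x (1 / Suc n) \<in> null_sets lborel"
        using N by (intro null_sets_subset[OF N(1)]) auto
      thus False using open_not_negligible[of "ball x (1 / Suc n)"]
        by (simp add: null_sets_completionI negligible_iff_null_sets)
    qed
    then obtain X where X: "\<And>n. X n \<in> ?G" "\<And>n. dist (X n) x < 1 / Suc n" by metis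
    have "X \<longlonglongrightarrow> x"
    proof (rule metric_LIMSEQ_I)
      fix e :: real assume "0 < e"
      then obtain m where "1 / Suc m < e" by (metis nat_approx_posE)
      moreover have "1 / real (Suc n) \<le> 1 / real (Suc m)" if "m \<le> n" for n
        using that by (intro divide_left_mono) auto
      ultimately show "\<exists>m. \<forall>n\<ge>m. dist (X n) x < e"
        using X(2) by (meson less_trans less_le_trans le_less_trans)
    qed
    hence lim: "(\<lambda>n. D t (X n)) \<longlonglongrightarrow> D t x" for t by (rule Dlim)
    have "(\<lambda>t. D t (X n)) \<in> borel_measurable lborel" for n using X(1)[of n] by (simp only: mem_Collect_eq)
    with lim show ?thesis by (rule borel_measurable_LIMSEQ_real)
  qed
  obtain s :: "nat \<Rightarrow> 'a \<Rightarrow> 'a" where s: "\<And>i. simple_function lborel (s i)" "\<And>x. (\<lambda>i. s i x) \<longlonglongrightarrow> x"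
    using borel_measurable_implies_sequence_metric[of "\<lambda>x::'a. x" lborel 0] by auto
  show ?thesis
  proof (rule borel_measurable_LIMSEQ_real[where u = "\<lambda>n (t, x). D t (s n x)"])
    show "(\<lambda>n. (case z of (t, x) \<Rightarrow> D t (s n x))) \<longlonglongrightarrow> (case z of (t, x) \<Rightarrow> D t x)" for z
      using Dlim[OF s(2)] by (auto split: prod.split)
    fix n
    have fin: "finite (range (s n))" using s(1)[of n] by (auto simp: simple_function_def)
    have sm: "s n \<in> lborel \<rightarrow>\<^sub>M count_space (range (s n))"
      using measurable_simple_function[OF s(1)[of n]] by (rule measurable_count_space_extend[rotated 2, OF _ ]) auto
    have "(\<lambda>z. D (fst z) (s n (snd z))) \<in> borel_measurable (lborel \<Otimes>\<^sub>M lborel)"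
    proof (rule measurable_compose_countable'[where f = "\<lambda>a z. D (fst z) a" and g = "\<lambda>z. s n (snd z)" and I = "range (s n)"])
      show "(\<lambda>z. D (fst z) a) \<in> borel_measurable (lborel \<Otimes>\<^sub>M lborel)" for a
        using all[of a] by (rule measurable_compose[OF measurable_fst])
      show "(\<lambda>z. s n (snd z)) \<in> lborel \<Otimes>\<^sub>M lborel \<rightarrow>\<^sub>M count_space (range (s n))"
        using sm by (rule measurable_compose[OF measurable_snd])
      show "countable (range (s n))" using fin by (rule countable_finite)
    qed
    thus "(\<lambda>(t, x). D t (s n x)) \<in> borel_measurable (lborel \<Otimes>\<^sub>M lborel)"
      by (simp add: case_prod_unfold)
  qed
qed

lemma nn_integral_lborel_lebesgue: "(\<integral>\<^sup>+ x. f x \<partial>lebesgue) = (\<integral>\<^sup>+ x. f x \<partial>lborel)"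
  by (simp add: nn_integral_completion)

text \<open>Minkowski's integral inequality for \<open>L\<^bsup>r,\<infinity>\<^esup>\<close>; the tails at different times are integrated by Tonelli's
theorem, for which \<open>D\<close> has to be jointly measurable.\<close>

lemma weak_type_time_integral:
  fixes D :: "real \<Rightarrow> 'a::euclidean_space \<Rightarrow> real"
  assumes D: "(\<lambda>(t, x). D t x) \<in> borel_measurable (lborel \<Otimes>\<^sub>M lborel)"
    and I: "I \<in> sets borel" "emeasure lborel I \<le> ennreal d" and d: "0 < d"
    and f: "\<And>t. t \<in> I \<Longrightarrow> weak_bound r A (D t)" and r: "1 < r" and A: "0 < A"
  shows "weak_type r (mink_const r * d * A) (\<lambda>x. \<integral>\<^sup>+ t\<in>I. ennreal \<bar>D t x\<bar> \<partial>lborel)"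
proof -
  have Dm[measurable]: "(\<lambda>z. D (fst z) (snd z)) \<in> borel_measurable (lborel \<Otimes>\<^sub>M lborel)"
    using D by (simp add: case_prod_unfold)
  have Dm'[measurable]: "(\<lambda>z. D (snd z) (fst z)) \<in> borel_measurable (lborel \<Otimes>\<^sub>M lborel)"
    using measurable_compose[OF measurable_pair_swap' Dm] by (simp add: case_prod_unfold)
  note [measurable] = I(1)
  have [measurable]: "(\<lambda>x. D t x) \<in> borel_measurable borel" for t
    using measurable_compose[OF measurable_Pair1'[of t lborel lborel] Dm] by simp
  let ?E = "\<lambda>x. \<integral>\<^sup>+ t\<in>I. ennreal \<bar>D t x\<bar> \<partial>lborel"
  show ?thesis
  proof (rule weak_type_truncation[OF _ r A d])
    have "?E \<in> borel_measurable lborel" by measurable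
    thus "?E \<in> borel_measurable lebesgue" by (rule measurable_completion)
    fix l :: real assume l: "0 < l"
    let ?c = "tail_const r * A powr r * l powr (1 - r)"
    define E where "E x = (\<integral>\<^sup>+ t. ennreal \<bar>D t x\<bar> * indicator {y. l < \<bar>y\<bar>} (D t x) * indicator I t \<partial>lborel)" for x
    have [measurable]: "{y::real. l < \<bar>y\<bar>} \<in> sets borel" by measurable
    have Em: "E \<in> borel_measurable lborel" unfolding E_def by measurable
    show "\<exists>E\<in>borel_measurable lebesgue. (\<forall>x. ?E x \<le> ennreal (d * l) + E x) \<and> (\<integral>\<^sup>+ x. E x \<partial>lebesgue) \<le> ennreal (d * ?c)"
    proof (intro bexI[of _ E] conjI allI)
      show "E \<in> borel_measurable lebesgue" using Em by (rule measurable_completion)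
      fix x
      have "?E x \<le> (\<integral>\<^sup>+ t. ennreal l * indicator I t +
          ennreal \<bar>D t x\<bar> * indicator {y. l < \<bar>y\<bar>} (D t x) * indicator I t \<partial>lborel)"
        by (intro nn_integral_mono) (auto simp: indicator_def intro: ennreal_leI)
      also have "\<dots> = ennreal l * emeasure lborel I + E x"
        using measurable_compose[OF measurable_Pair1'[of x lborel lborel] Dm'] unfolding E_def
        by (subst nn_integral_add) (auto simp: nn_integral_cmult_indicator)
      also have "\<dots> \<le> ennreal l * ennreal d + E x" by (intro add_right_mono mult_left_mono I) auto
      also have "ennreal l * ennreal d = ennreal (d * l)" using l d by (simp add: ennreal_mult mult.commute)
      finally show "?E x \<le> ennreal (d * l) + E x" .
    next
      have "(\<integral>\<^sup>+ x. E x \<partial>lebesgue) = (\<integral>\<^sup>+ x. E x \<partial>lborel)" by (rule nn_integral_lborel_lebesgue)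
      also have "\<dots> = (\<integral>\<^sup>+ t. \<integral>\<^sup>+ x. ennreal \<bar>D t x\<bar> * indicator {y. l < \<bar>y\<bar>} (D t x) * indicator I t \<partial>lborel \<partial>lborel)"
        unfolding E_def by (rule lborel_pair.Fubini') measurable
      also have "\<dots> \<le> (\<integral>\<^sup>+ t. ennreal ?c * indicator I t \<partial>lborel)"
      proof (rule nn_integral_mono)
        fix t
        show "(\<integral>\<^sup>+ x. ennreal \<bar>D t x\<bar> * indicator {y. l < \<bar>y\<bar>} (D t x) * indicator I t \<partial>lborel) \<le> ennreal ?c * indicator I t"
        proof (cases "t \<in> I")
          case True
          have "(\<integral>\<^sup>+ x. ennreal \<bar>D t x\<bar> * indicator {x. l < \<bar>D t x\<bar>} x \<partial>lebesgue) \<le> ennreal ?c"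
            by (rule weak_type_tail[OF f[OF True] _ r A l]) (intro measurable_completion, measurable)
          moreover have "indicator {x. l < \<bar>D t x\<bar>} x = (indicator {y. l < \<bar>y\<bar>} (D t x) :: ennreal)" for x
            by (simp add: indicator_def)
          ultimately show ?thesis using True by (simp add: nn_integral_lborel_lebesgue)
        qed simp
      qed
      also have "\<dots> = ennreal ?c * emeasure lborel I" by (rule nn_integral_cmult_indicator) simp
      also have "\<dots> \<le> ennreal ?c * ennreal d" by (intro mult_left_mono I) auto
      also have "\<dots> = ennreal (d * ?c)"
        using d by (simp only: mult.commute[of _ "ennreal d"] ennreal_mult'[symmetric] less_imp_le)
      finally show "(\<integral>\<^sup>+ x. E x \<partial>lebesgue) \<le> ennreal (d * ?c)" .
    qed
  qed
qed

lemma nn_integral_powr_tail: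
  fixes e d t T :: real
  assumes e: "1 < e" and d: "0 < d"
  shows "(\<integral>\<^sup>+ \<tau>\<in>{..t - d}. ennreal ((t - \<tau>) powr (- e)) \<partial>lborel) = ennreal (d powr (1 - e) / (e - 1))"
proof -
  have "(\<integral>\<^sup>+ \<tau>\<in>{..t - d}. ennreal ((t - \<tau>) powr (- e)) \<partial>lborel) =
      (\<integral>\<^sup>+ \<tau>. ennreal (indicator {d..} (t - \<tau>) * (t - \<tau>) powr (- e)) \<partial>lborel)"
    by (intro nn_integral_cong) (auto simp: indicator_def)
  also have "\<dots> = (\<integral>\<^sup>+ s. ennreal (indicator {d..} s * s powr (- e)) \<partial>lborel)"
    by (rule nn_integral_lborel_reflect[of "\<lambda>s. ennreal (indicator {d..} s * s powr (- e))" t]) measurable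
  also have "\<dots> = ennreal (- (d powr (- e + 1)) / (- e + 1))"
    using has_integral_powr_to_inf[of "- e" d] e d by (intro nn_integral_has_integral_lebesgue) auto
  also have "- (d powr (- e + 1)) / (- e + 1) = d powr (1 - e) / (e - 1)"
    using e by (simp add: field_simps)
  finally show ?thesis .
qed

text \<open>The endpoint estimate. In \<open>L\<^bsup>q,\<infinity>\<^esup>\<close> with \<open>q = r * e / (e - 1)\<close> the integrand has size of order
\<open>1 / (t - \<tau>)\<close>, so the norm cannot be taken inside. For a level set at height \<open>l\<close> the times at distance at
least \<open>d\<close> from \<open>t\<close> contribute at most \<open>A * d powr (1 - e) / (e - 1)\<close>, and \<open>d\<close> is chosen such that this is
\<open>l / 2\<close>. The remaining times form an interval of length \<open>d\<close>, on which Minkowski's inequality in \<open>L\<^bsup>r,\<infinity>\<^esup>\<close>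
suffices; the power of \<open>l\<close> hidden in \<open>d\<close> turns \<open>r\<close> into \<open>q\<close>.\<close>

lemma weak_type_time_integral_critical:
  fixes D :: "real \<Rightarrow> 'a::euclidean_space \<Rightarrow> real"
  assumes D: "(\<lambda>(t, x). D t x) \<in> borel_measurable (lborel \<Otimes>\<^sub>M lborel)"
    and f: "\<And>\<tau>. \<tau> \<in> {T<..<t} \<Longrightarrow> weak_bound r A (D \<tau>)"
    and bd: "\<And>\<tau> x. \<tau> \<in> {T<..<t} \<Longrightarrow> \<bar>D \<tau> x\<bar> \<le> A * (t - \<tau>) powr (- e)"
    and r: "1 < r" and A: "0 < A" and e: "1 < e"
  shows "weak_type (r * e / (e - 1)) ((2 * mink_const r + 2 / (e - 1)) * A)
    (\<lambda>x. \<integral>\<^sup>+ \<tau>\<in>{T<..<t}. ennreal \<bar>D \<tau> x\<bar> \<partial>lborel)" (is "weak_type ?q ?B ?E")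
  unfolding weak_type_def
proof (intro conjI allI impI)
  have Dm[measurable]: "(\<lambda>z. D (fst z) (snd z)) \<in> borel_measurable (lborel \<Otimes>\<^sub>M lborel)"
    using D by (simp add: case_prod_unfold)
  have Dm'[measurable]: "(\<lambda>z. D (snd z) (fst z)) \<in> borel_measurable (lborel \<Otimes>\<^sub>M lborel)"
    using measurable_compose[OF measurable_pair_swap' Dm] by (simp add: case_prod_unfold)
  have Dt: "(\<lambda>t. D t x) \<in> borel_measurable borel" for x
    using measurable_compose[OF measurable_Pair1'[of x lborel lborel] Dm'] by simp
  have "?E \<in> borel_measurable lborel" by measurable
  thus "?E \<in> borel_measurable lebesgue" by (rule measurable_completion)
  fix l :: real assume l: "0 < l"
  define X where "X = A / l"
  have X: "0 < X" using A l by (simp add: X_def)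
  \<comment> \<open>the solution of \<open>A * d powr (1 - e) / (e - 1) = l / 2\<close>\<close>
  define d where "d = (2 * X / (e - 1)) powr (1 / (e - 1))"
  have d: "0 < d" using X e by (simp add: d_def)
  define J where "J = {max T (t - d)<..<t}"
  let ?EJ = "\<lambda>x. \<integral>\<^sup>+ \<tau>\<in>J. ennreal \<bar>D \<tau> x\<bar> \<partial>lborel"
  define c where "c = 2 * mink_const r + 2 / (e - 1)"
  note mc = mink_const_pos[OF r]
  have dpow: "A * (d powr (1 - e) / (e - 1)) = l / 2"
  proof -
    have "d powr (1 - e) = (2 * X / (e - 1)) powr (- 1)"
    proof -
      have "1 / (e - 1) * (1 - e) = - 1" using e by (simp add: field_simps)
      thus ?thesis by (simp add: d_def powr_powr)
    qed
    also have "\<dots> = (e - 1) / (2 * X)" using X e by (simp add: powr_minus field_simps)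
    finally show ?thesis using e A l by (simp add: X_def field_simps)
  qed
  have wJ: "weak_type r (mink_const r * d * A) ?EJ"
  proof (rule weak_type_time_integral[OF D])
    have "emeasure lborel J \<le> emeasure lborel {t - d<..<t}"
      unfolding J_def by (intro emeasure_mono) auto
    also have "\<dots> = ennreal d" using d by simp
    finally show "emeasure lborel J \<le> ennreal d" .
  qed (use f d r A in \<open>auto simp: J_def\<close>)
  have split: "?E x \<le> ennreal (l / 2) + ?EJ x" for x
  proof -
    note [measurable] = Dt[of x]
    have [measurable]: "J \<in> sets borel" by (simp add: J_def)
    have "?E x \<le> (\<integral>\<^sup>+ \<tau>. ennreal A * (ennreal ((t - \<tau>) powr (- e)) * indicator {..t - d} \<tau>) +
        ennreal \<bar>D \<tau> x\<bar> * indicator J \<tau> \<partial>lborel)"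
    proof (rule nn_integral_mono)
      fix \<tau>
      show "ennreal \<bar>D \<tau> x\<bar> * indicator {T<..<t} \<tau> \<le> ennreal A * (ennreal ((t - \<tau>) powr (- e)) * indicator {..t - d} \<tau>) +
        ennreal \<bar>D \<tau> x\<bar> * indicator J \<tau>"
      proof (cases "\<tau> \<in> {T<..<t} \<and> \<tau> \<notin> J")
        case True
        hence "\<tau> \<le> t - d" by (auto simp: J_def)
        moreover have "ennreal \<bar>D \<tau> x\<bar> \<le> ennreal (A * (t - \<tau>) powr (- e))"
          using bd True by (intro ennreal_leI) auto
        ultimately show ?thesis using True A by (simp add: ennreal_mult')
      next
        case False
        thus ?thesis by (cases "\<tau> \<in> J") (auto simp: J_def)
      qed
    qed
    also have "\<dots> = ennreal A * (\<integral>\<^sup>+ \<tau>\<in>{..t - d}. ennreal ((t - \<tau>) powr (- e)) \<partial>lborel) + ?EJ x"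
      by (subst nn_integral_add) (auto simp: nn_integral_cmult)
    also have "ennreal A * (\<integral>\<^sup>+ \<tau>\<in>{..t - d}. ennreal ((t - \<tau>) powr (- e)) \<partial>lborel) = ennreal (l / 2)"
      using A by (simp only: nn_integral_powr_tail[OF e d] ennreal_mult'[symmetric] less_imp_le dpow)
    finally show ?thesis .
  qed
  have "{x. ennreal l < ?E x} \<subseteq> {x. ennreal (l / 2) < ?EJ x}"
  proof (rule subsetI, rule ccontr)
    fix x assume x: "x \<in> {x. ennreal l < ?E x}" "x \<notin> {x. ennreal (l / 2) < ?EJ x}"
    have "?E x \<le> ennreal (l / 2) + ?EJ x" by (rule split)
    also have "\<dots> \<le> ennreal (l / 2) + ennreal (l / 2)" using x by (intro add_left_mono) auto
    also have "\<dots> = ennreal l" using l by (simp flip: ennreal_plus)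
    finally show False using x by simp
  qed
  hence "emeasure lebesgue {x. ennreal l < ?E x} \<le> emeasure lebesgue {x. ennreal (l / 2) < ?EJ x}"
    using wJ by (intro emeasure_mono superlevel_sets) auto
  also have "\<dots> \<le> ennreal ((mink_const r * d * A / (l / 2)) powr r)"
    using wJ l by (intro weak_typeD) auto
  also have "(mink_const r * d * A / (l / 2)) powr r \<le> (?B / l) powr ?q"
  proof -
    have "(mink_const r * d * A / (l / 2)) powr r = (2 * mink_const r * X * d) powr r"
      by (simp add: X_def mult_ac)
    also have "\<dots> = (2 * mink_const r * X) powr r * d powr r"
      using mc X d by (subst powr_mult) auto
    also have "d powr r = (2 / (e - 1) * X) powr (r / (e - 1))"
      by (simp add: d_def powr_powr)
    also have "(2 * mink_const r * X) powr r * (2 / (e - 1) * X) powr (r / (e - 1)) \<le>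
        (c * X) powr r * (c * X) powr (r / (e - 1))"
    proof -
      have "0 \<le> 2 / (e - 1)" using e by simp
      hence c: "2 * mink_const r \<le> c" "2 / (e - 1) \<le> c" using mc unfolding c_def by linarith+
      have "(2 * mink_const r * X) powr r \<le> (c * X) powr r"
        using c(1) X mc r by (intro powr_mono2 mult_right_mono) auto
      moreover have "(2 / (e - 1) * X) powr (r / (e - 1)) \<le> (c * X) powr (r / (e - 1))"
        using r e X by (intro powr_mono2 mult_right_mono[OF c(2)]) auto
      ultimately show ?thesis by (intro mult_mono) auto
    qed
    also have "\<dots> = (c * X) powr (r + r / (e - 1))" by (simp add: powr_add)
    also have "r + r / (e - 1) = ?q" using e by (simp add: field_simps)
    also have "c * X = ?B / l" by (simp add: c_def X_def)
    finally show ?thesis .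
  qed
  finally show "emeasure lebesgue {x. ennreal l < ?E x} \<le> ennreal ((?B / l) powr ?q)" by (simp add: ennreal_leI)
qed

text \<open>Times in a fixed interval away from \<open>t\<close>: the \<open>L\<^bsup>r,\<infinity>\<^esup>\<close> size of the integral stays bounded while its
supremum is small, and interpolation makes the \<open>L\<^bsup>q,\<infinity>\<^esup>\<close> size small.\<close>

lemma weak_type_time_integral_early:
  fixes D :: "real \<Rightarrow> 'a::euclidean_space \<Rightarrow> real"
  assumes D: "(\<lambda>(t, x). D t x) \<in> borel_measurable (lborel \<Otimes>\<^sub>M lborel)"
    and f: "\<And>\<tau>. \<tau> \<in> {0<..<T} \<Longrightarrow> weak_bound r A (D \<tau>)"
    and bd: "\<And>\<tau> x. \<tau> \<in> {0<..<T} \<Longrightarrow> \<bar>D \<tau> x\<bar> \<le> L"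
    and r: "1 < r" "r < q" and A: "0 < A" and T: "0 < T" and L: "0 < L"
  shows "weak_type q (((mink_const r * T * A) powr r * (L * T) powr (q - r)) powr (1 / q))
    (\<lambda>x. \<integral>\<^sup>+ \<tau>\<in>{0<..<T}. ennreal \<bar>D \<tau> x\<bar> \<partial>lborel)" (is "weak_type q _ ?E")
proof (rule weak_type_bounded)
  show "weak_type r (mink_const r * T * A) ?E"
    using T f r A by (intro weak_type_time_integral[OF D]) auto
  show "AE x in lebesgue. ?E x \<le> ennreal (L * T)"
  proof (rule AE_I2)
    fix x
    have "?E x \<le> (\<integral>\<^sup>+ \<tau>\<in>{0<..<T}. ennreal L \<partial>lborel)"
      using bd by (intro nn_integral_mono) (auto simp: indicator_def intro: ennreal_leI)
    also have "\<dots> = ennreal L * ennreal T" using T by (subst nn_integral_cmult_indicator) auto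
    also have "\<dots> = ennreal (L * T)" using L by (simp add: ennreal_mult')
    finally show "?E x \<le> ennreal (L * T)" .
  qed
qed (use assms mink_const_pos[OF r(1)] in auto)

section \<open>Integer powers of the Laplacian: integration by parts\<close>

text \<open>By translation invariance \<open>f (x + b) - f x\<close> has integral \<open>0\<close>; writing the difference as the integral of
\<open>f'\<close> along the segment and exchanging the integrals gives the integral of \<open>f'\<close>.\<close>

lemma integral_directional_derivative_eq_0:
  fixes f f' :: "'a::euclidean_space \<Rightarrow> real"
  assumes f: "integrable lborel f" and f': "integrable lborel f'" "continuous_on UNIV f'"
    and d: "\<And>x s. ((\<lambda>s. f (x + s *\<^sub>R b)) has_real_derivative f' (x + s *\<^sub>R b)) (at s)"
  shows "(LINT x|lborel. f' x) = 0"
proof -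
  have fm[measurable]: "f \<in> borel_measurable borel" "f' \<in> borel_measurable borel" using f f' by auto
  have d1: "lborel = distr lborel borel (\<lambda>x. c + x)" for c :: 'a
    by (rule lborel_distr_plus[symmetric])
  have shift: "(LINT x|lborel. g (x + c)) = (LINT x|lborel. g x)" "integrable lborel (\<lambda>x. g (x + c))"
    if "integrable lborel g" for g :: "'a \<Rightarrow> real" and c
  proof -
    have [measurable]: "g \<in> borel_measurable borel" using that by auto
    have "(LINT x|lborel. g x) = (LINT x|distr lborel borel (\<lambda>x. c + x). g x)" using d1[of c] by simp
    also have "\<dots> = (LINT x|lborel. g (c + x))" by (subst integral_distr) auto
    finally show "(LINT x|lborel. g (x + c)) = (LINT x|lborel. g x)" by (simp add: add.commute)
    have "integrable (distr lborel borel (\<lambda>x. c + x)) g" using that d1[of c] by simp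
    hence "integrable lborel (\<lambda>x. g (c + x))" by (subst (asm) integrable_distr_eq) auto
    thus "integrable lborel (\<lambda>x. g (x + c))" by (simp add: add.commute)
  qed
  have ftc: "f (x + b) - f x = (LINT s|lborel. indicator {0..1} s * f' (x + s *\<^sub>R b))" for x
  proof -
    have "(LINT s|lborel. indicator {0..1} s *\<^sub>R f' (x + s *\<^sub>R b)) = f (x + 1 *\<^sub>R b) - f (x + 0 *\<^sub>R b)"
    proof (rule integral_FTC_atLeastAtMost)
      show "((\<lambda>s. f (x + s *\<^sub>R b)) has_vector_derivative f' (x + s *\<^sub>R b)) (at s within {0..1})" for s
        using d[of x s] by (auto simp: has_real_derivative_iff_has_vector_derivative intro: has_vector_derivative_at_within)
      show "continuous_on {0..1} (\<lambda>s. f' (x + s *\<^sub>R b))"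
        by (intro continuous_on_compose2[OF f'(2)] continuous_intros) auto
    qed simp
    thus ?thesis by simp
  qed
  have prod: "integrable (lborel \<Otimes>\<^sub>M lborel) (\<lambda>(x, s). indicator {0..1} s * f' (x + s *\<^sub>R b))"
  proof (rule integrableI_bounded)
    show "(\<lambda>(x, s). indicator {0..1} s * f' (x + s *\<^sub>R b)) \<in> borel_measurable (lborel \<Otimes>\<^sub>M lborel)"
      by measurable
    have "(\<integral>\<^sup>+ z. ennreal (norm (case z of (x, s) \<Rightarrow> indicator {0..1} s * f' (x + s *\<^sub>R b))) \<partial>(lborel \<Otimes>\<^sub>M lborel)) =
        (\<integral>\<^sup>+ s. \<integral>\<^sup>+ x. ennreal (norm (indicator {0..1} s * f' (x + s *\<^sub>R b))) \<partial>lborel \<partial>lborel)"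
      by (subst lborel_pair.nn_integral_snd[symmetric]) (auto simp: case_prod_unfold)
    also have "\<dots> = (\<integral>\<^sup>+ s. indicator {0..1::real} s * (\<integral>\<^sup>+ x. ennreal (norm (f' x)) \<partial>lborel) \<partial>lborel)"
    proof (rule nn_integral_cong)
      fix s :: real
      have "(\<integral>\<^sup>+ x. ennreal (norm (indicator {0..1} s * f' (x + s *\<^sub>R b))) \<partial>lborel) =
          indicator {0..1} s * (\<integral>\<^sup>+ x. ennreal (norm (f' (x - (- s *\<^sub>R b)))) \<partial>lborel)"
        by (auto simp: indicator_def)
      also have "(\<integral>\<^sup>+ x. ennreal (norm (f' (x - (- s *\<^sub>R b)))) \<partial>lborel) = (\<integral>\<^sup>+ x. ennreal (norm (f' x)) \<partial>lborel)"
        by (rule nn_integral_lborel_shift[of "\<lambda>x. ennreal (norm (f' x))"]) measurable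
      finally show "(\<integral>\<^sup>+ x. ennreal (norm (indicator {0..1} s * f' (x + s *\<^sub>R b))) \<partial>lborel) =
          indicator {0..1} s * (\<integral>\<^sup>+ x. ennreal (norm (f' x)) \<partial>lborel)" .
    qed
    also have "\<dots> = (\<integral>\<^sup>+ x. ennreal (norm (f' x)) \<partial>lborel)" by (simp add: nn_integral_multc)
    also have "\<dots> < \<infinity>" using f'(1) by (simp add: integrable_iff_bounded)
    finally show "(\<integral>\<^sup>+ z. ennreal (norm (case z of (x, s) \<Rightarrow> indicator {0..1} s * f' (x + s *\<^sub>R b))) \<partial>(lborel \<Otimes>\<^sub>M lborel)) < \<infinity>" .
  qed
  have "0 = (LINT x|lborel. f (x + b) - f x)"
    using shift[OF f, of b] f by simp
  also have "\<dots> = (LINT x|lborel. LINT s|lborel. indicator {0..1} s * f' (x + s *\<^sub>R b))"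
    by (simp add: ftc)
  also have "\<dots> = (LINT s|lborel. LINT x|lborel. indicator {0..1} s * f' (x + s *\<^sub>R b))"
    using prod by (intro lborel_pair.Fubini_integral[symmetric]) simp
  also have "\<dots> = (LINT s|lborel. indicator {0..1::real} s * (LINT x|lborel. f' x))"
    using shift(1)[OF f'(1)] by simp
  also have "\<dots> = (LINT x|lborel. f' x)" by simp
  finally show ?thesis by simp
qed

text \<open>Polynomial functions on a Euclidean space. What matters is that the products of such functions with
the symbol are closed under directional derivatives and integrable.\<close>

inductive polynomial_fun :: "('a::euclidean_space \<Rightarrow> real) \<Rightarrow> bool" where
  poly_const: "polynomial_fun (\<lambda>x. c)"
| poly_inner: "polynomial_fun (\<lambda>x. x \<bullet> b)"
| poly_add: "polynomial_fun P \<Longrightarrow> polynomial_fun Q \<Longrightarrow> polynomial_fun (\<lambda>x. P x + Q x)"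
| poly_mult: "polynomial_fun P \<Longrightarrow> polynomial_fun Q \<Longrightarrow> polynomial_fun (\<lambda>x. P x * Q x)"

lemma polynomial_fun_sum: "finite I \<Longrightarrow> (\<And>i. i \<in> I \<Longrightarrow> polynomial_fun (P i)) \<Longrightarrow> polynomial_fun (\<lambda>x. \<Sum>i\<in>I. P i x)"
  by (induction I rule: finite_induct) (auto intro: polynomial_fun.intros)

lemma polynomial_fun_power: "polynomial_fun P \<Longrightarrow> polynomial_fun (\<lambda>x. P x ^ k)"
  by (induction k) (auto intro: polynomial_fun.intros)

lemma polynomial_fun_diff: "polynomial_fun P \<Longrightarrow> polynomial_fun Q \<Longrightarrow> polynomial_fun (\<lambda>x. P x - Q x)"
  using poly_add[OF _ poly_mult[OF poly_const[of "-1"]], of P Q] by simp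

lemma polynomial_fun_norm_sq: "polynomial_fun (\<lambda>x::'a::euclidean_space. (norm x)\<^sup>2)"
proof -
  have "polynomial_fun (\<lambda>x::'a. \<Sum>b\<in>Basis. (x \<bullet> b) * (x \<bullet> b))"
    by (intro polynomial_fun_sum poly_mult poly_inner) auto
  thus ?thesis by (simp add: power2_norm_eq_inner euclidean_inner[symmetric])
qed

lemma polynomial_fun_continuous: "polynomial_fun P \<Longrightarrow> continuous_on UNIV P"
  by (induction rule: polynomial_fun.induct) (auto intro!: continuous_intros)

lemma polynomial_fun_deriv:
  assumes "polynomial_fun P"
  shows "\<exists>P'. polynomial_fun P' \<and> (\<forall>x s. ((\<lambda>s. P (x + s *\<^sub>R b)) has_real_derivative P' (x + s *\<^sub>R b)) (at s))"
  using assms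
proof (induction rule: polynomial_fun.induct)
  case (poly_const c)
  show ?case by (rule exI[of _ "\<lambda>x. 0"]) (auto intro: polynomial_fun.intros)
next
  case (poly_inner c)
  show ?case
    by (rule exI[of _ "\<lambda>x. b \<bullet> c"]) (auto intro!: polynomial_fun.intros derivative_eq_intros simp: inner_add_left)
next
  case (poly_add P Q)
  then obtain P' Q' where *: "polynomial_fun P'" "polynomial_fun Q'"
    "\<And>x s. ((\<lambda>s. P (x + s *\<^sub>R b)) has_real_derivative P' (x + s *\<^sub>R b)) (at s)"
    "\<And>x s. ((\<lambda>s. Q (x + s *\<^sub>R b)) has_real_derivative Q' (x + s *\<^sub>R b)) (at s)" by blast
  show ?case
    by (rule exI[of _ "\<lambda>x. P' x + Q' x"]) (auto intro!: polynomial_fun.intros * DERIV_add)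
next
  case (poly_mult P Q)
  then obtain P' Q' where *: "polynomial_fun P'" "polynomial_fun Q'"
    "\<And>x s. ((\<lambda>s. P (x + s *\<^sub>R b)) has_real_derivative P' (x + s *\<^sub>R b)) (at s)"
    "\<And>x s. ((\<lambda>s. Q (x + s *\<^sub>R b)) has_real_derivative Q' (x + s *\<^sub>R b)) (at s)" by blast
  show ?case
    by (rule exI[of _ "\<lambda>x. P' x * Q x + Q' x * P x"])
      (auto intro!: polynomial_fun.intros poly_mult.hyps * DERIV_mult)
qed

lemma polynomial_fun_growth:
  assumes "polynomial_fun P"
  shows "\<exists>c k. \<forall>x. \<bar>P x\<bar> \<le> c * (1 + norm x) ^ k"
  using assms
proof (induction rule: polynomial_fun.induct)
  case (poly_const c)
  show ?case by (rule exI[of _ "\<bar>c\<bar>"], rule exI[of _ 0]) simp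
next
  case (poly_inner b)
  have "\<bar>x \<bullet> b\<bar> \<le> norm b * (1 + norm x) ^ 1" for x
    using Cauchy_Schwarz_ineq2[of x b] by (simp add: algebra_simps add_increasing)
  thus ?case by blast
next
  case (poly_add P Q)
  then obtain c k d l where *: "\<And>x. \<bar>P x\<bar> \<le> c * (1 + norm x) ^ k" "\<And>x. \<bar>Q x\<bar> \<le> d * (1 + norm x) ^ l" by blast
  have "\<bar>P x + Q x\<bar> \<le> (\<bar>c\<bar> + \<bar>d\<bar>) * (1 + norm x) ^ (k + l)" for x
  proof -
    have "c * (1 + norm x) ^ k \<le> \<bar>c\<bar> * (1 + norm x) ^ (k + l)"
      by (intro mult_mono power_increasing) auto
    moreover have "d * (1 + norm x) ^ l \<le> \<bar>d\<bar> * (1 + norm x) ^ (k + l)"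
      by (intro mult_mono power_increasing) auto
    ultimately show ?thesis using *(1)[of x] *(2)[of x] by (simp add: distrib_right)
  qed
  thus ?case by blast
next
  case (poly_mult P Q)
  then obtain c k d l where *: "\<And>x. \<bar>P x\<bar> \<le> c * (1 + norm x) ^ k" "\<And>x. \<bar>Q x\<bar> \<le> d * (1 + norm x) ^ l" by blast
  have "\<bar>P x * Q x\<bar> \<le> (c * d) * (1 + norm x) ^ (k + l)" for x
  proof -
    have "\<bar>P x\<bar> * \<bar>Q x\<bar> \<le> (c * (1 + norm x) ^ k) * (d * (1 + norm x) ^ l)"
      by (intro mult_mono *) (use *(1)[of x] in linarith, simp)
    thus ?thesis by (simp add: abs_mult power_add mult_ac)
  qed
  thus ?case by blast
qed

lemma nn_integral_cauchy_weight: "(\<integral>\<^sup>+ (x::real). ennreal (1 / (1 + x\<^sup>2)) \<partial>lborel) < \<infinity>"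
proof -
  have "(\<integral>\<^sup>+ (x::real). ennreal (1 / (1 + x\<^sup>2)) * indicator {0..} x \<partial>lborel) = ennreal (pi / 2 - arctan 0)"
    by (rule nn_integral_FTC_atLeast[where F = arctan])
      (auto intro!: derivative_eq_intros tendsto_arctan_at_top simp: field_simps)
  hence P: "(\<integral>\<^sup>+ (x::real). ennreal (1 / (1 + x\<^sup>2)) * indicator {0..} x \<partial>lborel) < \<infinity>" by simp
  have "(\<integral>\<^sup>+ (x::real). ennreal (1 / (1 + (0 - x)\<^sup>2)) * indicator {0..} (0 - x) \<partial>lborel) =
    (\<integral>\<^sup>+ (x::real). ennreal (1 / (1 + x\<^sup>2)) * indicator {0..} x \<partial>lborel)"
    by (rule nn_integral_lborel_reflect[of "\<lambda>x::real. ennreal (1 / (1 + x\<^sup>2)) * indicator {0..} x" 0]) measurable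
  with P have N: "(\<integral>\<^sup>+ (x::real). ennreal (1 / (1 + (0 - x)\<^sup>2)) * indicator {0..} (0 - x) \<partial>lborel) < \<infinity>" by simp
  have "(\<integral>\<^sup>+ (x::real). ennreal (1 / (1 + x\<^sup>2)) \<partial>lborel) \<le>
    (\<integral>\<^sup>+ (x::real). ennreal (1 / (1 + x\<^sup>2)) * indicator {0..} x + ennreal (1 / (1 + (0 - x)\<^sup>2)) * indicator {0..} (0 - x) \<partial>lborel)"
    by (intro nn_integral_mono) (auto simp: indicator_def)
  also have "\<dots> = (\<integral>\<^sup>+ (x::real). ennreal (1 / (1 + x\<^sup>2)) * indicator {0..} x \<partial>lborel) +
    (\<integral>\<^sup>+ (x::real). ennreal (1 / (1 + (0 - x)\<^sup>2)) * indicator {0..} (0 - x) \<partial>lborel)"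
    by (intro nn_integral_add) measurable
  also have "\<dots> < \<infinity>" using P N by simp
  finally show ?thesis .
qed

text \<open>An integrable weight that is a product of functions of one coordinate. It can be produced by
integrating by parts in one coordinate at a time.\<close>

definition cauchy_weight :: "'a::euclidean_space \<Rightarrow> real" where
  "cauchy_weight x = (\<Prod>b\<in>Basis. 1 / (1 + (x \<bullet> b)\<^sup>2))"

lemma integrable_cauchy_weight: "integrable lborel (cauchy_weight :: 'a::euclidean_space \<Rightarrow> real)"
proof (rule integrableI_bounded)
  show "(cauchy_weight :: 'a \<Rightarrow> real) \<in> borel_measurable lborel" unfolding cauchy_weight_def by measurable
  have "(\<integral>\<^sup>+ (x::'a). ennreal (norm (cauchy_weight x)) \<partial>lborel) = (\<integral>\<^sup>+ (x::'a). (\<Prod>b\<in>Basis. ennreal (1 / (1 + (x \<bullet> b)\<^sup>2))) \<partial>lborel)"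
    by (intro nn_integral_cong) (auto simp: cauchy_weight_def prod_ennreal abs_prod)
  also have "\<dots> = (\<Prod>b\<in>(Basis::'a set). (\<integral>\<^sup>+ (x::real). ennreal (1 / (1 + x\<^sup>2)) \<partial>lborel))"
    by (rule nn_integral_lborel_prod) auto
  also have "\<dots> < \<infinity>" using nn_integral_cauchy_weight by (simp add: power_less_top_ennreal)
  finally show "(\<integral>\<^sup>+ (x::'a). ennreal (norm (cauchy_weight x)) \<partial>lborel) < \<infinity>" .
qed

lemma cauchy_weight_ge: "1 / (1 + norm x) ^ (2 * DIM('a)) \<le> cauchy_weight (x :: 'a::euclidean_space)"
proof -
  have "(\<Prod>b\<in>(Basis::'a set). 1 / (1 + norm x) ^ 2) \<le> cauchy_weight x"
    unfolding cauchy_weight_def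
  proof (rule prod_mono, safe)
    fix b :: 'a assume b: "b \<in> Basis"
    have "(x \<bullet> b)\<^sup>2 \<le> (norm x)\<^sup>2" using Basis_le_norm[OF b, of x] by (simp add: abs_le_square_iff[symmetric])
    moreover have "(1 + norm x)\<^sup>2 = 1 + 2 * norm x + (norm x)\<^sup>2" by (simp add: power2_eq_square algebra_simps)
    ultimately have "1 + (x \<bullet> b)\<^sup>2 \<le> (1 + norm x)\<^sup>2" using norm_ge_zero[of x] by linarith
    moreover have "0 < 1 + (x \<bullet> b)\<^sup>2" by (simp add: add_pos_nonneg)
    moreover have "0 < (1 + norm x)\<^sup>2" using calculation by linarith
    ultimately show "1 / (1 + norm x)\<^sup>2 \<le> 1 / (1 + (x \<bullet> b)\<^sup>2)" by (intro divide_left_mono) (auto intro!: mult_pos_pos)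
  qed auto
  thus ?thesis by (simp add: power_one_over power_mult)
qed

lemma integrable_polynomial_decay:
  fixes f :: "'a::euclidean_space \<Rightarrow> real"
  assumes "f \<in> borel_measurable borel" and "\<And>x. \<bar>f x\<bar> * (1 + norm x) ^ (2 * DIM('a)) \<le> c"
  shows "integrable lborel f"
proof (rule Bochner_Integration.integrable_bound[where f = "\<lambda>x. c * cauchy_weight x"])
  show "AE x in lborel. norm (f x) \<le> norm (c * cauchy_weight x)"
  proof (rule AE_I2)
    fix x :: 'a
    have p: "0 < (1 + norm x) ^ (2 * DIM('a))" by (intro zero_less_power) (simp add: add_pos_nonneg)
    have "0 \<le> \<bar>f x\<bar> * (1 + norm x) ^ (2 * DIM('a))" using p by simp
    hence c: "0 \<le> c" using assms(2)[of x] by linarith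
    have "\<bar>f x\<bar> \<le> c * (1 / (1 + norm x) ^ (2 * DIM('a)))" using assms(2)[of x] p by (simp add: field_simps)
    also have "\<dots> \<le> c * cauchy_weight x" using c by (intro mult_left_mono cauchy_weight_ge)
    finally show "norm (f x) \<le> norm (c * cauchy_weight x)" by simp
  qed
qed (use assms integrable_cauchy_weight in auto)

text \<open>For \<open>y > 1\<close> compare with a single term of the exponential series of \<open>y powr a\<close> whose power is at least
\<open>k\<close>.\<close>

lemma poly_exp_bounded:
  fixes a :: real
  assumes a: "0 < a"
  shows "\<exists>c. \<forall>y\<ge>0. (1 + y) ^ k * exp (- (y powr a)) \<le> c"
proof -
  define j where "j = nat \<lceil>real k / a\<rceil>"
  have j: "real k \<le> a * real j"
  proof -
    have "real k / a \<le> real j" unfolding j_def by linarith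
    thus ?thesis using a by (simp add: field_simps)
  qed
  have "(1 + y) ^ k * exp (- (y powr a)) \<le> 2 ^ k * fact j + 2 ^ k" if y: "0 \<le> y" for y
  proof (cases "y \<le> 1")
    case True
    have "(1 + y) ^ k * exp (- (y powr a)) \<le> 2 ^ k * 1"
      using True y by (intro mult_mono power_mono) auto
    also have "\<dots> \<le> 2 ^ k * fact j + 2 ^ k" by simp
    finally show ?thesis .
  next
    case False
    hence y1: "1 < y" by simp
    have "(1 + y) ^ k \<le> (2 * y) ^ k" using y1 by (intro power_mono) auto
    also have "\<dots> = 2 ^ k * y powr k" using y1 by (simp add: power_mult_distrib powr_realpow)
    also have "y powr k \<le> y powr (a * j)" using y1 j by (intro powr_mono) auto
    also have "y powr (a * j) = (y powr a) ^ j"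
      using y1 by (simp add: powr_powr[symmetric] powr_realpow)
    also have "(y powr a) ^ j \<le> fact j * exp (y powr a)"
    proof -
      have "(y powr a) ^ j / fact j \<le> exp (y powr a)"
        using sum_le_suminf[of "\<lambda>n. (y powr a) ^ n /\<^sub>R fact n" "{j}"] exp_converges[of "y powr a"]
        by (simp add: sums_iff divide_inverse mult.commute)
      thus ?thesis by (simp add: field_simps)
    qed
    finally have "(1 + y) ^ k \<le> 2 ^ k * (fact j * exp (y powr a))" by simp
    hence "(1 + y) ^ k * exp (- (y powr a)) \<le> 2 ^ k * (fact j * exp (y powr a)) * exp (- (y powr a))"
      by (intro mult_right_mono) auto
    also have "\<dots> = 2 ^ k * fact j" by (simp add: exp_minus field_simps)
    finally show ?thesis by (simp add: add_increasing2)
  qed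
  thus ?thesis by blast
qed

text \<open>The Fourier transform of an even real function, without the normalising constant. All symbols here are
even, so complex values are avoided.\<close>

definition cos_transform :: "('a::euclidean_space \<Rightarrow> real) \<Rightarrow> 'a \<Rightarrow> real" where
  "cos_transform g x = (LINT \<xi>|lborel. cos (x \<bullet> \<xi>) * g \<xi>)"

lemma integrable_cos_mult:
  fixes g :: "'a::euclidean_space \<Rightarrow> real"
  assumes "integrable lborel g"
  shows "integrable lborel (\<lambda>\<xi>. cos (x \<bullet> \<xi>) * g \<xi>)"
proof (rule Bochner_Integration.integrable_bound[OF assms])
  have [measurable]: "g \<in> borel_measurable borel" using assms by auto
  show "(\<lambda>\<xi>. cos (x \<bullet> \<xi>) * g \<xi>) \<in> borel_measurable lborel" by measurable
  show "AE \<xi> in lborel. norm (cos (x \<bullet> \<xi>) * g \<xi>) \<le> norm (g \<xi>)"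
    by (rule AE_I2) (simp add: abs_mult mult_left_le_one_le)
qed

lemma abs_cos_transform_le:
  assumes "integrable lborel g"
  shows "\<bar>cos_transform g x\<bar> \<le> (LINT \<xi>|lborel. \<bar>g \<xi>\<bar>)"
proof -
  have "\<bar>cos_transform g x\<bar> \<le> (LINT \<xi>|lborel. norm (cos (x \<bullet> \<xi>) * g \<xi>))"
    unfolding cos_transform_def using integral_norm_bound[of lborel "\<lambda>\<xi>. cos (x \<bullet> \<xi>) * g \<xi>"] by simp
  also have "\<dots> \<le> (LINT \<xi>|lborel. \<bar>g \<xi>\<bar>)"
    using integrable_norm[OF integrable_cos_mult[OF assms]] assms
    by (intro integral_mono) (auto simp: abs_mult mult_left_le_one_le)
  finally show ?thesis .
qed

lemma cos_transform_dominated: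
  fixes g :: "nat \<Rightarrow> 'a::euclidean_space \<Rightarrow> real"
  assumes "integrable lborel w" "\<And>n. g n \<in> borel_measurable borel" "h \<in> borel_measurable borel"
    and "\<And>n \<xi>. \<bar>g n \<xi>\<bar> \<le> w \<xi>" and "AE \<xi> in lborel. (\<lambda>n. g n \<xi>) \<longlonglongrightarrow> h \<xi>" and X: "X \<longlonglongrightarrow> x"
  shows "(\<lambda>n. cos_transform (g n) (X n)) \<longlonglongrightarrow> cos_transform h x"
  unfolding cos_transform_def
proof (rule integral_dominated_convergence[where w = w])
  note [measurable] = assms(2,3)
  show "(\<lambda>\<xi>. cos (x \<bullet> \<xi>) * h \<xi>) \<in> borel_measurable lborel" by measurable
  show "(\<lambda>\<xi>. cos (X n \<bullet> \<xi>) * g n \<xi>) \<in> borel_measurable lborel" for n by measurable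
  show "integrable lborel w" by fact
  show "AE \<xi> in lborel. (\<lambda>n. cos (X n \<bullet> \<xi>) * g n \<xi>) \<longlonglongrightarrow> cos (x \<bullet> \<xi>) * h \<xi>"
    using assms(5) by eventually_elim (intro tendsto_intros X)
  show "AE \<xi> in lborel. norm (cos (X n \<bullet> \<xi>) * g n \<xi>) \<le> w \<xi>" for n
  proof (rule AE_I2)
    fix \<xi>
    have "norm (cos (X n \<bullet> \<xi>) * g n \<xi>) \<le> \<bar>g n \<xi>\<bar>" by (simp add: abs_mult mult_left_le_one_le)
    thus "norm (cos (X n \<bullet> \<xi>) * g n \<xi>) \<le> w \<xi>" using assms(4)[of n \<xi>] by linarith
  qed
qed

lemma continuous_cos_transform:
  assumes "integrable lborel g"
  shows "continuous_on UNIV (cos_transform g)"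
  unfolding continuous_on_sequentially comp_def
proof (intro allI ballI impI, elim conjE)
  fix X :: "nat \<Rightarrow> 'a" and x assume X: "X \<longlonglongrightarrow> x"
  show "(\<lambda>n. cos_transform g (X n)) \<longlonglongrightarrow> cos_transform g x"
    using assms X by (intro cos_transform_dominated[where w = "\<lambda>\<xi>. \<bar>g \<xi>\<bar>"]) auto
qed

lemma borel_measurable_cos_transform:
  "integrable lborel g \<Longrightarrow> cos_transform g \<in> borel_measurable borel"
  by (intro borel_measurable_continuous_onI continuous_cos_transform)

lemma cos_transform_scale:
  fixes g :: "'a::euclidean_space \<Rightarrow> real"
  assumes g: "g \<in> borel_measurable borel" and c: "0 < c"
  shows "cos_transform (\<lambda>\<xi>. g (c *\<^sub>R \<xi>)) x = cos_transform g (x /\<^sub>R c) / c ^ DIM('a)"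
proof -
  note [measurable] = g
  have "cos_transform g (x /\<^sub>R c) = (LINT \<xi>|density (distr lborel borel (\<lambda>\<xi>. 0 + c *\<^sub>R \<xi>)) (\<lambda>_. \<bar>c\<bar> ^ DIM('a)). cos ((x /\<^sub>R c) \<bullet> \<xi>) * g \<xi>)"
    unfolding cos_transform_def using c by (subst lborel_affine[of c 0]) auto
  also have "\<dots> = (LINT \<xi>|distr lborel borel (\<lambda>\<xi>. 0 + c *\<^sub>R \<xi>). c ^ DIM('a) * (cos ((x /\<^sub>R c) \<bullet> \<xi>) * g \<xi>))"
    using c by (subst integral_density) auto
  also have "\<dots> = (LINT \<xi>|lborel. c ^ DIM('a) * (cos ((x /\<^sub>R c) \<bullet> (c *\<^sub>R \<xi>)) * g (c *\<^sub>R \<xi>)))"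
    by (subst integral_distr) auto
  also have "\<dots> = c ^ DIM('a) * cos_transform (\<lambda>\<xi>. g (c *\<^sub>R \<xi>)) x"
    unfolding cos_transform_def using c by (subst integral_mult_right_zero[symmetric]) (simp flip: mult.assoc)
  finally show ?thesis using c by simp
qed

text \<open>The \<open>L\<^sup>1\<close> norm of a transform is invariant under dilation of the symbol. Hence one Gaussian stands for
all of them, and the kernel at time \<open>1\<close> for all times.\<close>

lemma nn_integral_cos_transform_scale:
  fixes g :: "'a::euclidean_space \<Rightarrow> real"
  assumes g: "integrable lborel g" and c: "0 < c"
  shows "L1_norm (cos_transform (\<lambda>\<xi>. g (c *\<^sub>R \<xi>))) = L1_norm (cos_transform g)"
proof -
  note [measurable] = borel_measurable_cos_transform[OF g]
  have [measurable]: "g \<in> borel_measurable borel" using g by auto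
  have "L1_norm (cos_transform (\<lambda>\<xi>. g (c *\<^sub>R \<xi>))) =
      (\<integral>\<^sup>+ x. ennreal (\<bar>inverse c\<bar> ^ DIM('a)) * ennreal \<bar>cos_transform g (0 + inverse c *\<^sub>R x)\<bar> \<partial>lborel)"
    using c by (intro nn_integral_cong) (simp add: cos_transform_scale abs_mult power_inverse divide_inverse mult.commute flip: ennreal_mult')
  also have "\<dots> = ennreal (\<bar>inverse c\<bar> ^ DIM('a)) * L1_norm (\<lambda>x. cos_transform g (0 + inverse c *\<^sub>R x))"
    by (intro nn_integral_cmult) measurable
  also have "\<dots> = L1_norm (cos_transform g)"
    using c by (intro nn_integral_lborel_affine[symmetric]) auto
  finally show ?thesis .
qed

definition frac_symbol :: "real \<Rightarrow> 'a::euclidean_space \<Rightarrow> real" where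
  "frac_symbol m \<xi> = exp (- (norm \<xi> powr (2 * m)))"

lemma frac_symbol_measurable [measurable]: "frac_symbol m \<in> borel_measurable borel"
  unfolding frac_symbol_def by measurable

lemma integrable_polynomial_frac_symbol:
  fixes P :: "'a::euclidean_space \<Rightarrow> real"
  assumes m: "0 < m" and P: "polynomial_fun P"
  shows "integrable lborel (\<lambda>\<xi>. P \<xi> * frac_symbol m \<xi>)"
proof -
  have [measurable]: "P \<in> borel_measurable borel"
    using polynomial_fun_continuous[OF P] by (rule borel_measurable_continuous_onI)
  obtain c k where ck: "\<And>x. \<bar>P x\<bar> \<le> c * (1 + norm x) ^ k" using polynomial_fun_growth[OF P] by blast
  obtain d where d: "\<And>y::real. 0 \<le> y \<Longrightarrow> (1 + y) ^ (k + 2 * DIM('a)) * exp (- (y powr (2 * m))) \<le> d"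
    using poly_exp_bounded[of "2 * m" "k + 2 * DIM('a)"] m by auto
  have c: "0 \<le> c" using ck[of 0] by simp
  show ?thesis
  proof (rule integrable_polynomial_decay[where c = "c * d"])
    fix x :: 'a
    have "\<bar>P x * frac_symbol m x\<bar> * (1 + norm x) ^ (2 * DIM('a)) =
        \<bar>P x\<bar> * (frac_symbol m x * (1 + norm x) ^ (2 * DIM('a)))"
      by (simp add: abs_mult frac_symbol_def)
    also have "\<dots> \<le> c * (1 + norm x) ^ k * (frac_symbol m x * (1 + norm x) ^ (2 * DIM('a)))"
      by (intro mult_right_mono ck) (simp add: frac_symbol_def)
    also have "\<dots> = c * ((1 + norm x) ^ (k + 2 * DIM('a)) * exp (- (norm x powr (2 * m))))"
      by (simp add: frac_symbol_def power_add mult_ac)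
    also have "\<dots> \<le> c * d" by (intro mult_left_mono c d) simp
    finally show "\<bar>P x * frac_symbol m x\<bar> * (1 + norm x) ^ (2 * DIM('a)) \<le> c * d" .
  qed measurable
qed

lemma integrable_frac_symbol: "0 < m \<Longrightarrow> integrable lborel (frac_symbol m :: 'a::euclidean_space \<Rightarrow> real)"
  using integrable_polynomial_frac_symbol[OF _ poly_const[of 1]] by simp

lemma frac_symbol_nat: "1 \<le> k \<Longrightarrow> frac_symbol (real k) \<xi> = exp (- (((norm \<xi>)\<^sup>2) ^ k))"
  using powr_realpow[of "norm \<xi>" "2 * k"]
  by (cases "\<xi> = 0") (simp_all add: frac_symbol_def power_mult power_0_left)

lemma polynomial_symbol_deriv:
  fixes P :: "'a::euclidean_space \<Rightarrow> real"
  assumes k: "1 \<le> k" and P: "polynomial_fun P"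
  shows "\<exists>R. polynomial_fun R \<and>
    (\<forall>x s. ((\<lambda>s. P (x + s *\<^sub>R b) * frac_symbol (real k) (x + s *\<^sub>R b)) has_real_derivative
      R (x + s *\<^sub>R b) * frac_symbol (real k) (x + s *\<^sub>R b)) (at s))"
proof -
  define Q where "Q \<xi> = ((norm \<xi>)\<^sup>2) ^ k" for \<xi> :: 'a
  have Q: "polynomial_fun Q"
    unfolding Q_def by (intro polynomial_fun_power polynomial_fun_norm_sq)
  obtain P' where P': "polynomial_fun P'"
    "\<And>x s. ((\<lambda>s. P (x + s *\<^sub>R b)) has_real_derivative P' (x + s *\<^sub>R b)) (at s)"
    using polynomial_fun_deriv[OF P] by blast
  obtain Q' where Q': "polynomial_fun Q'"
    "\<And>x s. ((\<lambda>s. Q (x + s *\<^sub>R b)) has_real_derivative Q' (x + s *\<^sub>R b)) (at s)"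
    using polynomial_fun_deriv[OF Q] by blast
  have \<phi>: "frac_symbol (real k) = (\<lambda>\<xi>::'a. exp (- Q \<xi>))"
    using k by (simp add: fun_eq_iff Q_def frac_symbol_nat)
  show ?thesis
  proof (intro exI conjI allI)
    show "polynomial_fun (\<lambda>x. P' x - P x * Q' x)"
      by (intro polynomial_fun_diff poly_mult P P' Q')
    show "((\<lambda>s. P (x + s *\<^sub>R b) * frac_symbol (real k) (x + s *\<^sub>R b)) has_real_derivative
      (P' (x + s *\<^sub>R b) - P (x + s *\<^sub>R b) * Q' (x + s *\<^sub>R b)) * frac_symbol (real k) (x + s *\<^sub>R b)) (at s)" for x s
      unfolding \<phi>
      by (rule DERIV_cong[OF DERIV_mult[OF P'(2) DERIV_chain2[OF DERIV_exp DERIV_minus[OF Q'(2)]]]])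
        (simp add: algebra_simps)
  qed
qed

text \<open>The field \<open>cos (x \<bullet> \<xi>) * f' + (x \<bullet> b) * sin (x \<bullet> \<xi>) * f\<close>, with \<open>f'\<close> the derivative of \<open>f\<close> in
direction \<open>b\<close>, has derivative \<open>cos (x \<bullet> \<xi>) * (f'' + (x \<bullet> b)\<^sup>2 * f)\<close>, which integrates to \<open>0\<close>.
So the weight \<open>1 + (x \<bullet> b)\<^sup>2\<close> turns the transform of \<open>f\<close> into that of \<open>f - f''\<close>.\<close>

lemma cos_transform_weight_step:
  fixes P :: "'a::euclidean_space \<Rightarrow> real"
  assumes k: "1 \<le> k" and P: "polynomial_fun P"
  shows "\<exists>R. polynomial_fun R \<and> (\<forall>x. (1 + (x \<bullet> b)\<^sup>2) * cos_transform (\<lambda>\<xi>. P \<xi> * frac_symbol (real k) \<xi>) x =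
    cos_transform (\<lambda>\<xi>. R \<xi> * frac_symbol (real k) \<xi>) x)"
proof -
  define \<phi> :: "'a \<Rightarrow> real" where "\<phi> = frac_symbol (real k)"
  obtain P1 where P1: "polynomial_fun P1" "\<And>x s. ((\<lambda>s. P (x + s *\<^sub>R b) * \<phi> (x + s *\<^sub>R b)) has_real_derivative
      P1 (x + s *\<^sub>R b) * \<phi> (x + s *\<^sub>R b)) (at s)"
    using polynomial_symbol_deriv[OF k P, of b, folded \<phi>_def] by blast
  obtain P2 where P2: "polynomial_fun P2" "\<And>x s. ((\<lambda>s. P1 (x + s *\<^sub>R b) * \<phi> (x + s *\<^sub>R b)) has_real_derivative
      P2 (x + s *\<^sub>R b) * \<phi> (x + s *\<^sub>R b)) (at s)"
    using polynomial_symbol_deriv[OF k P1(1), of b, folded \<phi>_def] by blast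
  have I: "integrable lborel (\<lambda>\<xi>. Q \<xi> * \<phi> \<xi>)" if "polynomial_fun Q" for Q
    unfolding \<phi>_def using k that by (intro integrable_polynomial_frac_symbol) auto
  have cont: "continuous_on UNIV \<phi>"
    unfolding \<phi>_def using k by (simp add: frac_symbol_nat cong: continuous_on_cong) (intro continuous_intros)
  note C = polynomial_fun_continuous
  have main: "(x \<bullet> b)\<^sup>2 * cos_transform (\<lambda>\<xi>. P \<xi> * \<phi> \<xi>) x = - cos_transform (\<lambda>\<xi>. P2 \<xi> * \<phi> \<xi>) x" for x
  proof -
    let ?f = "\<lambda>\<xi>. cos (x \<bullet> \<xi>) * (P1 \<xi> * \<phi> \<xi>) + (x \<bullet> b) * (sin (x \<bullet> \<xi>) * (P \<xi> * \<phi> \<xi>))"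
    let ?f' = "\<lambda>\<xi>. cos (x \<bullet> \<xi>) * (P2 \<xi> * \<phi> \<xi>) + (x \<bullet> b)\<^sup>2 * (cos (x \<bullet> \<xi>) * (P \<xi> * \<phi> \<xi>))"
    have "(LINT \<xi>|lborel. ?f' \<xi>) = 0"
    proof (rule integral_directional_derivative_eq_0)
      have "integrable lborel (\<lambda>\<xi>. sin (x \<bullet> \<xi>) * (P \<xi> * \<phi> \<xi>))"
      proof (rule Bochner_Integration.integrable_bound[OF I[OF P]])
        have [measurable]: "\<phi> \<in> borel_measurable borel" "P \<in> borel_measurable borel"
          using cont C[OF P] by (auto intro: borel_measurable_continuous_onI)
        show "(\<lambda>\<xi>. sin (x \<bullet> \<xi>) * (P \<xi> * \<phi> \<xi>)) \<in> borel_measurable lborel" by measurable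
        show "AE \<xi> in lborel. norm (sin (x \<bullet> \<xi>) * (P \<xi> * \<phi> \<xi>)) \<le> norm (P \<xi> * \<phi> \<xi>)"
        proof (rule AE_I2)
          fix \<xi>
          show "norm (sin (x \<bullet> \<xi>) * (P \<xi> * \<phi> \<xi>)) \<le> norm (P \<xi> * \<phi> \<xi>)"
            using mult_left_le_one_le[of "norm (P \<xi> * \<phi> \<xi>)" "\<bar>sin (x \<bullet> \<xi>)\<bar>"] by (simp add: abs_mult)
        qed
      qed
      thus "integrable lborel ?f"
        by (intro Bochner_Integration.integrable_add integrable_mult_right integrable_cos_mult I P1)
      show "integrable lborel ?f'"
        by (intro Bochner_Integration.integrable_add integrable_mult_right integrable_cos_mult I P P2)
      show "continuous_on UNIV ?f'"
        by (intro continuous_intros cont C P P2)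
      fix y and s :: real
      have "((\<lambda>s. x \<bullet> (y + s *\<^sub>R b)) has_real_derivative (x \<bullet> b)) (at s)"
        by (auto intro!: derivative_eq_intros simp: inner_add_right)
      note d = DERIV_cos[THEN DERIV_chain2, OF this] DERIV_sin[THEN DERIV_chain2, OF this]
      show "((\<lambda>s. ?f (y + s *\<^sub>R b)) has_real_derivative ?f' (y + s *\<^sub>R b)) (at s)"
        by (rule DERIV_cong[OF DERIV_add[OF DERIV_mult[OF d(1) P2(2)] DERIV_cmult[OF DERIV_mult[OF d(2) P1(2)]]]])
          (simp add: algebra_simps power2_eq_square)
    qed
    moreover have "(LINT \<xi>|lborel. ?f' \<xi>) = cos_transform (\<lambda>\<xi>. P2 \<xi> * \<phi> \<xi>) x + (x \<bullet> b)\<^sup>2 * cos_transform (\<lambda>\<xi>. P \<xi> * \<phi> \<xi>) x"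
      unfolding cos_transform_def
      by (subst Bochner_Integration.integral_add) (auto intro!: integrable_mult_right integrable_cos_mult I P P2)
    ultimately show ?thesis by linarith
  qed
  have "(1 + (x \<bullet> b)\<^sup>2) * cos_transform (\<lambda>\<xi>. P \<xi> * \<phi> \<xi>) x = cos_transform (\<lambda>\<xi>. (P \<xi> - P2 \<xi>) * \<phi> \<xi>) x" for x
  proof -
    have "cos_transform (\<lambda>\<xi>. (P \<xi> - P2 \<xi>) * \<phi> \<xi>) x = cos_transform (\<lambda>\<xi>. P \<xi> * \<phi> \<xi>) x - cos_transform (\<lambda>\<xi>. P2 \<xi> * \<phi> \<xi>) x"
      unfolding cos_transform_def
      by (subst Bochner_Integration.integral_diff[OF integrable_cos_mult[OF I[OF P]] integrable_cos_mult[OF I[OF P2(1)]], symmetric])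
        (simp add: algebra_simps)
    thus ?thesis using main[of x] by (simp add: algebra_simps)
  qed
  thus ?thesis using polynomial_fun_diff[OF P P2(1)] unfolding \<phi>_def by blast
qed

text \<open>For integer \<open>m\<close> the symbol is the exponential of a polynomial. Applying the preceding lemma once in
every coordinate direction multiplies the transform by the reciprocal of the Cauchy weight and leaves it
bounded.\<close>

lemma cos_transform_nat_decay:
  assumes k: "1 \<le> k"
  shows "\<exists>c. \<forall>x::'a::euclidean_space. \<bar>cos_transform (frac_symbol (real k)) x\<bar> \<le> c * cauchy_weight x"
proof -
  have "\<exists>R. polynomial_fun R \<and> (\<forall>x::'a. (\<Prod>b\<in>S. 1 + (x \<bullet> b)\<^sup>2) * cos_transform (frac_symbol (real k)) x =
    cos_transform (\<lambda>\<xi>. R \<xi> * frac_symbol (real k) \<xi>) x)" if "finite S" for S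
    using that
  proof induction
    case empty
    show ?case using poly_const[of 1] by (intro exI[of _ "\<lambda>x. 1"]) auto
  next
    case (insert b S)
    then obtain R where R: "polynomial_fun R" "\<And>x. (\<Prod>b\<in>S. 1 + (x \<bullet> b)\<^sup>2) * cos_transform (frac_symbol (real k)) x =
      cos_transform (\<lambda>\<xi>. R \<xi> * frac_symbol (real k) \<xi>) x" by blast
    obtain R' where R': "polynomial_fun R'" "\<And>x. (1 + (x \<bullet> b)\<^sup>2) * cos_transform (\<lambda>\<xi>. R \<xi> * frac_symbol (real k) \<xi>) x =
      cos_transform (\<lambda>\<xi>. R' \<xi> * frac_symbol (real k) \<xi>) x"
      using cos_transform_weight_step[OF k R(1)] by blast
    show ?case
      using R'(1) insert.hyps by (intro exI[of _ R']) (auto simp: R'(2)[symmetric] R(2)[symmetric] mult.assoc)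
  qed
  from this[of "Basis :: 'a set"] obtain R where R: "polynomial_fun R"
    "\<And>x::'a. (\<Prod>b\<in>Basis. 1 + (x \<bullet> b)\<^sup>2) * cos_transform (frac_symbol (real k)) x =
      cos_transform (\<lambda>\<xi>. R \<xi> * frac_symbol (real k) \<xi>) x" by auto
  have I: "integrable lborel (\<lambda>\<xi>. R \<xi> * frac_symbol (real k) \<xi>)"
    using k R(1) by (intro integrable_polynomial_frac_symbol) auto
  have "\<bar>cos_transform (frac_symbol (real k)) x\<bar> \<le> (LINT \<xi>|lborel. \<bar>R \<xi> * frac_symbol (real k) \<xi>\<bar>) * cauchy_weight x" for x :: 'a
  proof -
    let ?p = "\<Prod>b\<in>Basis. 1 + (x \<bullet> b)\<^sup>2"
    have p: "0 < ?p" by (intro prod_pos) (auto simp: add_pos_nonneg)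
    have "?p * \<bar>cos_transform (frac_symbol (real k)) x\<bar> = \<bar>cos_transform (\<lambda>\<xi>. R \<xi> * frac_symbol (real k) \<xi>) x\<bar>"
      unfolding R(2)[symmetric] using p by (simp only: abs_mult abs_of_pos)
    also have "\<dots> \<le> (LINT \<xi>|lborel. \<bar>R \<xi> * frac_symbol (real k) \<xi>\<bar>)" by (rule abs_cos_transform_le[OF I])
    finally have "\<bar>cos_transform (frac_symbol (real k)) x\<bar> \<le> (LINT \<xi>|lborel. \<bar>R \<xi> * frac_symbol (real k) \<xi>\<bar>) / ?p"
      using p by (simp add: field_simps)
    thus ?thesis by (simp add: cauchy_weight_def prod_dividef)
  qed
  thus ?thesis by blast
qed

lemma nn_integral_cos_transform_nat:
  assumes k: "1 \<le> k"
  shows "L1_norm (cos_transform (frac_symbol (real k) :: 'a::euclidean_space \<Rightarrow> real)) < \<infinity>"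
proof -
  obtain c where c: "\<And>x::'a. \<bar>cos_transform (frac_symbol (real k)) x\<bar> \<le> c * cauchy_weight x"
    using cos_transform_nat_decay[OF k] by blast
  have w: "0 \<le> cauchy_weight x" for x :: 'a by (auto simp: cauchy_weight_def intro!: prod_nonneg)
  have "L1_norm (cos_transform (frac_symbol (real k) :: 'a \<Rightarrow> real)) \<le> (\<integral>\<^sup>+ x. ennreal (norm (c * cauchy_weight (x::'a))) \<partial>lborel)"
    using c by (intro nn_integral_mono ennreal_leI) (metis abs_ge_self order_trans real_norm_def)
  also have "\<dots> < \<infinity>"
    using integrable_mult_right[OF integrable_cauchy_weight, of c] unfolding integrable_iff_bounded by (rule conjunct2)
  finally show ?thesis .
qed

section \<open>Fractional powers of the Laplacian: subordination\<close>

text \<open>The factor \<open>x powr (- 1 / m)\<close> makes \<open>x * (1 - exp (- \<rho> * x powr (- 1 / m))) powr m\<close> tend to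
\<open>\<rho> powr m\<close>, and the limit is an instance of \<open>(1 - y / x) powr x \<longrightarrow> exp (- y)\<close>.\<close>

lemma exp_powr_limit:
  fixes m \<rho> :: real assumes "0 < m" "0 < \<rho>"
  shows "((\<lambda>x::real. (1 - (1 - exp (- (\<rho> * x powr (- 1 / m)))) powr m) powr x) \<longlongrightarrow> exp (- (\<rho> powr m))) at_top"
  using assms by real_asymp

abbreviation gauss :: "real \<Rightarrow> 'a::euclidean_space \<Rightarrow> real" where
  "gauss s \<xi> \<equiv> exp (- s * (norm \<xi>)\<^sup>2)"

text \<open>A class of bounded symbols that is closed under products with convex combinations of Gaussians and
under pointwise limits, and for which the \<open>L\<^sup>1\<close> bound of the transform is uniform. The Gaussian cut-off
makes the transform meaningful for symbols such as the constant \<open>1\<close>; asking for every \<open>\<epsilon>\<close> is what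
makes multiplication by \<open>exp (- s * (norm \<xi>)\<^sup>2)\<close> harmless, since it only replaces \<open>\<epsilon>\<close> by \<open>\<epsilon> + s\<close>.\<close>

definition gauss_L1 :: "ennreal \<Rightarrow> ('a::euclidean_space \<Rightarrow> real) \<Rightarrow> bool" where
  "gauss_L1 K g \<longleftrightarrow> g \<in> borel_measurable borel \<and> (\<forall>\<xi>. \<bar>g \<xi>\<bar> \<le> 1) \<and>
     (\<forall>\<epsilon>>0. L1_norm (cos_transform (\<lambda>\<xi>. g \<xi> * gauss \<epsilon> \<xi>)) \<le> K)"

lemma integrable_gauss: 
  assumes "0 < \<epsilon>"
  shows "integrable lborel (\<lambda>\<xi>::'a::euclidean_space. gauss \<epsilon> \<xi>)"
proof -
  obtain c where c: "\<And>y::real. 0 \<le> y \<Longrightarrow> (1 + y) ^ (2 * DIM('a)) * exp (- (y powr 2)) \<le> c"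
    using poly_exp_bounded[of 2 "2 * DIM('a)"] by auto
  \<comment> \<open>with \<open>s \<le> 1\<close>, the growth of \<open>1 + norm x\<close> is at most \<open>1 / s\<close> times that of \<open>1 + s * norm x\<close>\<close>
  define s where "s = min 1 (sqrt \<epsilon>)"
  have s: "0 < s" "s \<le> 1" "s\<^sup>2 \<le> \<epsilon>"
  proof -
    show "0 < s" "s \<le> 1" using assms by (auto simp: s_def)
    have "s\<^sup>2 \<le> (sqrt \<epsilon>)\<^sup>2" using assms by (intro power_mono) (auto simp: s_def)
    thus "s\<^sup>2 \<le> \<epsilon>" using assms by simp
  qed
  show ?thesis
  proof (rule integrable_polynomial_decay[where c = "c / s ^ (2 * DIM('a))"])
    fix x :: 'a
    have sn: "0 \<le> s * norm x" using s by simp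
    have "s * (1 + norm x) \<le> 1 + s * norm x" using s by (simp add: algebra_simps)
    hence "(s * (1 + norm x)) ^ (2 * DIM('a)) \<le> (1 + s * norm x) ^ (2 * DIM('a))"
      using s by (intro power_mono) auto
    moreover have "gauss \<epsilon> x \<le> exp (- ((s * norm x) powr 2))"
    proof -
      have "(s * norm x) powr 2 = s\<^sup>2 * (norm x)\<^sup>2" using s by (simp add: power_mult_distrib)
      also have "\<dots> \<le> \<epsilon> * (norm x)\<^sup>2" using s by (intro mult_right_mono) auto
      finally show ?thesis by simp
    qed
    ultimately have "(s * (1 + norm x)) ^ (2 * DIM('a)) * gauss \<epsilon> x \<le>
        (1 + s * norm x) ^ (2 * DIM('a)) * exp (- ((s * norm x) powr 2))"
      using s by (intro mult_mono) auto
    also have "\<dots> \<le> c" by (rule c[OF sn])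
    finally have "s ^ (2 * DIM('a)) * (1 + norm x) ^ (2 * DIM('a)) * gauss \<epsilon> x \<le> c"
      by (simp only: power_mult_distrib)
    thus "\<bar>gauss \<epsilon> x\<bar> * (1 + norm x) ^ (2 * DIM('a)) \<le> c / s ^ (2 * DIM('a))"
      using s by (simp add: pos_le_divide_eq mult_ac)
  qed measurable
qed

lemma gauss_L1_integrable:
  assumes g: "g \<in> borel_measurable borel" "\<And>\<xi>. \<bar>g \<xi>\<bar> \<le> 1" and e: "0 < \<epsilon>"
  shows "integrable lborel (\<lambda>\<xi>::'a::euclidean_space. g \<xi> * gauss \<epsilon> \<xi>)"
proof (rule Bochner_Integration.integrable_bound[OF integrable_gauss[OF e]])
  note [measurable] = g(1)
  show "(\<lambda>\<xi>. g \<xi> * gauss \<epsilon> \<xi>) \<in> borel_measurable lborel" by measurable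
  show "AE \<xi> in lborel. norm (g \<xi> * gauss \<epsilon> \<xi>) \<le> norm (gauss \<epsilon> \<xi>)"
    using g(2) by (intro AE_I2) (simp add: abs_mult mult_left_le_one_le)
qed

lemma gauss_L1_one:
  "gauss_L1 (L1_norm (cos_transform (frac_symbol 1 :: 'a::euclidean_space \<Rightarrow> real))) (\<lambda>\<xi>::'a. 1)"
  unfolding gauss_L1_def
proof (intro conjI allI impI)
  fix \<epsilon> :: real assume e: "0 < \<epsilon>"
  have "(\<lambda>\<xi>::'a. 1 * gauss \<epsilon> \<xi>) = (\<lambda>\<xi>. frac_symbol 1 (sqrt \<epsilon> *\<^sub>R \<xi>))"
    using e by (simp add: fun_eq_iff frac_symbol_def power_mult_distrib)
  moreover have "L1_norm (\<lambda>x::'a. cos_transform (\<lambda>\<xi>. frac_symbol 1 (sqrt \<epsilon> *\<^sub>R \<xi>)) x) =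
      L1_norm (cos_transform (frac_symbol 1 :: 'a \<Rightarrow> real))"
    using e by (intro nn_integral_cos_transform_scale integrable_frac_symbol) auto
  ultimately show "L1_norm (\<lambda>x::'a. cos_transform (\<lambda>\<xi>. 1 * gauss \<epsilon> \<xi>) x) \<le>
      L1_norm (cos_transform (frac_symbol 1 :: 'a \<Rightarrow> real))" by simp
qed auto

lemma gauss_L1_mixture:
  fixes g :: "'a::euclidean_space \<Rightarrow> real" and a s :: "nat \<Rightarrow> real"
  assumes g: "gauss_L1 K g" and I: "finite I" and a: "\<And>i. i \<in> I \<Longrightarrow> 0 \<le> a i" "sum a I \<le> 1" and s: "\<And>i. i \<in> I \<Longrightarrow> 0 \<le> s i"
  shows "gauss_L1 K (\<lambda>\<xi>. g \<xi> * (\<Sum>i\<in>I. a i * gauss (s i) \<xi>))"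
  unfolding gauss_L1_def
proof (intro conjI allI impI)
  let ?S = "\<lambda>\<xi>::'a. \<Sum>i\<in>I. a i * gauss (s i) \<xi>"
  have gm[measurable]: "g \<in> borel_measurable borel" and g1: "\<And>\<xi>. \<bar>g \<xi>\<bar> \<le> 1"
    and gK: "\<And>\<epsilon>. 0 < \<epsilon> \<Longrightarrow> L1_norm (cos_transform (\<lambda>\<xi>. g \<xi> * gauss \<epsilon> \<xi>)) \<le> K"
    using g by (auto simp: gauss_L1_def)
  show "(\<lambda>\<xi>. g \<xi> * ?S \<xi>) \<in> borel_measurable borel" by measurable
  show "\<bar>g \<xi> * ?S \<xi>\<bar> \<le> 1" for \<xi>
  proof -
    have "0 \<le> ?S \<xi>" using a by (intro sum_nonneg) auto
    moreover have "?S \<xi> \<le> (\<Sum>i\<in>I. a i * 1)"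
      using a s by (intro sum_mono mult_left_mono) auto
    ultimately have "\<bar>?S \<xi>\<bar> \<le> 1" using a(2) by simp
    thus ?thesis using g1[of \<xi>] mult_mono[of "\<bar>g \<xi>\<bar>" 1 "\<bar>?S \<xi>\<bar>" 1]
      by (simp add: abs_mult)
  qed
  fix \<epsilon> :: real assume e: "0 < \<epsilon>"
  let ?H = "cos_transform (\<lambda>\<xi>. g \<xi> * ?S \<xi> * gauss \<epsilon> \<xi>)"
  let ?G = "\<lambda>i. cos_transform (\<lambda>\<xi>. g \<xi> * gauss (\<epsilon> + s i) \<xi>)"
  have ei: "0 < \<epsilon> + s i" if "i \<in> I" for i using s[OF that] e by simp
  have Gm: "?G i \<in> borel_measurable borel" if "i \<in> I" for i
    using gauss_L1_integrable[OF gm g1 ei[OF that]] by (rule borel_measurable_cos_transform)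
  have lin: "?H x = (\<Sum>i\<in>I. a i * ?G i x)" for x
  proof -
    have "?H x =
      (LINT \<xi>|lborel. (\<Sum>i\<in>I. a i * (cos (x \<bullet> \<xi>) * (g \<xi> * gauss (\<epsilon> + s i) \<xi>))))"
      unfolding cos_transform_def
      by (intro Bochner_Integration.integral_cong refl)
        (simp add: sum_distrib_left sum_distrib_right algebra_simps exp_add[symmetric] exp_diff exp_minus field_simps)
    also have "\<dots> = (\<Sum>i\<in>I. (LINT \<xi>|lborel. a i * (cos (x \<bullet> \<xi>) * (g \<xi> * gauss (\<epsilon> + s i) \<xi>))))"
      using gauss_L1_integrable[OF gm g1 ei]
      by (intro Bochner_Integration.integral_sum integrable_mult_right integrable_cos_mult)
    finally show ?thesis by (simp add: cos_transform_def)
  qed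
  have "L1_norm (?H) \<le>
      (\<integral>\<^sup>+ x. (\<Sum>i\<in>I. ennreal (a i) * ennreal \<bar>?G i x\<bar>) \<partial>lborel)"
  proof (rule nn_integral_mono)
    fix x
    have "\<bar>\<Sum>i\<in>I. a i * ?G i x\<bar> \<le> (\<Sum>i\<in>I. \<bar>a i * ?G i x\<bar>)" by (rule sum_abs)
    also have "\<dots> = (\<Sum>i\<in>I. a i * \<bar>?G i x\<bar>)" using a by (intro sum.cong) (auto simp: abs_mult)
    finally have "ennreal \<bar>\<Sum>i\<in>I. a i * ?G i x\<bar> \<le> ennreal (\<Sum>i\<in>I. a i * \<bar>?G i x\<bar>)" by (rule ennreal_leI)
    also have "\<dots> = (\<Sum>i\<in>I. ennreal (a i * \<bar>?G i x\<bar>))" using a by (intro sum_ennreal[symmetric]) auto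
    also have "\<dots> = (\<Sum>i\<in>I. ennreal (a i) * ennreal \<bar>?G i x\<bar>)" using a by (intro sum.cong) (auto simp: ennreal_mult')
    finally show "ennreal \<bar>?H x\<bar> \<le> (\<Sum>i\<in>I. ennreal (a i) * ennreal \<bar>?G i x\<bar>)"
      unfolding lin .
  qed
  also have "\<dots> = (\<Sum>i\<in>I. \<integral>\<^sup>+ x. ennreal (a i) * ennreal \<bar>?G i x\<bar> \<partial>lborel)"
    using Gm by (intro nn_integral_sum) auto
  also have "\<dots> = (\<Sum>i\<in>I. ennreal (a i) * L1_norm (?G i))"
    using Gm by (intro sum.cong nn_integral_cmult) auto
  also have "\<dots> \<le> (\<Sum>i\<in>I. ennreal (a i) * K)"
    using gK[OF ei] by (intro sum_mono mult_left_mono) auto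
  also have "\<dots> = ennreal (sum a I) * K" using a by (simp add: sum_distrib_right[symmetric] sum_ennreal)
  also have "\<dots> \<le> 1 * K" using a by (intro mult_right_mono) (auto simp: ennreal_le_1)
  finally show "L1_norm (?H) \<le> K"
    by simp
qed

text \<open>The transforms converge at every point by dominated convergence, and Fatou's lemma preserves the bound.\<close>

lemma nn_integral_cos_transform_limit:
  fixes g :: "nat \<Rightarrow> 'a::euclidean_space \<Rightarrow> real"
  assumes "integrable lborel w" "\<And>n. g n \<in> borel_measurable borel" "h \<in> borel_measurable borel"
    and "\<And>n \<xi>. \<bar>g n \<xi>\<bar> \<le> w \<xi>" and "AE \<xi> in lborel. (\<lambda>n. g n \<xi>) \<longlonglongrightarrow> h \<xi>"
    and K: "\<And>n. L1_norm (cos_transform (g n)) \<le> K"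
  shows "L1_norm (cos_transform h) \<le> K"
proof -
  have gi: "integrable lborel (g n)" for n
    by (rule Bochner_Integration.integrable_bound[OF assms(1)])
      (use assms(2,4) in \<open>auto intro!: AE_I2 order_trans[OF assms(4)]\<close>)
  have lim: "(\<lambda>n. cos_transform (g n) x) \<longlonglongrightarrow> cos_transform h x" for x
    by (rule cos_transform_dominated[OF assms(1-5) tendsto_const])
  have "ennreal \<bar>cos_transform h x\<bar> = liminf (\<lambda>n. ennreal \<bar>cos_transform (g n) x\<bar>)" for x
    by (intro lim_imp_Liminf[symmetric] tendsto_ennrealI tendsto_rabs lim) simp
  hence "L1_norm (cos_transform h) = (\<integral>\<^sup>+ x. liminf (\<lambda>n. ennreal \<bar>cos_transform (g n) x\<bar>) \<partial>lborel)"
    by simp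
  also have "\<dots> \<le> liminf (\<lambda>n. \<integral>\<^sup>+ x. ennreal \<bar>cos_transform (g n) x\<bar> \<partial>lborel)"
    using borel_measurable_cos_transform[OF gi] by (intro nn_integral_liminf) auto
  also have "\<dots> \<le> liminf (\<lambda>n. K)"
    using K by (intro Liminf_mono always_eventually) auto
  also have "\<dots> = K" by (simp add: Liminf_const)
  finally show ?thesis .
qed

lemma gauss_L1_limit:
  fixes g :: "nat \<Rightarrow> 'a::euclidean_space \<Rightarrow> real"
  assumes g: "\<And>n. gauss_L1 K (g n)" and h: "h \<in> borel_measurable borel" "\<And>\<xi>. \<bar>h \<xi>\<bar> \<le> 1"
    and lim: "AE \<xi> in lborel. (\<lambda>n. g n \<xi>) \<longlonglongrightarrow> h \<xi>"
  shows "gauss_L1 K h"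
  unfolding gauss_L1_def
proof (intro conjI allI impI h)
  fix \<epsilon> :: real assume e: "0 < \<epsilon>"
  have gm[measurable]: "g n \<in> borel_measurable borel" for n using g by (auto simp: gauss_L1_def)
  note [measurable] = h(1)
  show "L1_norm (cos_transform (\<lambda>\<xi>. h \<xi> * gauss \<epsilon> \<xi>)) \<le> K"
  proof (rule nn_integral_cos_transform_limit[where g = "\<lambda>n \<xi>. g n \<xi> * gauss \<epsilon> \<xi>"])
    show "integrable lborel (\<lambda>\<xi>::'a. gauss \<epsilon> \<xi>)" using e by (rule integrable_gauss)
    show "\<bar>g n \<xi> * gauss \<epsilon> \<xi>\<bar> \<le> gauss \<epsilon> \<xi>" for n \<xi>
      using g[of n] by (simp add: gauss_L1_def abs_mult mult_left_le_one_le)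
    show "AE \<xi> in lborel. (\<lambda>n. g n \<xi> * gauss \<epsilon> \<xi>) \<longlonglongrightarrow> h \<xi> * gauss \<epsilon> \<xi>"
      using lim by eventually_elim (intro tendsto_intros)
    show "L1_norm (cos_transform (\<lambda>\<xi>. g n \<xi> * gauss \<epsilon> \<xi>)) \<le> K" for n
      using g[of n] e by (simp add: gauss_L1_def)
  qed measurable
qed

text \<open>The Taylor coefficients of \<open>1 - (1 - x) powr m\<close>; for \<open>0 < m < 1\<close> and \<open>k \<ge> 1\<close> they are the
probabilities of Sibuya's distribution.\<close>

definition sibuya :: "real \<Rightarrow> nat \<Rightarrow> real" where
  "sibuya m k = - ((m gchoose k) * (- 1) ^ k)"

text \<open>The ratio of consecutive coefficients is \<open>(k - m) / (k + 1)\<close>, and the first one is \<open>m\<close>.\<close>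

lemma sibuya_nonneg:
  assumes m: "0 < m" "m < 1" and k: "1 \<le> k"
  shows "0 \<le> sibuya m k"
  using k
proof (induction k rule: nat_induct_at_least)
  case base
  show ?case using m by (simp add: sibuya_def)
next
  case (Suc k)
  have step: "real (Suc k) * (m gchoose Suc k) = (m - real k) * (m gchoose k)"
    using gbinomial_mult_1[of m k] by (simp add: algebra_simps)
  have "real (Suc k) * sibuya m (Suc k) = (real (Suc k) * (m gchoose Suc k)) * (- 1) ^ k"
    by (simp add: sibuya_def)
  also have "\<dots> = (real k - m) * sibuya m k"
    unfolding step by (simp add: sibuya_def algebra_simps)
  also have "\<dots> \<ge> 0" using Suc m by (intro mult_nonneg_nonneg) auto
  finally show ?case by (simp add: zero_le_mult_iff)
qed

lemma sibuya_sums: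
  assumes m: "0 < m" and x: "0 \<le> x" "x < 1"
  shows "(\<lambda>L. \<Sum>k=1..L. sibuya m k * x ^ k) \<longlonglongrightarrow> 1 - (1 - x) powr m"
proof -
  have "(\<lambda>k. (m gchoose k) * (- x) ^ k) sums (1 + (- x)) powr m"
    using x by (intro gen_binomial_real) auto
  hence "(\<lambda>L. \<Sum>k<Suc L. (m gchoose k) * (- x) ^ k) \<longlonglongrightarrow> (1 - x) powr m"
    unfolding sums_def by (subst filterlim_sequentially_Suc) simp
  hence "(\<lambda>L. 1 - (\<Sum>k<Suc L. (m gchoose k) * (- x) ^ k)) \<longlonglongrightarrow> 1 - (1 - x) powr m"
    by (intro tendsto_intros)
  moreover have "1 - (\<Sum>k<Suc L. (m gchoose k) * (- x) ^ k) = (\<Sum>k=1..L. sibuya m k * x ^ k)" for L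
  proof -
    have "(\<Sum>k<Suc L. (m gchoose k) * (- x) ^ k) = (m gchoose 0) * (- x) ^ 0 + (\<Sum>k<L. (m gchoose Suc k) * (- x) ^ Suc k)"
      by (rule sum.lessThan_Suc_shift)
    also have "(\<Sum>k<L. (m gchoose Suc k) * (- x) ^ Suc k) = (\<Sum>k=1..L. (m gchoose k) * (- x) ^ k)"
      by (rule sum.reindex_bij_witness[of _ "\<lambda>k. k - 1" Suc]) auto
    also have "\<dots> = - (\<Sum>k=1..L. sibuya m k * x ^ k)"
      unfolding sum_negf[symmetric] sibuya_def
      by (intro sum.cong refl) (simp add: power_mult_distrib[symmetric] mult.assoc)
    finally show ?thesis by simp
  qed
  ultimately show ?thesis by simp
qed

text \<open>For \<open>x < 1\<close> the partial sums of the power series stay below its limit \<open>1 - (1 - x) powr m \<le> 1\<close>; let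
\<open>x\<close> tend to \<open>1\<close>.\<close>

lemma sibuya_sum_le_1:
  assumes m: "0 < m" "m < 1"
  shows "(\<Sum>k=1..L. sibuya m k) \<le> 1"
proof -
  have le: "(\<Sum>k=1..L. sibuya m k * x ^ k) \<le> 1" if x: "0 < x" "x < 1" for x :: real
  proof -
    have "(\<Sum>k=1..L. sibuya m k * x ^ k) \<le> 1 - (1 - x) powr m"
    proof (rule incseq_le[OF _ sibuya_sums])
      show "incseq (\<lambda>L. \<Sum>k=1..L. sibuya m k * x ^ k)"
        using m x by (intro incseq_SucI) (simp add: sibuya_nonneg)
    qed (use m x in auto)
    thus ?thesis by (smt (verit) powr_ge_zero)
  qed
  have "((\<lambda>x. \<Sum>k=1..L. sibuya m k * x ^ k) \<longlongrightarrow> (\<Sum>k=1..L. sibuya m k * 1 ^ k)) (at_left 1)"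
    by (intro tendsto_intros)
  moreover have "\<forall>\<^sub>F x in at_left 1. (\<Sum>k=1..L. sibuya m k * x ^ k) \<le> 1"
    using eventually_at_left_real[of 0 1] by (rule eventually_mono) (auto intro!: le simp del: One_nat_def)
  ultimately show ?thesis by (auto intro: tendsto_upperbound)
qed

text \<open>With \<open>x = gauss s \<xi>\<close> the function \<open>1 - (1 - x) powr m\<close> is a limit of combinations
of the Gaussians \<open>x ^ k\<close> with nonnegative coefficients of sum at most \<open>1\<close>. The expansion is used for
\<open>\<xi> \<noteq> 0\<close> only, where \<open>x < 1\<close>.\<close>

lemma gauss_L1_sibuya:
  fixes g :: "'a::euclidean_space \<Rightarrow> real"
  assumes m: "0 < m" "m < 1" and s: "0 < s" and g: "gauss_L1 K g"
  shows "gauss_L1 K (\<lambda>\<xi>. g \<xi> * (1 - (1 - gauss s \<xi>) powr m))"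
proof (rule gauss_L1_limit[where g = "\<lambda>L \<xi>. g \<xi> * (\<Sum>k=1..L. sibuya m k * gauss (s * real k) \<xi>)"])
  have gm[measurable]: "g \<in> borel_measurable borel" and g1: "\<And>\<xi>. \<bar>g \<xi>\<bar> \<le> 1" using g by (auto simp: gauss_L1_def)
  show "gauss_L1 K (\<lambda>\<xi>. g \<xi> * (\<Sum>k=1..L. sibuya m k * gauss (s * real k) \<xi>))" for L
    using m s sibuya_nonneg[OF m] sibuya_sum_le_1[OF m] by (intro gauss_L1_mixture g) auto
  show "(\<lambda>\<xi>. g \<xi> * (1 - (1 - gauss s \<xi>) powr m)) \<in> borel_measurable borel" by measurable
  show "\<bar>g \<xi> * (1 - (1 - gauss s \<xi>) powr m)\<bar> \<le> 1" for \<xi>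
  proof -
    define u where "u = 1 - gauss s \<xi>"
    have u: "0 \<le> u" "u \<le> 1" using s by (auto simp: u_def)
    hence "u powr m \<le> 1" using m powr_mono2[of m u 1] by simp
    hence "\<bar>1 - u powr m\<bar> \<le> 1" by (simp add: abs_le_iff)
    thus ?thesis using g1[of \<xi>] mult_mono[of "\<bar>g \<xi>\<bar>" 1 "\<bar>1 - u powr m\<bar>" 1]
      by (simp add: abs_mult u_def)
  qed
  show "AE \<xi> in lborel. (\<lambda>L. g \<xi> * (\<Sum>k=1..L. sibuya m k * gauss (s * real k) \<xi>)) \<longlonglongrightarrow>
      g \<xi> * (1 - (1 - gauss s \<xi>) powr m)"
    using AE_lborel_singleton[of "0::'a"]
  proof eventually_elim
    fix \<xi> :: 'a assume x: "\<xi> \<noteq> 0"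
    have "gauss (s * real k) \<xi> = gauss s \<xi> ^ k" for k
      by (simp add: exp_of_nat_mult[symmetric] mult_ac)
    moreover have "gauss s \<xi> < 1" using x s by simp
    ultimately show "(\<lambda>L. g \<xi> * (\<Sum>k=1..L. sibuya m k * gauss (s * real k) \<xi>)) \<longlonglongrightarrow>
      g \<xi> * (1 - (1 - gauss s \<xi>) powr m)"
      using m by (simp only:) (intro tendsto_intros sibuya_sums, auto)
  qed
qed

text \<open>Take \<open>\<rho> = (norm \<xi>)\<^sup>2\<close> in \<open>exp_powr_limit\<close>: the symbol is a limit of powers of the
functions just treated, and each power stays in the class.\<close>

lemma gauss_L1_frac_symbol:
  assumes m: "0 < m" "m < 1" and one: "gauss_L1 K (\<lambda>\<xi>::'a::euclidean_space. 1)"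
  shows "gauss_L1 K (frac_symbol m :: 'a \<Rightarrow> real)"
proof -
  define \<theta> where "\<theta> s \<xi> = 1 - (1 - gauss s \<xi>) powr m" for s :: real and \<xi> :: 'a
  have pw: "gauss_L1 K (\<lambda>\<xi>. \<theta> s \<xi> ^ N)" if "0 < s" for s N
  proof (induction N)
    case (Suc N)
    from gauss_L1_sibuya[OF m that Suc] show ?case by (simp add: \<theta>_def mult.commute)
  qed (use one in simp)
  show ?thesis
  proof (rule gauss_L1_limit[where g = "\<lambda>N \<xi>. \<theta> (real (Suc N) powr (- 1 / m)) \<xi> ^ Suc N"])
    show "gauss_L1 K (\<lambda>\<xi>. \<theta> (real (Suc N) powr (- 1 / m)) \<xi> ^ Suc N)" for N
      by (rule pw) simp
    show "AE \<xi> in lborel. (\<lambda>N. \<theta> (real (Suc N) powr (- 1 / m)) \<xi> ^ Suc N) \<longlonglongrightarrow> frac_symbol m \<xi>"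
      using AE_lborel_singleton[of "0::'a"]
    proof eventually_elim
      fix \<xi> :: 'a assume x: "\<xi> \<noteq> 0"
      have L: "((\<lambda>N. (1 - (1 - exp (- ((norm \<xi>)\<^sup>2 * real (Suc N) powr (- 1 / m)))) powr m) powr real (Suc N)) \<longlonglongrightarrow> exp (- ((norm \<xi>)\<^sup>2 powr m)))"
        using x m by (intro filterlim_compose[OF exp_powr_limit] filterlim_compose[OF filterlim_real_sequentially filterlim_Suc]) auto
      have pos: "0 < \<theta> (real (Suc N) powr (- 1 / m)) \<xi>" for N
      proof -
        have "(1 - gauss (real (Suc N) powr (- 1 / m)) \<xi>) powr m < 1 powr m"
          using m x by (intro powr_less_mono2) auto
        thus ?thesis by (simp add: \<theta>_def)
      qed
      have "(norm \<xi>)\<^sup>2 powr m = norm \<xi> powr (2 * m)"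
        using x powr_powr[of "norm \<xi>" 2 m] by simp
      thus "(\<lambda>N. \<theta> (real (Suc N) powr (- 1 / m)) \<xi> ^ Suc N) \<longlonglongrightarrow> frac_symbol m \<xi>"
        using L powr_realpow[OF pos] unfolding frac_symbol_def
        by (simp only: \<theta>_def mult.commute[of "(norm \<xi>)\<^sup>2"] minus_mult_left)
    qed
    show "\<bar>frac_symbol m \<xi>\<bar> \<le> 1" for \<xi> :: 'a by (simp add: frac_symbol_def)
  qed measurable
qed

text \<open>For a fraction \<open>m\<close> the Gaussian cut-off is removed by letting \<open>\<epsilon>\<close> tend to \<open>0\<close>, which is legitimate as the
symbol itself is integrable.\<close>

lemma nn_integral_cos_transform_frac:
  assumes m: "(0 < m \<and> m < 1) \<or> (\<exists>k::nat. 1 \<le> k \<and> m = real k)"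
  shows "L1_norm (cos_transform (frac_symbol m :: 'a::euclidean_space \<Rightarrow> real)) < \<infinity>"
proof (cases "0 < m \<and> m < 1")
  case True
  define K where "K = L1_norm (cos_transform (frac_symbol 1 :: 'a \<Rightarrow> real))"
  have "gauss_L1 K (frac_symbol m :: 'a \<Rightarrow> real)"
    using True gauss_L1_one[where 'a = 'a] unfolding K_def by (intro gauss_L1_frac_symbol) auto
  hence e: "L1_norm (\<lambda>x::'a. cos_transform (\<lambda>\<xi>. frac_symbol m \<xi> * gauss \<epsilon> \<xi>) x) \<le> K" if "0 < \<epsilon>" for \<epsilon>
    using that by (simp add: gauss_L1_def)
  have "L1_norm (cos_transform (frac_symbol m :: 'a \<Rightarrow> real)) \<le> K"
  proof (rule nn_integral_cos_transform_limit[where g = "\<lambda>n \<xi>. frac_symbol m \<xi> * gauss (1 / real (Suc n)) \<xi>"])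
    show "integrable lborel (frac_symbol m :: 'a \<Rightarrow> real)" using True by (intro integrable_frac_symbol) auto
    show "AE \<xi>::'a in lborel. (\<lambda>n. frac_symbol m \<xi> * gauss (1 / real (Suc n)) \<xi>) \<longlonglongrightarrow> frac_symbol m \<xi>"
    proof (rule AE_I2)
      fix \<xi> :: 'a
      have "(\<lambda>n. 1 / real (Suc n)) \<longlonglongrightarrow> 0" by (rule lim_1_over_n[THEN LIMSEQ_Suc])
      hence "(\<lambda>n. frac_symbol m \<xi> * gauss (1 / real (Suc n)) \<xi>) \<longlonglongrightarrow> frac_symbol m \<xi> * exp (- 0 * (norm \<xi>)\<^sup>2)"
        by (intro tendsto_intros)
      thus "(\<lambda>n. frac_symbol m \<xi> * gauss (1 / real (Suc n)) \<xi>) \<longlonglongrightarrow> frac_symbol m \<xi>" by simp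
    qed
    show "\<bar>frac_symbol m \<xi> * gauss (1 / real (Suc n)) \<xi>\<bar> \<le> frac_symbol m \<xi>" for n and \<xi> :: 'a
      by (simp add: frac_symbol_def abs_mult mult_left_le)
    show "L1_norm (\<lambda>x::'a. cos_transform (\<lambda>\<xi>. frac_symbol m \<xi> * gauss (1 / real (Suc n)) \<xi>) x) \<le> K" for n
      by (rule e) simp
  qed measurable
  also have "K < \<infinity>" unfolding K_def using nn_integral_cos_transform_nat[of 1, where 'a = 'a] by simp
  finally show ?thesis .
next
  case False
  with m obtain k :: nat where "1 \<le> k" "m = real k" by blast
  thus ?thesis using nn_integral_cos_transform_nat[of k, where 'a = 'a] by simp
qed

section \<open>The semigroup in weak Lebesgue spaces\<close>

lemma heat_symbol_scale:
  assumes t: "0 < t" and m: "0 < m"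
  shows "exp (- t * norm \<xi> powr (2 * m)) = frac_symbol m ((t powr (1 / (2 * m))) *\<^sub>R \<xi>)"
  using assms by (simp add: frac_symbol_def powr_mult powr_powr)

lemma heat_kernel_cos_transform:
  fixes x :: "real^'n"
  assumes t: "0 < t" and m: "0 < m"
  shows "heat_kernel m t x = cos_transform (frac_symbol m) (x /\<^sub>R (t powr (1 / (2 * m)))) /
    ((t powr (1 / (2 * m))) ^ CARD('n) * (2 * pi) ^ CARD('n))"
proof -
  define c where "c = t powr (1 / (2 * m))"
  have c: "0 < c" using t by (simp add: c_def)
  define g where "g \<xi> = exp (- t * norm \<xi> powr (2 * m))" for \<xi> :: "real^'n"
  have gc: "g = (\<lambda>\<xi>. frac_symbol m (c *\<^sub>R \<xi>))"
    unfolding g_def c_def by (intro ext heat_symbol_scale[OF t m])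
  have g: "integrable lborel g"
  proof -
    have "integrable lborel (\<lambda>\<xi>::real^'n. frac_symbol m (0 + c *\<^sub>R \<xi>))"
    proof -
      have "(\<integral>\<^sup>+ (\<xi>::real^'n). ennreal (norm (frac_symbol m \<xi>)) \<partial>lborel) =
          ennreal (\<bar>c\<bar> ^ DIM(real^'n)) * (\<integral>\<^sup>+ (\<xi>::real^'n). ennreal (norm (frac_symbol m (0 + c *\<^sub>R \<xi>))) \<partial>lborel)"
        using c by (intro nn_integral_lborel_affine) auto
      moreover have "(\<integral>\<^sup>+ (\<xi>::real^'n). ennreal (norm (frac_symbol m \<xi>)) \<partial>lborel) < \<infinity>"
        using integrable_frac_symbol[OF m, where 'a = "real^'n"] unfolding integrable_iff_bounded by (rule conjunct2)
      ultimately have "(\<integral>\<^sup>+ (\<xi>::real^'n). ennreal (norm (frac_symbol m (0 + c *\<^sub>R \<xi>))) \<partial>lborel) < \<infinity>"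
        using c by (auto simp: ennreal_mult_less_top)
      thus ?thesis by (intro integrableI_bounded) measurable
    qed
    thus ?thesis by (simp add: gc)
  qed
  have ci: "integrable lborel (\<lambda>\<xi>. cis (x \<bullet> \<xi>) * complex_of_real (g \<xi>))"
  proof (rule Bochner_Integration.integrable_bound[OF g])
    have gm: "g \<in> borel_measurable lborel" using g by auto
    have "(\<lambda>\<xi>. cis (x \<bullet> \<xi>)) \<in> borel_measurable borel"
      by (intro borel_measurable_continuous_onI continuous_intros)
    thus "(\<lambda>\<xi>. cis (x \<bullet> \<xi>) * complex_of_real (g \<xi>)) \<in> borel_measurable lborel" using gm by simp
    show "AE \<xi> in lborel. norm (cis (x \<bullet> \<xi>) * complex_of_real (g \<xi>)) \<le> norm (g \<xi>)"
      by (simp add: norm_mult)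
  qed
  have "Re (LINT \<xi>|lborel. cis (x \<bullet> \<xi>) * complex_of_real (g \<xi>)) = cos_transform g x"
    unfolding cos_transform_def by (subst integral_Re[OF ci, symmetric]) simp
  also have "\<dots> = cos_transform (frac_symbol m) (x /\<^sub>R c) / c ^ CARD('n)"
    unfolding gc using c by (subst cos_transform_scale) (auto simp: DIM_cart)
  finally show ?thesis unfolding heat_kernel_def g_def c_def by simp
qed

text \<open>The kernel at time \<open>t\<close> is the kernel at time \<open>1\<close>, dilated by \<open>t powr (1 / (2 * m))\<close> and normalised such
that its \<open>L\<^sup>1\<close> norm does not depend on \<open>t\<close>.\<close>

lemma heat_kernel_bounds:
  assumes m: "(0 < m \<and> m < 1) \<or> (\<exists>k::nat. 1 \<le> k \<and> m = real k)"
  obtains S B where "0 < S" "0 < B"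
    "\<And>t. 0 < t \<Longrightarrow> continuous_on UNIV (heat_kernel m t :: real^'n \<Rightarrow> real)"
    "\<And>t. 0 < t \<Longrightarrow> integrable lborel (heat_kernel m t :: real^'n \<Rightarrow> real)"
    "\<And>t x. 0 < t \<Longrightarrow> \<bar>heat_kernel m t (x :: real^'n)\<bar> \<le> S * t powr (- (real CARD('n) / (2 * m)))"
    "\<And>t. 0 < t \<Longrightarrow> L1_norm (heat_kernel m t :: real^'n \<Rightarrow> real) \<le> ennreal B"
proof -
  have m0: "0 < m" using m by auto
  define k where "k x = cos_transform (frac_symbol m) x / (2 * pi) ^ CARD('n)" for x :: "real^'n"
  have I: "integrable lborel (frac_symbol m :: real^'n \<Rightarrow> real)" using m0 by (rule integrable_frac_symbol)
  have kc: "continuous_on UNIV k" unfolding k_def by (intro continuous_intros continuous_cos_transform I) auto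
  have km[measurable]: "k \<in> borel_measurable borel" using kc by (rule borel_measurable_continuous_onI)
  define P where "P = (LINT \<xi>|lborel. \<bar>frac_symbol m (\<xi> :: real^'n)\<bar>)"
  have P0: "0 \<le> P" unfolding P_def by simp
  have kS: "\<bar>k x\<bar> \<le> P + 1" for x
  proof -
    have "1 \<le> (2 * pi) ^ CARD('n)" using pi_gt3 by (intro one_le_power) simp
    hence "\<bar>k x\<bar> \<le> \<bar>cos_transform (frac_symbol m) x\<bar>"
      using divide_left_mono[of 1 "(2 * pi) ^ CARD('n)" "\<bar>cos_transform (frac_symbol m) x\<bar>"] by (simp add: k_def)
    also have "\<dots> \<le> P" unfolding P_def by (rule abs_cos_transform_le[OF I])
    finally show ?thesis by simp
  qed
  define Q where "Q = L1_norm k"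
  have "Q \<le> L1_norm (cos_transform (frac_symbol m :: real^'n \<Rightarrow> real))"
    unfolding Q_def
  proof (intro nn_integral_mono ennreal_leI)
    fix x :: "real^'n"
    have "1 \<le> (2 * pi) ^ CARD('n)" using pi_gt3 by (intro one_le_power) simp
    thus "\<bar>k x\<bar> \<le> \<bar>cos_transform (frac_symbol m) x\<bar>"
      using divide_left_mono[of 1 "(2 * pi) ^ CARD('n)" "\<bar>cos_transform (frac_symbol m) x\<bar>"] by (simp add: k_def)
  qed
  also have "\<dots> < \<infinity>" using m by (rule nn_integral_cos_transform_frac)
  finally have Qfin: "Q < \<infinity>" .
  hence Q: "Q = ennreal (enn2real Q)" by simp
  have hk: "heat_kernel m t x = k (x /\<^sub>R (t powr (1 / (2 * m)))) / (t powr (1 / (2 * m))) ^ CARD('n)" if "0 < t" for t and x :: "real^'n"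
    using that m0 by (simp add: heat_kernel_cos_transform k_def)
  have hc: "continuous_on UNIV (heat_kernel m t :: real^'n \<Rightarrow> real)" if "0 < t" for t
    using that unfolding hk[OF that, abs_def] by (intro continuous_intros continuous_on_compose2[OF kc]) auto
  have hQ: "L1_norm (heat_kernel m t :: real^'n \<Rightarrow> real) = Q" if t: "0 < t" for t
  proof -
    define c where "c = t powr (1 / (2 * m))"
    have c: "0 < c" using t by (simp add: c_def)
    have "L1_norm (heat_kernel m t :: real^'n \<Rightarrow> real) =
        (\<integral>\<^sup>+ (x::real^'n). ennreal (\<bar>inverse c\<bar> ^ DIM(real^'n)) * ennreal \<bar>k (0 + inverse c *\<^sub>R x)\<bar> \<partial>lborel)"
    proof (rule nn_integral_cong)
      fix x :: "real^'n"
      have "heat_kernel m t x = k (x /\<^sub>R c) / c ^ CARD('n)" unfolding c_def by (rule hk[OF t])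
      hence "heat_kernel m t x = inverse c ^ CARD('n) * k (0 + inverse c *\<^sub>R x)"
        by (simp only: divide_inverse power_inverse mult.commute add_0_left)
      hence "\<bar>heat_kernel m t x\<bar> = \<bar>inverse c\<bar> ^ DIM(real^'n) * \<bar>k (0 + inverse c *\<^sub>R x)\<bar>"
        by (simp add: abs_mult power_abs)
      thus "ennreal \<bar>heat_kernel m t x\<bar> = ennreal (\<bar>inverse c\<bar> ^ DIM(real^'n)) * ennreal \<bar>k (0 + inverse c *\<^sub>R x)\<bar>"
        by (simp add: ennreal_mult')
    qed
    also have "\<dots> = ennreal (\<bar>inverse c\<bar> ^ DIM(real^'n)) * L1_norm (\<lambda>x::real^'n. k (0 + inverse c *\<^sub>R x))"
      by (intro nn_integral_cmult) measurable
    also have "\<dots> = Q"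
      unfolding Q_def using c by (intro nn_integral_lborel_affine[symmetric]) auto
    finally show ?thesis .
  qed
  show ?thesis
  proof (rule that[of "P + 1" "enn2real Q + 1"])
    show "0 < P + 1" "0 < enn2real Q + 1" using P0 enn2real_nonneg[of Q] by (linarith, linarith)
    fix t :: real assume t: "0 < t"
    show "continuous_on UNIV (heat_kernel m t :: real^'n \<Rightarrow> real)" by (rule hc[OF t])
    show "L1_norm (heat_kernel m t :: real^'n \<Rightarrow> real) \<le> ennreal (enn2real Q + 1)"
      unfolding hQ[OF t] by (subst Q) (rule ennreal_leI, simp)
    have "(\<integral>\<^sup>+ x. ennreal (norm (heat_kernel m t (x :: real^'n))) \<partial>lborel) < \<infinity>"
      using hQ[OF t] Qfin by simp
    thus "integrable lborel (heat_kernel m t :: real^'n \<Rightarrow> real)"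
      using borel_measurable_continuous_onI[OF hc[OF t]] by (intro integrableI_bounded) auto
    fix x :: "real^'n"
    have "(t powr (1 / (2 * m))) ^ CARD('n) = t powr (real CARD('n) / (2 * m))"
      using t powr_realpow[of "t powr (1 / (2 * m))" "CARD('n)"] by (simp add: powr_powr)
    hence "heat_kernel m t x = k (x /\<^sub>R (t powr (1 / (2 * m)))) * t powr (- (real CARD('n) / (2 * m)))"
      by (simp only: hk[OF t] powr_minus divide_inverse)
    hence "\<bar>heat_kernel m t x\<bar> = \<bar>k (x /\<^sub>R (t powr (1 / (2 * m))))\<bar> * t powr (- (real CARD('n) / (2 * m)))"
      by (simp only: abs_mult abs_of_nonneg[OF powr_ge_zero])
    also have "\<dots> \<le> (P + 1) * t powr (- (real CARD('n) / (2 * m)))"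
      by (intro mult_right_mono kS) simp
    finally show "\<bar>heat_kernel m t x\<bar> \<le> (P + 1) * t powr (- (real CARD('n) / (2 * m)))" .
  qed
qed

text \<open>The sup bound results from cutting \<open>f\<close> at the height \<open>A * t powr (- n / (2 * m * r))\<close>, at which the two terms of
\<open>conv_abs_le\<close> have the same order in \<open>t\<close>.\<close>

lemma heat_semigroup_weak_type:
  assumes m: "(0 < m \<and> m < 1) \<or> (\<exists>k::nat. 1 \<le> k \<and> m = real k)" and r: "1 < r"
  shows "\<exists>c>0. \<forall>t A (f :: real^'n \<Rightarrow> real) x. 0 < t \<longrightarrow> 0 < A \<longrightarrow>
      f \<in> borel_measurable lebesgue \<longrightarrow> weak_bound r A f \<longrightarrow>
      integrable lebesgue (\<lambda>y. heat_kernel m t (x - y) * f y) \<and>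
      continuous_on UNIV (heat_semigroup m t f) \<and>
      weak_bound r (c * A) (heat_semigroup m t f) \<and>
      \<bar>heat_semigroup m t f x\<bar> \<le> c * A * t powr (- (real CARD('n) / (2 * m * r)))"
proof -
  obtain S B where SB: "0 < S" "0 < B"
    "\<And>t. 0 < t \<Longrightarrow> continuous_on UNIV (heat_kernel m t :: real^'n \<Rightarrow> real)"
    "\<And>t. 0 < t \<Longrightarrow> integrable lborel (heat_kernel m t :: real^'n \<Rightarrow> real)"
    "\<And>t x. 0 < t \<Longrightarrow> \<bar>heat_kernel m t (x :: real^'n)\<bar> \<le> S * t powr (- (real CARD('n) / (2 * m)))"
    "\<And>t. 0 < t \<Longrightarrow> L1_norm (heat_kernel m t :: real^'n \<Rightarrow> real) \<le> ennreal B"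
    using heat_kernel_bounds[OF m, where 'n = 'n] by blast
  define c1 where "c1 = mink_const r * B"
  define c2 where "c2 = B + S * tail_const r"
  have c: "0 < c1" "0 < c2" using SB tail_const_pos[OF r] mink_const_pos[OF r] by (auto simp: c1_def c2_def add_pos_pos)
  have pos: "0 < c1 + c2" using c by simp
  show ?thesis
  proof (intro exI[of _ "c1 + c2"] conjI[OF pos] allI impI)
    fix t A :: real and f :: "real^'n \<Rightarrow> real" and x
    assume t: "0 < t" and A: "0 < A" and fm: "f \<in> borel_measurable lebesgue" and f: "weak_bound r A f"
    have km: "(heat_kernel m t :: real^'n \<Rightarrow> real) \<in> borel_measurable borel"
      using SB(3)[OF t] by (rule borel_measurable_continuous_onI)
    note cw = continuous_convolution_weak_type[OF SB(3)[OF t] SB(4)[OF t] SB(5)[OF t] fm f r A]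
    have cont: "continuous_on UNIV (heat_semigroup m t f)" using cw(2) by (simp add: heat_semigroup_def[abs_def])
    have w: "weak_bound r ((c1 + c2) * A) (heat_semigroup m t f)"
    proof (rule weak_type_mono[OF weak_type_conv_abs[OF km fm SB(6)[OF t] SB(2) f r A]])
      show "(\<lambda>x. ennreal \<bar>heat_semigroup m t f x\<bar>) \<in> borel_measurable lebesgue"
        using borel_measurable_continuous_onI[OF cont] by (intro measurable_completion) simp
      show "AE x in lebesgue. ennreal \<bar>heat_semigroup m t f x\<bar> \<le> conv_abs (heat_kernel m t) f x"
        unfolding heat_semigroup_def by (intro AE_I2 convolution_le_conv_abs)
      show "mink_const r * B * A \<le> (c1 + c2) * A" "0 \<le> mink_const r * B * A"
        unfolding c1_def[symmetric] using c A by auto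
    qed (use r in auto)
    define N where "N = real CARD('n) / (2 * m)"
    \<comment> \<open>cutting at the height \<open>A * \<mu>\<close> balances the two terms, as \<open>t powr (- N) * \<mu> powr (1 - r) = \<mu>\<close>\<close>
    define \<mu> where "\<mu> = t powr (- (N / r))"
    have mu: "0 < \<mu>" using t by (simp add: \<mu>_def)
    have mur: "t powr (- N) * \<mu> powr (1 - r) = \<mu>"
    proof -
      have "- N + - (N / r) * (1 - r) = - (N / r)" using r by (simp add: field_simps)
      thus ?thesis using t by (simp add: \<mu>_def powr_powr flip: powr_add)
    qed
    have "conv_abs (heat_kernel m t) f x \<le> ennreal (B * (A * \<mu>) + S * t powr (- N) * (tail_const r * A powr r * (A * \<mu>) powr (1 - r)))"
      using SB t r A mu f fm km unfolding N_def by (intro conv_abs_le) auto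
    also have "B * (A * \<mu>) + S * t powr (- N) * (tail_const r * A powr r * (A * \<mu>) powr (1 - r)) = c2 * A * \<mu>"
    proof -
      have "A powr r * (A * \<mu>) powr (1 - r) = A * \<mu> powr (1 - r)"
        using A mu by (simp add: powr_mult powr_diff)
      hence "S * t powr (- N) * (tail_const r * A powr r * (A * \<mu>) powr (1 - r)) = S * tail_const r * A * (t powr (- N) * \<mu> powr (1 - r))"
        by (simp add: mult_ac)
      thus ?thesis unfolding mur c2_def by (simp add: algebra_simps)
    qed
    finally have "ennreal \<bar>heat_semigroup m t f x\<bar> \<le> ennreal (c2 * A * \<mu>)"
      unfolding heat_semigroup_def by (rule order_trans[OF convolution_le_conv_abs])
    hence "\<bar>heat_semigroup m t f x\<bar> \<le> c2 * A * \<mu>"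
      using c A mu by (subst (asm) ennreal_le_iff) auto
    also have "\<dots> \<le> (c1 + c2) * A * \<mu>" using c A mu by (intro mult_right_mono) auto
    finally have "\<bar>heat_semigroup m t f x\<bar> \<le> (c1 + c2) * A * t powr (- (real CARD('n) / (2 * m * r)))"
      by (simp add: \<mu>_def N_def)
    with cw(1) cont w show "integrable lebesgue (\<lambda>y. heat_kernel m t (x - y) * f y) \<and>
      continuous_on UNIV (heat_semigroup m t f) \<and>
      weak_bound r ((c1 + c2) * A) (heat_semigroup m t f) \<and>
      \<bar>heat_semigroup m t f x\<bar> \<le> (c1 + c2) * A * t powr (- (real CARD('n) / (2 * m * r)))" by blast
  qed
qed

lemma schwartz_integrable:
  fixes \<psi> :: "real^'n \<Rightarrow> real"
  assumes "\<psi> \<in> schwartz"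
  shows "continuous_on UNIV \<psi>" "integrable lborel \<psi>"
proof -
  have "\<forall>is. (\<forall>x. foldr partial_deriv is \<psi> differentiable (at x)) \<and>
     (\<forall>k::nat. bounded (range (\<lambda>x. norm x ^ k * foldr partial_deriv is \<psi> x)))"
    using assms unfolding schwartz_def mem_Collect_eq .
  from this[rule_format, of "[]"] have d: "\<And>x. \<psi> differentiable (at x)"
    and b: "\<And>k. bounded (range (\<lambda>x. norm x ^ k * \<psi> x))" by simp_all
  show c: "continuous_on UNIV \<psi>"
    using d by (simp add: continuous_on_eq_continuous_at differentiable_imp_continuous_within)
  let ?k = "2 * DIM(real^'n)"
  obtain a where a: "\<And>x. \<bar>norm x ^ 0 * \<psi> x\<bar> \<le> a" using b[of 0] by (auto simp: bounded_iff)
  obtain e where e: "\<And>x. \<bar>norm x ^ ?k * \<psi> x\<bar> \<le> e" using b[of ?k] by (auto simp: bounded_iff)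
  show "integrable lborel \<psi>"
  proof (rule integrable_polynomial_decay[where c = "2 ^ ?k * (a + e)"])
    show "\<psi> \<in> borel_measurable borel" using c by (rule borel_measurable_continuous_onI)
    fix x :: "real^'n"
    have "(1 + norm x) ^ ?k \<le> (2 * max 1 (norm x)) ^ ?k" by (intro power_mono) auto
    also have "\<dots> = 2 ^ ?k * max 1 (norm x) ^ ?k" by (rule power_mult_distrib)
    also have "max 1 (norm x) ^ ?k \<le> 1 + norm x ^ ?k" by (simp add: max_def)
    finally have "\<bar>\<psi> x\<bar> * (1 + norm x) ^ ?k \<le> \<bar>\<psi> x\<bar> * (2 ^ ?k * (1 + norm x ^ ?k))"
      by (intro mult_left_mono) auto
    also have "\<dots> = 2 ^ ?k * (\<bar>norm x ^ 0 * \<psi> x\<bar> + \<bar>norm x ^ ?k * \<psi> x\<bar>)"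
      by (simp add: abs_mult algebra_simps)
    also have "\<dots> \<le> 2 ^ ?k * (a + e)" by (intro mult_left_mono add_mono a e) auto
    finally show "\<bar>\<psi> x\<bar> * (1 + norm x) ^ ?k \<le> 2 ^ ?k * (a + e)" .
  qed
qed

text \<open>The \<open>L\<^sup>1\<close> norm stays bounded and the supremum tends to \<open>0\<close>, so the decay follows by interpolation.\<close>

lemma heat_semigroup_L1_decay:
  fixes \<psi> :: "real^'n \<Rightarrow> real"
  assumes m: "(0 < m \<and> m < 1) \<or> (\<exists>k::nat. 1 \<le> k \<and> m = real k)" and q: "1 < q"
    and \<psi>: "integrable lebesgue \<psi>" and \<delta>: "0 < \<delta>"
  shows "\<forall>\<^sub>F t in at_top. (\<forall>x. integrable lebesgue (\<lambda>y. heat_kernel m t (x - y) * \<psi> y)) \<and>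
    continuous_on UNIV (heat_semigroup m t \<psi>) \<and> weak_bound q \<delta> (heat_semigroup m t \<psi>)"
proof -
  have m0: "0 < m" using m by auto
  obtain S B where SB: "0 < S" "0 < B"
    "\<And>t. 0 < t \<Longrightarrow> continuous_on UNIV (heat_kernel m t :: real^'n \<Rightarrow> real)"
    "\<And>t. 0 < t \<Longrightarrow> integrable lborel (heat_kernel m t :: real^'n \<Rightarrow> real)"
    "\<And>t x. 0 < t \<Longrightarrow> \<bar>heat_kernel m t (x :: real^'n)\<bar> \<le> S * t powr (- (real CARD('n) / (2 * m)))"
    "\<And>t. 0 < t \<Longrightarrow> L1_norm (heat_kernel m t :: real^'n \<Rightarrow> real) \<le> ennreal B"
    using heat_kernel_bounds[OF m, where 'n = 'n] by blast
  define N where "N = real CARD('n) / (2 * m)"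
  have N: "0 < N" using m0 by (simp add: N_def)
  \<comment> \<open>the summand \<open>1\<close> keeps the bound positive when \<open>\<psi>\<close> vanishes almost everywhere\<close>
  define P where "P = (LINT x|lebesgue. \<bar>\<psi> x\<bar>) + 1"
  have P0: "0 < P" by (simp add: P_def add_nonneg_pos)
  have \<psi>m: "\<psi> \<in> borel_measurable lebesgue" using \<psi> by auto
  have PI: "(\<integral>\<^sup>+ x. ennreal \<bar>\<psi> x\<bar> \<partial>lebesgue) \<le> ennreal P"
    using nn_integral_eq_integral[of lebesgue "\<lambda>x. \<bar>\<psi> x\<bar>"] \<psi> by (simp add: P_def ennreal_leI)
  define L where "L t = S * t powr (- N) * P" for t
  define D where "D t = ((B * P) powr 1 * L t powr (q - 1)) powr (1 / q)" for t
  have "((\<lambda>t. t powr (- N)) \<longlongrightarrow> 0) at_top" using N by (intro tendsto_neg_powr filterlim_ident) auto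
  hence "(L \<longlongrightarrow> S * 0 * P) at_top" unfolding L_def by (intro tendsto_intros)
  hence L0: "(L \<longlongrightarrow> 0) at_top" by simp
  have Lq: "((\<lambda>t. L t powr (q - 1)) \<longlongrightarrow> 0 powr (q - 1)) at_top"
    by (rule tendsto_powr'[OF L0 tendsto_const]) (use q SB(1) P0 in \<open>auto simp: L_def intro!: always_eventually\<close>)
  have "(D \<longlongrightarrow> ((B * P) powr 1 * (0 powr (q - 1))) powr (1 / q)) at_top"
    unfolding D_def
    by (rule tendsto_powr'[OF tendsto_mult[OF tendsto_const Lq] tendsto_const])
      (use q in \<open>auto intro!: always_eventually\<close>)
  hence "(D \<longlongrightarrow> 0) at_top" by simp
  hence "\<forall>\<^sub>F t in at_top. D t < \<delta>" using \<delta> by (rule order_tendstoD)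
  thus ?thesis using eventually_gt_at_top[of 0]
  proof eventually_elim
    fix t :: real assume D: "D t < \<delta>" and t: "0 < t"
    have km: "(heat_kernel m t :: real^'n \<Rightarrow> real) \<in> borel_measurable borel"
      using SB(3)[OF t] by (rule borel_measurable_continuous_onI)
    note cw = continuous_convolution_L1[OF SB(3)[OF t] SB(5)[OF t] \<psi>]
    have cm: "conv_abs (heat_kernel m t) \<psi> \<in> borel_measurable lebesgue"
      using conv_abs_measurable[OF km \<psi>m] by (intro measurable_completion) simp
    have w1: "weak_type 1 (B * P) (conv_abs (heat_kernel m t) \<psi>)"
    proof (rule nn_integral_imp_weak_type_1[OF cm])
      have "(\<integral>\<^sup>+ x. conv_abs (heat_kernel m t) \<psi> x \<partial>lebesgue) = (\<integral>\<^sup>+ x. conv_abs (heat_kernel m t) \<psi> x \<partial>lborel)"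
        by (simp add: nn_integral_completion)
      also have "\<dots> = L1_norm (heat_kernel m t :: real^'n \<Rightarrow> real) * (\<integral>\<^sup>+ x. ennreal \<bar>\<psi> x\<bar> \<partial>lebesgue)"
        by (rule nn_integral_conv_abs[OF km \<psi>m])
      also have "\<dots> \<le> ennreal B * ennreal P" by (intro mult_mono SB(6)[OF t] PI) auto
      also have "\<dots> = ennreal (B * P)" using SB by (simp add: ennreal_mult')
      finally show "(\<integral>\<^sup>+ x. conv_abs (heat_kernel m t) \<psi> x \<partial>lebesgue) \<le> ennreal (B * P)" .
    qed (use SB P0 in auto)
    have bd: "conv_abs (heat_kernel m t) \<psi> x \<le> ennreal (L t)" for x
    proof -
      have "conv_abs (heat_kernel m t) \<psi> x \<le> (\<integral>\<^sup>+ y. ennreal (S * t powr (- N)) * ennreal \<bar>\<psi> y\<bar> \<partial>lebesgue)"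
        unfolding conv_abs_def N_def using SB(5)[OF t] by (intro nn_integral_mono mult_right_mono ennreal_leI) auto
      also have "\<dots> = ennreal (S * t powr (- N)) * (\<integral>\<^sup>+ y. ennreal \<bar>\<psi> y\<bar> \<partial>lebesgue)"
        using \<psi>m by (intro nn_integral_cmult) measurable
      also have "\<dots> \<le> ennreal (S * t powr (- N)) * ennreal P" by (intro mult_left_mono PI) auto
      also have "\<dots> = ennreal (L t)" using SB by (simp add: L_def ennreal_mult')
      finally show ?thesis .
    qed
    have "weak_type q (D t) (conv_abs (heat_kernel m t) \<psi>)"
      unfolding D_def using SB P0 t q bd by (intro weak_type_bounded w1) (auto simp: L_def)
    hence "weak_bound q \<delta> (heat_semigroup m t \<psi>)"
    proof (rule weak_type_mono)
      show "(\<lambda>x. ennreal \<bar>heat_semigroup m t \<psi> x\<bar>) \<in> borel_measurable lebesgue"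
        using borel_measurable_continuous_onI[OF cw(2)] unfolding heat_semigroup_def by (intro measurable_completion) simp
      show "AE x in lebesgue. ennreal \<bar>heat_semigroup m t \<psi> x\<bar> \<le> conv_abs (heat_kernel m t) \<psi> x"
        unfolding heat_semigroup_def by (intro AE_I2 convolution_le_conv_abs)
    qed (use D q in \<open>auto simp: D_def\<close>)
    with cw(1) cw(2)[folded heat_semigroup_def] show "(\<forall>x. integrable lebesgue (\<lambda>y. heat_kernel m t (x - y) * \<psi> y)) \<and>
      continuous_on UNIV (heat_semigroup m t \<psi>) \<and> weak_bound q \<delta> (heat_semigroup m t \<psi>)" by blast
  qed
qed

lemma heat_semigroup_schwartz_closure_decay:
  fixes \<phi> :: "real^'n \<Rightarrow> real"
  assumes m: "(0 < m \<and> m < 1) \<or> (\<exists>k::nat. 1 \<le> k \<and> m = real k)" and q: "1 < q"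
    and \<phi>: "\<phi> \<in> schwartz_closure q" and \<delta>: "0 < \<delta>"
  shows "\<forall>\<^sub>F t in at_top. weak_bound q \<delta> (heat_semigroup m t \<phi>)"
proof -
  obtain c where c: "0 < c" and sg0: 
    "\<forall>t A (f :: real^'n \<Rightarrow> real) x. 0 < t \<longrightarrow> 0 < A \<longrightarrow> f \<in> borel_measurable lebesgue \<longrightarrow> weak_bound q A f \<longrightarrow>
      integrable lebesgue (\<lambda>y. heat_kernel m t (x - y) * f y) \<and>
      continuous_on UNIV (heat_semigroup m t f) \<and>
      weak_bound q (c * A) (heat_semigroup m t f) \<and>
      \<bar>heat_semigroup m t f x\<bar> \<le> c * A * t powr (- (real CARD('n) / (2 * m * q)))"
    using heat_semigroup_weak_type[OF m q, where 'n = 'n] by (elim exE conjE) (rule that)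
  note sg = sg0[rule_format]
  define A where "A = \<delta> / (4 * c)"
  have A: "0 < A" using c \<delta> by (simp add: A_def)
  obtain \<psi> where \<psi>: "\<psi> \<in> schwartz" "weak_norm q (\<lambda>x. \<phi> x - \<psi> x) < ennreal A"
    using \<phi> A by (auto simp: schwartz_closure_def)
  have \<psi>i: "integrable lebesgue \<psi>" using schwartz_integrable(2)[OF \<psi>(1)] by (rule integrable_lebesgueI)
  have \<phi>m: "\<phi> \<in> borel_measurable lebesgue" using \<phi> by (simp add: schwartz_closure_def weak_L_def)
  have dm: "(\<lambda>x. \<phi> x - \<psi> x) \<in> borel_measurable lebesgue" using \<phi>m \<psi>i by measurable
  have dw: "weak_bound q A (\<lambda>x. \<phi> x - \<psi> x)"
    using \<psi>(2) A q by (intro weak_norm_imp_weak_type dm) auto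
  have "\<forall>\<^sub>F t in at_top. (\<forall>x. integrable lebesgue (\<lambda>y. heat_kernel m t (x - y) * \<psi> y)) \<and>
    continuous_on UNIV (heat_semigroup m t \<psi>) \<and> weak_bound q (\<delta> / 4) (heat_semigroup m t \<psi>)"
    using \<delta> by (intro heat_semigroup_L1_decay m q \<psi>i) auto
  thus ?thesis using eventually_gt_at_top[of 0]
  proof eventually_elim
    fix t :: real assume t: "0 < t" and h: "(\<forall>x. integrable lebesgue (\<lambda>y. heat_kernel m t (x - y) * \<psi> y)) \<and>
      continuous_on UNIV (heat_semigroup m t \<psi>) \<and> weak_bound q (\<delta> / 4) (heat_semigroup m t \<psi>)"
    note s = sg[OF t A dm dw]
    have eq: "heat_semigroup m t \<phi> x = heat_semigroup m t (\<lambda>x. \<phi> x - \<psi> x) x + heat_semigroup m t \<psi> x" for x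
      unfolding heat_semigroup_def
      using Bochner_Integration.integral_add[of lebesgue "\<lambda>y. heat_kernel m t (x - y) * (\<phi> y - \<psi> y)" "\<lambda>y. heat_kernel m t (x - y) * \<psi> y"] s[of x] h
      by (simp add: algebra_simps)
    have w: "weak_bound q (\<delta> / 4) (\<lambda>x. heat_semigroup m t (\<lambda>x. \<phi> x - \<psi> x) x)"
      using s c by (simp add: A_def)
    have sum: "weak_type q (4 * (\<delta> / 4)) (\<lambda>x. ennreal \<bar>heat_semigroup m t (\<lambda>x. \<phi> x - \<psi> x) x\<bar> + ennreal \<bar>heat_semigroup m t \<psi> x\<bar>)"
      using w h q \<delta> by (intro weak_type_add) auto
    show "weak_bound q \<delta> (heat_semigroup m t \<phi>)"
    proof (rule weak_type_mono[OF sum])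
      have "(\<lambda>x. ennreal \<bar>heat_semigroup m t \<phi> x\<bar>) = (\<lambda>x. ennreal \<bar>heat_semigroup m t (\<lambda>x. \<phi> x - \<psi> x) x + heat_semigroup m t \<psi> x\<bar>)"
        unfolding eq ..
      moreover have "heat_semigroup m t (\<lambda>x. \<phi> x - \<psi> x) \<in> borel_measurable lebesgue"
        using s by (intro measurable_completion) (auto intro: borel_measurable_continuous_onI)
      moreover have "heat_semigroup m t \<psi> \<in> borel_measurable lebesgue"
        using h by (intro measurable_completion) (auto intro: borel_measurable_continuous_onI)
      ultimately show "(\<lambda>x. ennreal \<bar>heat_semigroup m t \<phi> x\<bar>) \<in> borel_measurable lebesgue" by simp
      show "AE x in lebesgue. ennreal \<bar>heat_semigroup m t \<phi> x\<bar> \<le> ennreal \<bar>heat_semigroup m t (\<lambda>x. \<phi> x - \<psi> x) x\<bar> + ennreal \<bar>heat_semigroup m t \<psi> x\<bar>"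
        unfolding eq by (intro AE_I2) (simp add: ennreal_leI flip: ennreal_plus)
    qed (use \<delta> q in auto)
  qed
qed

section \<open>Asymptotic stability\<close>

text \<open>Hoelder's inequality for the weight in \<open>L\<^bsup>n/\<alpha>,\<infinity>\<^esup>\<close>, the difference in \<open>L\<^bsup>q,\<infinity>\<^esup>\<close> and the powers in
\<open>L\<^bsup>q/(p-1),\<infinity>\<^esup>\<close>. The Lipschitz condition also gives the continuity of \<open>F\<close>, needed for measurability.\<close>

lemma nonlinearity_weak_type:
  fixes F :: "real \<Rightarrow> real"
  assumes \<alpha>: "0 < \<alpha>" and p: "1 < p" "p \<le> q" and r: "1 \<le> r" "1 / r = \<alpha> / real CARD('n) + p / q"
    and C: "0 < C"
    and F_lip: "\<And>a b. \<bar>F a - F b\<bar> \<le> C * \<bar>a - b\<bar> * (\<bar>a\<bar> powr (p - 1) + \<bar>b\<bar> powr (p - 1))"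
  shows "\<exists>c>0. \<forall>A M (u :: real^'n \<Rightarrow> real) w. 0 < A \<longrightarrow> 0 < M \<longrightarrow> u \<in> borel_measurable lebesgue \<longrightarrow> w \<in> borel_measurable lebesgue \<longrightarrow>
      weak_bound q M u \<longrightarrow> weak_bound q M w \<longrightarrow> weak_bound q A (\<lambda>x. u x - w x) \<longrightarrow>
      (\<lambda>y. norm y powr (- \<alpha>) * F (u y) - norm y powr (- \<alpha>) * F (w y)) \<in> borel_measurable lebesgue \<and>
      weak_bound r (c * A * M powr (p - 1)) (\<lambda>y. norm y powr (- \<alpha>) * F (u y) - norm y powr (- \<alpha>) * F (w y))"
proof -
  obtain K where K: "0 < K" "weak_type (real CARD('n) / \<alpha>) K (\<lambda>y::real^'n. ennreal (norm y powr (- \<alpha>)))"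
    using weak_type_norm_powr[OF \<alpha>, where 'a = "real^'n"] by auto
  have "isCont F a" for a
  proof -
    have "((\<lambda>b. F b - F a) \<longlongrightarrow> 0) (at a)"
    proof (rule Lim_null_comparison)
      show "\<forall>\<^sub>F b in at a. norm (F b - F a) \<le> C * \<bar>b - a\<bar> * (\<bar>b\<bar> powr (p - 1) + \<bar>a\<bar> powr (p - 1))"
        using F_lip by (intro always_eventually) auto
      have "((\<lambda>b. C * \<bar>b - a\<bar> * (\<bar>b\<bar> powr (p - 1) + \<bar>a\<bar> powr (p - 1))) \<longlongrightarrow> C * \<bar>a - a\<bar> * (\<bar>a\<bar> powr (p - 1) + \<bar>a\<bar> powr (p - 1))) (at a)"
        using p by (intro tendsto_intros tendsto_powr') (auto intro!: always_eventually)
      thus "((\<lambda>b. C * \<bar>b - a\<bar> * (\<bar>b\<bar> powr (p - 1) + \<bar>a\<bar> powr (p - 1))) \<longlongrightarrow> 0) (at a)" by simp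
    qed
    thus ?thesis by (simp add: isCont_def LIM_zero_iff)
  qed
  hence Fm[measurable]: "F \<in> borel_measurable borel"
    by (intro borel_measurable_continuous_onI) (simp add: continuous_on_eq_continuous_at)
  have pos: "0 < 16 * C * K" using C K by simp
  show ?thesis
  proof (intro exI[of _ "16 * C * K"] conjI[OF pos] allI impI)
    fix A M :: real and u w :: "real^'n \<Rightarrow> real"
    assume A: "0 < A" and M: "0 < M" and um[measurable]: "u \<in> borel_measurable lebesgue" and wm[measurable]: "w \<in> borel_measurable lebesgue"
      and u: "weak_bound q M u" and w: "weak_bound q M w"
      and d: "weak_bound q A (\<lambda>x. u x - w x)"
    let ?s = "p - 1"
    let ?h = "\<lambda>y. norm y powr (- \<alpha>) * F (u y) - norm y powr (- \<alpha>) * F (w y)"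
    let ?R = "\<lambda>y. ennreal C * (ennreal (norm y powr (- \<alpha>)) * (ennreal \<bar>u y - w y\<bar> * (ennreal (\<bar>u y\<bar> powr ?s) + ennreal (\<bar>w y\<bar> powr ?s))))"
    have q: "0 < q" "1 \<le> q / ?s" "1 \<le> q / p" using p by auto
    have Ms: "0 < M powr ?s" using M by simp
    have nm[measurable]: "(\<lambda>y::real^'n. norm y powr (- \<alpha>)) \<in> borel_measurable lebesgue"
      by (intro measurable_completion) measurable
    have hm: "?h \<in> borel_measurable lebesgue"
      by measurable
    have us: "weak_type (q / ?s) (M powr ?s) (\<lambda>x. ennreal (\<bar>u x\<bar> powr ?s))"
      using p M by (intro weak_type_powr u um) auto
    have ws: "weak_type (q / ?s) (M powr ?s) (\<lambda>x. ennreal (\<bar>w x\<bar> powr ?s))"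
      using p M by (intro weak_type_powr w wm) auto
    have sum: "weak_type (q / ?s) (4 * (M powr ?s)) (\<lambda>x. ennreal (\<bar>u x\<bar> powr ?s) + ennreal (\<bar>w x\<bar> powr ?s))"
      using q by (intro weak_type_add us ws) auto
    have prod: "weak_type (q / p) (2 * (A * (4 * (M powr ?s)))) (\<lambda>x. ennreal \<bar>u x - w x\<bar> * (ennreal (\<bar>u x\<bar> powr ?s) + ennreal (\<bar>w x\<bar> powr ?s)))"
      using p q A Ms by (intro weak_type_mult[OF d sum]) (auto simp: add_divide_distrib[symmetric])
    have "weak_type r (2 * (K * (2 * (A * (4 * (M powr ?s))))))
      (\<lambda>x. ennreal (norm x powr (- \<alpha>)) * (ennreal \<bar>u x - w x\<bar> * (ennreal (\<bar>u x\<bar> powr ?s) + ennreal (\<bar>w x\<bar> powr ?s))))"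
      using p q A Ms K r \<alpha> by (intro weak_type_mult[OF K(2) prod]) auto
    from weak_type_cmult[OF this C]
    have all: "weak_type r (C * (2 * (K * (2 * (A * (4 * (M powr ?s)))))))
      ?R" .
    have "weak_bound r (16 * C * K * A * M powr ?s) ?h"
    proof (rule weak_type_mono[OF all])
      show "(\<lambda>y. ennreal \<bar>?h y\<bar>) \<in> borel_measurable lebesgue"
        using hm by measurable
      show "AE y in lebesgue. ennreal \<bar>?h y\<bar> \<le>
        ?R y"
      proof (rule AE_I2)
        fix y :: "real^'n"
        have "\<bar>?h y\<bar> = norm y powr (- \<alpha>) * \<bar>F (u y) - F (w y)\<bar>"
          by (simp add: abs_mult flip: right_diff_distrib)
        also have "\<dots> \<le> norm y powr (- \<alpha>) * (C * \<bar>u y - w y\<bar> * (\<bar>u y\<bar> powr ?s + \<bar>w y\<bar> powr ?s))"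
          by (intro mult_left_mono F_lip) simp
        also have "\<dots> = C * (norm y powr (- \<alpha>) * (\<bar>u y - w y\<bar> * (\<bar>u y\<bar> powr ?s + \<bar>w y\<bar> powr ?s)))"
          by (simp add: mult_ac)
        finally have "ennreal \<bar>?h y\<bar> \<le>
          ennreal (C * (norm y powr (- \<alpha>) * (\<bar>u y - w y\<bar> * (\<bar>u y\<bar> powr ?s + \<bar>w y\<bar> powr ?s))))" by (rule ennreal_leI)
        also have "\<dots> = ?R y"
          using C by (simp add: ennreal_mult' ennreal_plus[symmetric] del: ennreal_plus)
        finally show "ennreal \<bar>?h y\<bar> \<le>
          ?R y" .
      qed
    qed (use C K A Ms r in \<open>auto simp: mult_ac\<close>)
    with hm show "?h \<in> borel_measurable lebesgue \<and>
      weak_bound r (16 * C * K * A * M powr ?s) ?h" by blast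
  qed
qed

text \<open>The size \<open>A\<close> of the difference after a time \<open>T\<close> alone decides its size at large times: whatever happened
before \<open>T\<close>, and the linear part, are eventually below \<open>\<Lambda> * A * M powr (p - 1)\<close>. The factor \<open>M powr (p - 1)\<close>
is what smallness of the solutions makes small.\<close>

lemma difference_contraction:
  fixes F :: "real \<Rightarrow> real"
  assumes m: "(0 < m \<and> m < 1) \<or> (\<exists>k::nat. 1 \<le> k \<and> m = real k)"
    and \<alpha>: "0 < \<alpha>" and p: "1 < p" "p \<le> q"
    and r: "1 < r" "1 / r = \<alpha> / real CARD('n) + p / q" "1 / r = 1 / q + 2 * m / real CARD('n)"
    and F0: "F 0 = 0" and C: "0 < C"
    and F_lip: "\<And>a b. \<bar>F a - F b\<bar> \<le> C * \<bar>a - b\<bar> * (\<bar>a\<bar> powr (p - 1) + \<bar>b\<bar> powr (p - 1))"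
  shows "\<exists>\<Lambda>>0. \<forall>A M T (u :: real \<Rightarrow> real^'n \<Rightarrow> real) w u0 w0 \<phi>. 0 < A \<longrightarrow> 0 < M \<longrightarrow> 0 < T \<longrightarrow>
      (\<forall>t>0. u t \<in> borel_measurable lebesgue \<and> weak_bound q M (u t)) \<longrightarrow>
      (\<forall>t>0. w t \<in> borel_measurable lebesgue \<and> weak_bound q M (w t)) \<longrightarrow>
      (\<forall>t>T. weak_bound q A (\<lambda>x. u t x - w t x)) \<longrightarrow>
      integral_solution m \<alpha> F u0 u \<longrightarrow> integral_solution m \<alpha> F w0 w \<longrightarrow>
      w0 \<in> weak_L q \<longrightarrow> \<phi> \<in> schwartz_closure q \<longrightarrow> u0 = (\<lambda>x. w0 x + \<phi> x) \<longrightarrow>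
      (\<forall>\<^sub>F t in at_top. weak_bound q (\<Lambda> * A * M powr (p - 1)) (\<lambda>x. u t x - w t x))"
proof -
  let ?n = "real CARD('n)"
  have m0: "0 < m" using m by auto
  have q1: "1 < q" using p by simp
  have n0: "0 < ?n" by simp
  have rq: "r < q"
  proof -
    have "0 < 2 * m / ?n" using m0 n0 by simp
    hence "1 / q < 1 / r" using r(3) by linarith
    thus ?thesis using q1 r(1) by (simp add: field_simps)
  qed
  \<comment> \<open>the decay exponent of the semigroup from \<open>L\<^bsup>r,\<infinity>\<^esup>\<close> to \<open>L\<^bsup>\<infinity>\<^esup>\<close>; it satisfies \<open>r * e / (e - 1) = q\<close>\<close>
  define e where "e = ?n / (2 * m * r)"
  have e_eq: "e = 1 + ?n / (2 * m * q)"
  proof -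
    have "e = ?n / (2 * m) * (1 / r)" by (simp add: e_def)
    also have "\<dots> = ?n / (2 * m) * (1 / q) + ?n / (2 * m) * (2 * m / ?n)" unfolding r(3) by (simp add: distrib_left)
    also have "?n / (2 * m) * (2 * m / ?n) = 1" using m0 by simp
    finally show ?thesis by simp
  qed
  have e1: "1 < e" using e_eq m0 q1 by simp
  have qe: "r * e / (e - 1) = q"
  proof -
    have "r * e = ?n / (2 * m)" using r(1) by (simp add: e_def)
    moreover have "e - 1 = ?n / (2 * m * q)" using e_eq by simp
    ultimately show ?thesis using m0 q1 by simp
  qed
  obtain cs where cs: "0 < cs" and sg0: 
    "\<forall>t A (f :: real^'n \<Rightarrow> real) x. 0 < t \<longrightarrow> 0 < A \<longrightarrow> f \<in> borel_measurable lebesgue \<longrightarrow> weak_bound r A f \<longrightarrow>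
      integrable lebesgue (\<lambda>y. heat_kernel m t (x - y) * f y) \<and>
      continuous_on UNIV (heat_semigroup m t f) \<and>
      weak_bound r (cs * A) (heat_semigroup m t f) \<and>
      \<bar>heat_semigroup m t f x\<bar> \<le> cs * A * t powr (- e)"
    using heat_semigroup_weak_type[OF m r(1), where 'n = 'n, folded e_def] by (elim exE conjE) (rule that)
  note sg = sg0[rule_format]
  obtain cq where "0 < cq" and sgq0: 
    "\<forall>t A (f :: real^'n \<Rightarrow> real) x. 0 < t \<longrightarrow> 0 < A \<longrightarrow> f \<in> borel_measurable lebesgue \<longrightarrow> weak_bound q A f \<longrightarrow>
      integrable lebesgue (\<lambda>y. heat_kernel m t (x - y) * f y) \<and>
      continuous_on UNIV (heat_semigroup m t f) \<and>
      weak_bound q (cq * A) (heat_semigroup m t f) \<and>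
      \<bar>heat_semigroup m t f x\<bar> \<le> cq * A * t powr (- (?n / (2 * m * q)))"
    using heat_semigroup_weak_type[OF m q1, where 'n = 'n] by (elim exE conjE) (rule that)
  note sgq = sgq0[rule_format]
  have r1: "1 \<le> r" using r by simp
  obtain c1 where c1: "0 < c1" and nl0:
    "\<forall>A M (u :: real^'n \<Rightarrow> real) w. 0 < A \<longrightarrow> 0 < M \<longrightarrow> u \<in> borel_measurable lebesgue \<longrightarrow> w \<in> borel_measurable lebesgue \<longrightarrow>
      weak_bound q M u \<longrightarrow> weak_bound q M w \<longrightarrow> weak_bound q A (\<lambda>x. u x - w x) \<longrightarrow>
      (\<lambda>y. norm y powr (- \<alpha>) * F (u y) - norm y powr (- \<alpha>) * F (w y)) \<in> borel_measurable lebesgue \<and>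
      weak_bound r (c1 * A * M powr (p - 1)) (\<lambda>y. norm y powr (- \<alpha>) * F (u y) - norm y powr (- \<alpha>) * F (w y))"
    using nonlinearity_weak_type[OF \<alpha> p r1 r(2) C F_lip] by (elim exE conjE) (rule that)
  note nl = nl0[rule_format]
  define \<Lambda>0 where "\<Lambda>0 = (2 * mink_const r + 2 / (e - 1)) * (cs * c1)"
  have L0: "0 < \<Lambda>0"
  proof -
    have "0 < 2 / (e - 1)" using e1 by simp
    thus ?thesis unfolding \<Lambda>0_def using mink_const_pos[OF r(1)] cs c1 by (intro mult_pos_pos add_pos_pos) auto
  qed
  have pos: "0 < 16 * \<Lambda>0" using L0 by simp
  show ?thesis
  proof (intro exI[of _ "16 * \<Lambda>0"] conjI[OF pos] allI impI)
    fix A M T :: real and u w :: "real \<Rightarrow> real^'n \<Rightarrow> real" and u0 w0 \<phi>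
    assume A: "0 < A" and M: "0 < M" and T: "0 < T"
      and hu0: "\<forall>t>0. u t \<in> borel_measurable lebesgue \<and> weak_bound q M (u t)"
      and hw0: "\<forall>t>0. w t \<in> borel_measurable lebesgue \<and> weak_bound q M (w t)"
      and hd0: "\<forall>t>T. weak_bound q A (\<lambda>x. u t x - w t x)"
      and su: "integral_solution m \<alpha> F u0 u" and sw: "integral_solution m \<alpha> F w0 w"
      and w0: "w0 \<in> weak_L q" and \<phi>: "\<phi> \<in> schwartz_closure q" and u0: "u0 = (\<lambda>x. w0 x + \<phi> x)"
    note hu = hu0[rule_format] and hw = hw0[rule_format] and hd = hd0[rule_format]
    let ?Ms = "M powr (p - 1)"
    have Ms: "0 < ?Ms" using M by simp
    define h where "h \<tau> y = norm y powr (- \<alpha>) * F (u \<tau> y) - norm y powr (- \<alpha>) * F (w \<tau> y)" for \<tau> y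
    have d0: "weak_bound q (4 * M) (\<lambda>x. u t x - w t x)" if "0 < t" for t
      using hu[OF that] hw[OF that] M q1 by (intro weak_type_diff) auto
    define A1 where "A1 = c1 * (4 * M) * ?Ms"
    define A2 where "A2 = c1 * A * ?Ms"
    have A12: "0 < A1" "0 < A2" using c1 M A Ms by (auto simp: A1_def A2_def)
    have hm: "h \<tau> \<in> borel_measurable lebesgue" and h1: "weak_bound r A1 (h \<tau>)" if "0 < \<tau>" for \<tau>
      using nl[OF _ M _ _ _ _ d0[OF that]] hu[OF that] hw[OF that] M unfolding h_def A1_def by auto
    have h2: "weak_bound r A2 (h \<tau>)" if "T < \<tau>" for \<tau>
      using nl[OF A M _ _ _ _ hd[OF that]] hu[of \<tau>] hw[of \<tau>] that T unfolding h_def A2_def by auto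
    have Fint: "integrable lebesgue (\<lambda>y. heat_kernel m s (x - y) * (norm y powr (- \<alpha>) * F (v y)))"
      if "0 < s" "v \<in> borel_measurable lebesgue" "weak_bound q M v" for v :: "real^'n \<Rightarrow> real" and s x
    proof -
      \<comment> \<open>comparison of \<open>v\<close> with \<open>0\<close> in the nonlinear estimate, using \<open>F 0 = 0\<close>\<close>
      have z: "weak_bound q M (\<lambda>x::real^'n. 0)"
        by (rule weak_type_mono[OF that(3)]) (use M q1 in auto)
      have "(\<lambda>y. norm y powr (- \<alpha>) * F (v y) - norm y powr (- \<alpha>) * F 0) \<in> borel_measurable lebesgue \<and>
        weak_bound r (c1 * M * ?Ms) (\<lambda>y. norm y powr (- \<alpha>) * F (v y) - norm y powr (- \<alpha>) * F 0)"
        using that z by (intro nl M) auto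
      thus ?thesis using sg[OF that(1), of "c1 * M * ?Ms" "\<lambda>y. norm y powr (- \<alpha>) * F (v y)" x] c1 M Ms F0 by simp
    qed
    have dw0: "w0 \<in> borel_measurable lebesgue" "\<phi> \<in> borel_measurable lebesgue" "weak_norm q w0 < \<infinity>" "weak_norm q \<phi> < \<infinity>"
      using w0 \<phi> by (auto simp: schwartz_closure_def weak_L_def)
    have lint: "integrable lebesgue (\<lambda>y. heat_kernel m t (x - y) * f y)"
      if "0 < t" "f \<in> borel_measurable lebesgue" "weak_norm q f < \<infinity>" for f :: "real^'n \<Rightarrow> real" and t x
    proof -
      define a where "a = enn2real (weak_norm q f) + 1"
      have a: "0 < a" by (simp add: a_def add_nonneg_pos)
      have "weak_norm q f = ennreal (enn2real (weak_norm q f))" using that(3) by simp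
      also have "\<dots> \<le> ennreal a" by (intro ennreal_leI) (simp add: a_def)
      finally have "weak_bound q a f"
        using a q1 that by (intro weak_norm_imp_weak_type) auto
      thus ?thesis using sgq[OF that(1) a that(2)] by blast
    qed
    \<comment> \<open>the size of the part of the integral over \<open>(0, T)\<close>\<close>
    define early where "early t = ((mink_const r * T * (cs * A1)) powr r * ((cs * A1 * (t - T) powr (- e)) * T) powr (q - r)) powr (1 / q)" for t
    define B where "B = \<Lambda>0 * A * ?Ms"
    have B: "0 < B" using L0 A Ms by (simp add: B_def)
    have "filterlim (\<lambda>t. t - T) at_top at_top"
      by (rule filterlim_at_top_mono[OF filterlim_tendsto_add_at_top[OF tendsto_const[of "- T"] filterlim_ident]]) auto
    hence "((\<lambda>t. (t - T) powr (- e)) \<longlongrightarrow> 0) at_top" using e1 by (intro tendsto_neg_powr) auto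
    hence "((\<lambda>t. cs * A1 * (t - T) powr (- e) * T) \<longlongrightarrow> cs * A1 * 0 * T) at_top" by (intro tendsto_intros)
    hence l0: "((\<lambda>t. cs * A1 * (t - T) powr (- e) * T) \<longlongrightarrow> 0) at_top" by simp
    have l1: "((\<lambda>t. (cs * A1 * (t - T) powr (- e) * T) powr (q - r)) \<longlongrightarrow> 0 powr (q - r)) at_top"
      by (rule tendsto_powr'[OF l0 tendsto_const]) (use rq cs A12 T in \<open>auto intro!: always_eventually mult_nonneg_nonneg\<close>)
    have "(early \<longlongrightarrow> ((mink_const r * T * (cs * A1)) powr r * 0 powr (q - r)) powr (1 / q)) at_top"
      unfolding early_def
      by (rule tendsto_powr'[OF tendsto_mult[OF tendsto_const l1] tendsto_const]) (use q1 in \<open>auto intro!: always_eventually\<close>)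
    hence "(early \<longlongrightarrow> 0) at_top" by simp
    hence "\<forall>\<^sub>F t in at_top. early t < B" using B by (rule order_tendstoD)
    moreover have "\<forall>\<^sub>F t in at_top. weak_bound q B (heat_semigroup m t \<phi>)"
      by (rule heat_semigroup_schwartz_closure_decay[OF m q1 \<phi> B])
    ultimately show "\<forall>\<^sub>F t in at_top. weak_bound q (16 * \<Lambda>0 * A * ?Ms) (\<lambda>x. u t x - w t x)"
      using eventually_gt_at_top[of T]
    proof eventually_elim
      fix t assume early: "early t < B" and lin: "weak_bound q B (heat_semigroup m t \<phi>)" and tT: "T < t"
      have t0: "0 < t" using tT T by simp
      \<comment> \<open>the integrand of the Duhamel term of \<open>u - w\<close>, extended by \<open>0\<close> so that it is continuous in \<open>x\<close>
        for every \<open>\<tau>\<close>\<close>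
      define D where "D \<tau> x = (if \<tau> \<in> {0<..<t} then heat_semigroup m (t - \<tau>) (h \<tau>) x else 0)" for \<tau> x
      let ?E = "\<lambda>I x. \<integral>\<^sup>+ \<tau>\<in>I. ennreal \<bar>D \<tau> x\<bar> \<partial>lborel"
      have Dcont: "continuous_on UNIV (D \<tau>)" for \<tau>
        using sg[OF _ A12(1) hm h1, of "t - \<tau>" \<tau>] by (cases "\<tau> \<in> {0<..<t}") (auto simp: D_def[abs_def])
      have D1: "weak_bound r (cs * A1) (D \<tau>)" "\<bar>D \<tau> x\<bar> \<le> cs * A1 * (t - \<tau>) powr (- e)" if "\<tau> \<in> {0<..<t}" for \<tau> x
        using sg[OF _ A12(1) hm h1, of "t - \<tau>" \<tau> x] that by (auto simp: D_def)
      have D2: "weak_bound r (cs * A2) (D \<tau>)" "\<bar>D \<tau> x\<bar> \<le> cs * A2 * (t - \<tau>) powr (- e)" if "\<tau> \<in> {T<..<t}" for \<tau> x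
        using sg[OF _ A12(2) hm h2, of "t - \<tau>" \<tau> x] that T by (auto simp: D_def)
      have Deq: "D \<tau> x = duhamel_integrand m \<alpha> F u t x \<tau> - duhamel_integrand m \<alpha> F w t x \<tau>" if "\<tau> \<in> {0<..<t}" for \<tau> x
        unfolding duhamel_integrand_def heat_semigroup_def D_def h_def
        using that Fint[of "t - \<tau>" "u \<tau>" x] Fint[of "t - \<tau>" "w \<tau>" x] hu[of \<tau>] hw[of \<tau>]
        by (simp add: right_diff_distrib)
      have aeu: "AE x in lebesgue. set_integrable lborel {0<..<t} (duhamel_integrand m \<alpha> F u t x) \<and>
        u t x = heat_semigroup m t u0 x + (LINT \<tau>:{0<..<t}|lborel. duhamel_integrand m \<alpha> F u t x \<tau>)"
        using su t0 unfolding integral_solution_def by blast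
      have aew: "AE x in lebesgue. set_integrable lborel {0<..<t} (duhamel_integrand m \<alpha> F w t x) \<and>
        w t x = heat_semigroup m t w0 x + (LINT \<tau>:{0<..<t}|lborel. duhamel_integrand m \<alpha> F w t x \<tau>)"
        using sw t0 unfolding integral_solution_def by blast
      have Dind: "D \<tau> x = indicator {0<..<t} \<tau> *\<^sub>R duhamel_integrand m \<alpha> F u t x \<tau> - indicator {0<..<t} \<tau> *\<^sub>R duhamel_integrand m \<alpha> F w t x \<tau>" for \<tau> x
        using Deq[of \<tau> x] by (cases "\<tau> \<in> {0<..<t}") (auto simp: D_def)
      have aeD: "AE x in lebesgue. integrable lborel (\<lambda>\<tau>. D \<tau> x) \<and> u t x - w t x = heat_semigroup m t \<phi> x + (LINT \<tau>|lborel. D \<tau> x)"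
        using aeu aew
      proof eventually_elim
        fix x assume iu: "set_integrable lborel {0<..<t} (duhamel_integrand m \<alpha> F u t x) \<and>
            u t x = heat_semigroup m t u0 x + (LINT \<tau>:{0<..<t}|lborel. duhamel_integrand m \<alpha> F u t x \<tau>)"
          and iw: "set_integrable lborel {0<..<t} (duhamel_integrand m \<alpha> F w t x) \<and>
            w t x = heat_semigroup m t w0 x + (LINT \<tau>:{0<..<t}|lborel. duhamel_integrand m \<alpha> F w t x \<tau>)"
        have "heat_semigroup m t u0 x = heat_semigroup m t w0 x + heat_semigroup m t \<phi> x"
          unfolding heat_semigroup_def u0 using lint[OF t0 dw0(1,3)] lint[OF t0 dw0(2,4)] by (simp add: distrib_left)
        with iu iw show "integrable lborel (\<lambda>\<tau>. D \<tau> x) \<and> u t x - w t x = heat_semigroup m t \<phi> x + (LINT \<tau>|lborel. D \<tau> x)"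
          unfolding Dind set_integrable_def set_lebesgue_integral_def by simp
      qed
      have Dmeas: "(\<lambda>(\<tau>, x). D \<tau> x) \<in> borel_measurable (lborel \<Otimes>\<^sub>M lborel)"
      proof (rule Caratheodory_jointly_measurable[OF Dcont])
        have "AE x in lborel. integrable lborel (\<lambda>\<tau>. D \<tau> x) \<and> u t x - w t x = heat_semigroup m t \<phi> x + (LINT \<tau>|lborel. D \<tau> x)"
          using aeD by (simp add: AE_completion_iff)
        thus "AE x in lborel. (\<lambda>\<tau>. D \<tau> x) \<in> borel_measurable lborel"
          by eventually_elim auto
      qed
      have we: "weak_type q B (?E {0<..<T})"
      proof -
        have "weak_type q (early t) (?E {0<..<T})"
          unfolding early_def
        proof (rule weak_type_time_integral_early[OF Dmeas])
          fix \<tau> x assume \<tau>: "\<tau> \<in> {0<..<T}"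
          show "weak_bound r (cs * A1) (D \<tau>)" using D1(1)[of \<tau>] \<tau> tT by simp
          have "\<bar>D \<tau> x\<bar> \<le> cs * A1 * (t - \<tau>) powr (- e)" using D1(2)[of \<tau> x] \<tau> tT by simp
          also have "\<dots> \<le> cs * A1 * (t - T) powr (- e)"
            using \<tau> tT cs A12 e1 by (intro mult_left_mono powr_mono2') auto
          finally show "\<bar>D \<tau> x\<bar> \<le> cs * A1 * (t - T) powr (- e)" .
        qed (use r rq cs A12 T tT in auto)
        thus ?thesis
          by (rule weak_type_mono) (use early q1 weak_type_measurable[OF \<open>weak_type q (early t) _\<close>] in \<open>auto simp: early_def\<close>)
      qed
      have wl: "weak_type q B (?E {T<..<t})"
      proof -
        have "weak_type (r * e / (e - 1)) ((2 * mink_const r + 2 / (e - 1)) * (cs * A2)) (?E {T<..<t})"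
          using cs A12 r e1 by (intro weak_type_time_integral_critical[OF Dmeas] D2) auto
        moreover have "(2 * mink_const r + 2 / (e - 1)) * (cs * A2) = B" by (simp add: B_def A2_def \<Lambda>0_def mult_ac)
        ultimately show ?thesis unfolding qe by simp
      qed
      have s1: "weak_type q (4 * B) (\<lambda>x. ennreal \<bar>heat_semigroup m t \<phi> x\<bar> + ?E {0<..<T} x)"
        using q1 B by (intro weak_type_add lin we) auto
      have s2: "weak_type q (4 * B) (?E {T<..<t})"
        by (rule weak_type_mono[OF wl]) (use B q1 weak_type_measurable[OF wl] in auto)
      have "weak_type q (4 * (4 * B)) (\<lambda>x. (ennreal \<bar>heat_semigroup m t \<phi> x\<bar> + ?E {0<..<T} x) + ?E {T<..<t} x)"
        by (rule weak_type_add[OF s1 s2]) (use q1 B in auto)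
      thus "weak_bound q (16 * \<Lambda>0 * A * ?Ms) (\<lambda>x. u t x - w t x)"
      proof (rule weak_type_mono)
        show "(\<lambda>x. ennreal \<bar>u t x - w t x\<bar>) \<in> borel_measurable lebesgue"
          using conjunct1[OF hu[OF t0]] conjunct1[OF hw[OF t0]] by measurable
        show "AE x in lebesgue. ennreal \<bar>u t x - w t x\<bar> \<le> (ennreal \<bar>heat_semigroup m t \<phi> x\<bar> + ?E {0<..<T} x) + ?E {T<..<t} x"
          using aeD
        proof eventually_elim
          fix x assume x: "integrable lborel (\<lambda>\<tau>. D \<tau> x) \<and> u t x - w t x = heat_semigroup m t \<phi> x + (LINT \<tau>|lborel. D \<tau> x)"
          hence [measurable]: "(\<lambda>\<tau>. D \<tau> x) \<in> borel_measurable borel" by auto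
          have "ennreal \<bar>LINT \<tau>|lborel. D \<tau> x\<bar> \<le> (\<integral>\<^sup>+ \<tau>. ennreal \<bar>D \<tau> x\<bar> \<partial>lborel)"
            using integral_norm_bound_ennreal[of lborel "\<lambda>\<tau>. D \<tau> x"] x by simp
          also have "\<dots> \<le> (\<integral>\<^sup>+ \<tau>. ennreal \<bar>D \<tau> x\<bar> * indicator {0<..<T} \<tau> + ennreal \<bar>D \<tau> x\<bar> * indicator {T<..<t} \<tau> \<partial>lborel)"
            using AE_lborel_singleton[of T]
            by (intro nn_integral_mono_AE) (auto elim!: eventually_mono simp: indicator_def D_def)
          also have "\<dots> = ?E {0<..<T} x + ?E {T<..<t} x"
            by (intro nn_integral_add) measurable
          finally have I: "ennreal \<bar>LINT \<tau>|lborel. D \<tau> x\<bar> \<le> \<dots>" .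
          have "ennreal \<bar>u t x - w t x\<bar> \<le> ennreal (\<bar>heat_semigroup m t \<phi> x\<bar> + \<bar>LINT \<tau>|lborel. D \<tau> x\<bar>)"
            using x by (intro ennreal_leI) linarith
          also have "\<dots> = ennreal \<bar>heat_semigroup m t \<phi> x\<bar> + ennreal \<bar>LINT \<tau>|lborel. D \<tau> x\<bar>" by simp
          also have "\<dots> \<le> ennreal \<bar>heat_semigroup m t \<phi> x\<bar> + (?E {0<..<T} x + ?E {T<..<t} x)"
            by (intro add_left_mono I)
          finally show "ennreal \<bar>u t x - w t x\<bar> \<le> (ennreal \<bar>heat_semigroup m t \<phi> x\<bar> + ?E {0<..<T} x) + ?E {T<..<t} x"
            by (simp add: add.assoc)
        qed
      qed (use B q1 in \<open>auto simp: B_def\<close>)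
    qed
  qed
qed

theorem corollary5p11:
  fixes m \<alpha> p C \<kappa> qc :: real
    and F :: "real \<Rightarrow> real"
  assumes m: "(0 < m \<and> m < 1) \<or> (\<exists>k::nat. 1 \<le> k \<and> m = real k)"
    and \<alpha>: "0 < \<alpha>" "\<alpha> < 2 * m"
    and dim: "2 * m < real CARD('n::finite)"
    and p: "(real CARD('n) - \<alpha>) / (real CARD('n) - 2 * m) < p"
    and qc: "qc = real CARD('n) * (p - 1) / (2 * m - \<alpha>)"
    and F0: "F 0 = 0"
    and C: "0 < C"
    and F_lip: "\<And>a b. \<bar>F a - F b\<bar> \<le> C * \<bar>a - b\<bar> * (\<bar>a\<bar> powr (p - 1) + \<bar>b\<bar> powr (p - 1))"
    and F_hom: "\<And>l a. 0 < l \<Longrightarrow> F (l * a) = l powr p * F a"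
    and \<kappa>: "0 < \<kappa>"
  shows "\<exists>\<epsilon>0>0. \<forall>\<epsilon>. 0 < \<epsilon> \<and> \<epsilon> \<le> \<epsilon>0 \<longrightarrow>
    (\<forall>(w0 :: real^'n \<Rightarrow> real) \<phi> u0 w u.
        w0 \<in> weak_L qc \<and> weak_norm qc w0 < ennreal \<epsilon> \<and>
        homogeneous_ae (- ((2 * m - \<alpha>) / (p - 1))) w0 \<and>
        small_solution m \<alpha> F qc (\<kappa> * \<epsilon>) w0 w \<and>
        self_similar m ((2 * m - \<alpha>) / (p - 1)) w \<and>
        \<phi> \<in> schwartz_closure qc \<and>
        u0 = (\<lambda>x. w0 x + \<phi> x) \<and> weak_norm qc u0 < ennreal \<epsilon> \<and>
        small_solution m \<alpha> F qc (\<kappa> * \<epsilon>) u0 u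
      \<longrightarrow> ((\<lambda>t. weak_norm qc (\<lambda>x. u t x - w t x)) \<longlongrightarrow> 0) at_top)"
proof -
  let ?n = "real CARD('n)"
  have m0: "0 < m" using m by auto
  have pn: "?n - \<alpha> < p * (?n - 2 * m)" using p dim by (simp add: pos_divide_less_eq)
  have p1: "1 < p"
  proof -
    have "1 * (?n - 2 * m) < p * (?n - 2 * m)" using pn \<alpha> by simp
    thus ?thesis using dim by (simp add: mult_less_cancel_right)
  qed
  have n0: "0 < ?n" by simp
  have qinv: "(p - 1) / qc = (2 * m - \<alpha>) / ?n" using p1 \<alpha> n0 by (simp add: qc)
  have q0: "0 < qc" unfolding qc using p1 \<alpha> n0 by (intro divide_pos_pos mult_pos_pos) auto
  \<comment> \<open>the reciprocal of the exponent \<open>r\<close> of the nonlinearity; the lower bound on \<open>p\<close> is equivalent to \<open>s < 1\<close>\<close>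
  define s where "s = \<alpha> / ?n + p / qc"
  have s2: "s = 1 / qc + 2 * m / ?n"
  proof -
    have "p / qc = 1 / qc + (p - 1) / qc" by (simp add: diff_divide_distrib)
    thus ?thesis unfolding s_def qinv by (simp add: diff_divide_distrib)
  qed
  have s0: "0 < s" using \<alpha> n0 p1 q0 by (simp add: s_def add_pos_pos)
  have s1: "s < 1"
  proof -
    have "(p - 1) * s = (p - 1) / qc + (p - 1) * (2 * m / ?n)" unfolding s2 by (simp add: distrib_left)
    also have "\<dots> = (2 * m * p - \<alpha>) / ?n" unfolding qinv by (simp add: algebra_simps diff_divide_distrib add_divide_distrib)
    also have "\<dots> < (p - 1) * 1" using pn by (simp only: pos_divide_less_eq[OF n0]) (simp add: algebra_simps)
    finally show ?thesis using p1 by (simp add: mult_less_cancel_left)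
  qed
  define r where "r = 1 / s"
  have r: "1 < r" "1 / r = \<alpha> / ?n + p / qc" "1 / r = 1 / qc + 2 * m / ?n"
    using s0 s1 s2 by (auto simp: r_def s_def)
  have pq: "p \<le> qc"
  proof -
    have "0 < \<alpha> / ?n" using \<alpha> n0 by simp
    hence "p / qc < 1" using s1 by (simp add: s_def)
    thus ?thesis using q0 by (simp add: field_simps)
  qed
  have q1: "1 < qc" using p1 pq by simp
  obtain \<Lambda> where \<Lambda>: "0 < \<Lambda>" and half:
    "\<forall>A M T (u :: real \<Rightarrow> real^'n \<Rightarrow> real) w u0 w0 \<phi>. 0 < A \<longrightarrow> 0 < M \<longrightarrow> 0 < T \<longrightarrow>
      (\<forall>t>0. u t \<in> borel_measurable lebesgue \<and> weak_bound qc M (u t)) \<longrightarrow>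
      (\<forall>t>0. w t \<in> borel_measurable lebesgue \<and> weak_bound qc M (w t)) \<longrightarrow>
      (\<forall>t>T. weak_bound qc A (\<lambda>x. u t x - w t x)) \<longrightarrow>
      integral_solution m \<alpha> F u0 u \<longrightarrow> integral_solution m \<alpha> F w0 w \<longrightarrow>
      w0 \<in> weak_L qc \<longrightarrow> \<phi> \<in> schwartz_closure qc \<longrightarrow> u0 = (\<lambda>x. w0 x + \<phi> x) \<longrightarrow>
      (\<forall>\<^sub>F t in at_top. weak_bound qc (\<Lambda> * A * M powr (p - 1)) (\<lambda>x. u t x - w t x))"
    using difference_contraction[OF m \<alpha>(1) p1 pq r F0 C F_lip] by (elim exE conjE) (rule that)
  \<comment> \<open>chosen such that \<open>\<Lambda> * M powr (p - 1) \<le> 1 / 2\<close> for the radius \<open>M = 2 * (\<kappa> * \<epsilon>)\<close> of the ball of small solutions\<close>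
  define \<epsilon>0 where "\<epsilon>0 = (1 / (2 * \<Lambda>)) powr (1 / (p - 1)) / (2 * \<kappa>)"
  have e0: "0 < \<epsilon>0" unfolding \<epsilon>0_def using \<Lambda> \<kappa> by (intro divide_pos_pos) auto
  show ?thesis
  proof (intro exI[of _ \<epsilon>0] conjI allI impI e0)
    fix \<epsilon> :: real and w0 \<phi> u0 :: "real^'n \<Rightarrow> real" and w u
    assume \<epsilon>: "0 < \<epsilon> \<and> \<epsilon> \<le> \<epsilon>0"
      and H: "w0 \<in> weak_L qc \<and> weak_norm qc w0 < ennreal \<epsilon> \<and>
        homogeneous_ae (- ((2 * m - \<alpha>) / (p - 1))) w0 \<and>
        small_solution m \<alpha> F qc (\<kappa> * \<epsilon>) w0 w \<and>
        self_similar m ((2 * m - \<alpha>) / (p - 1)) w \<and>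
        \<phi> \<in> schwartz_closure qc \<and>
        u0 = (\<lambda>x. w0 x + \<phi> x) \<and> weak_norm qc u0 < ennreal \<epsilon> \<and>
        small_solution m \<alpha> F qc (\<kappa> * \<epsilon>) u0 u"
    define M where "M = 2 * (\<kappa> * \<epsilon>)"
    have M: "0 < M" using \<kappa> \<epsilon> by (simp add: M_def)
    have LM: "\<Lambda> * M powr (p - 1) \<le> 1 / 2"
    proof -
      have "M \<le> 2 * (\<kappa> * \<epsilon>0)" using \<kappa> \<epsilon> by (simp add: M_def)
      also have "\<dots> = (1 / (2 * \<Lambda>)) powr (1 / (p - 1))" using \<kappa> by (simp add: \<epsilon>0_def)
      finally have "M powr (p - 1) \<le> ((1 / (2 * \<Lambda>)) powr (1 / (p - 1))) powr (p - 1)"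
        using M p1 by (intro powr_mono2) auto
      also have "\<dots> = 1 / (2 * \<Lambda>)" using p1 \<Lambda> by (simp add: powr_powr)
      finally show ?thesis using \<Lambda> by (simp add: field_simps)
    qed
    have sol: "v t \<in> borel_measurable lebesgue \<and> weak_bound qc M (v t)"
      if v: "small_solution m \<alpha> F qc (\<kappa> * \<epsilon>) v0 v" and t: "0 < t" for v v0 t
    proof -
      have vm: "v t \<in> borel_measurable lebesgue"
        using v t by (auto simp: small_solution_def bounded_cont_def weak_L_def)
      have "weak_norm qc (v t) \<le> sup_weak_norm qc v"
        unfolding sup_weak_norm_def using t by (intro SUP_upper) auto
      also have "\<dots> \<le> ennreal M" using v by (simp add: small_solution_def M_def)
      finally show ?thesis using vm M q0 by (intro conjI weak_norm_imp_weak_type) auto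
    qed
    have hu: "\<And>t. 0 < t \<Longrightarrow> u t \<in> borel_measurable lebesgue \<and> weak_bound qc M (u t)"
      and hw: "\<And>t. 0 < t \<Longrightarrow> w t \<in> borel_measurable lebesgue \<and> weak_bound qc M (w t)"
      using sol H by blast+
    have d0: "weak_bound qc (4 * M) (\<lambda>x. u t x - w t x)" if "0 < t" for t
      using hu[OF that] hw[OF that] M q1 by (intro weak_type_diff) auto
    have step: "\<forall>\<^sub>F t in at_top. weak_bound qc (4 * M * (1 / 2) ^ k) (\<lambda>x. u t x - w t x)" for k
    proof (induction k)
      case 0
      show ?case using eventually_gt_at_top[of 0] by eventually_elim (simp add: d0)
    next
      case (Suc k)
      then obtain T0 where T0: "\<And>t. T0 \<le> t \<Longrightarrow> weak_bound qc (4 * M * (1 / 2) ^ k) (\<lambda>x. u t x - w t x)"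
        by (auto simp: eventually_at_top_linorder)
      let ?A = "4 * M * (1 / 2) ^ k"
      have A: "0 < ?A" using M by simp
      have "\<forall>\<^sub>F t in at_top. weak_bound qc (\<Lambda> * ?A * M powr (p - 1)) (\<lambda>x. u t x - w t x)"
      proof (rule half[rule_format, of ?A M "max 1 T0" u w u0 w0 \<phi>])
        fix t
        show "0 < t \<Longrightarrow> u t \<in> borel_measurable lebesgue \<and> weak_bound qc M (u t)" by (rule hu)
        show "0 < t \<Longrightarrow> w t \<in> borel_measurable lebesgue \<and> weak_bound qc M (w t)" by (rule hw)
        show "max 1 T0 < t \<Longrightarrow> weak_bound qc ?A (\<lambda>x. u t x - w t x)" by (rule T0) simp
      qed (use A M H in \<open>auto simp: small_solution_def\<close>)
      thus ?case using eventually_gt_at_top[of 0]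
      proof eventually_elim
        fix t :: real assume w: "weak_bound qc (\<Lambda> * ?A * M powr (p - 1)) (\<lambda>x. u t x - w t x)"
        have "?A * (\<Lambda> * M powr (p - 1)) \<le> ?A * (1 / 2)" using A by (intro mult_left_mono LM) auto
        hence "\<Lambda> * ?A * M powr (p - 1) \<le> 4 * M * (1 / 2) ^ Suc k" by (simp add: mult_ac)
        thus "weak_bound qc (4 * M * (1 / 2) ^ Suc k) (\<lambda>x. u t x - w t x)"
          using A \<Lambda> q0 weak_type_measurable[OF w] by (intro weak_type_mono[OF w]) auto
      qed
    qed
    show "((\<lambda>t. weak_norm qc (\<lambda>x. u t x - w t x)) \<longlongrightarrow> 0) at_top"
    proof (rule order_tendstoI)
      fix a :: ennreal assume "0 < a"
      have "(\<lambda>k. ennreal (qc / (qc - 1) * (4 * M * (1 / 2) ^ k))) \<longlonglongrightarrow> ennreal (qc / (qc - 1) * (4 * M * 0))"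
        by (intro tendsto_ennrealI tendsto_intros LIMSEQ_power_zero) simp
      hence "\<forall>\<^sub>F k in sequentially. ennreal (qc / (qc - 1) * (4 * M * (1 / 2) ^ k)) < a"
        using \<open>0 < a\<close> by (intro order_tendstoD) auto
      then obtain k where k: "ennreal (qc / (qc - 1) * (4 * M * (1 / 2) ^ k)) < a"
        by (auto simp: eventually_sequentially)
      show "\<forall>\<^sub>F t in at_top. weak_norm qc (\<lambda>x. u t x - w t x) < a"
        using step[of k]
      proof eventually_elim
        fix t assume "weak_bound qc (4 * M * (1 / 2) ^ k) (\<lambda>x. u t x - w t x)"
        hence "weak_norm qc (\<lambda>x. u t x - w t x) \<le> ennreal (qc / (qc - 1) * (4 * M * (1 / 2) ^ k))"
          using M q1 by (intro weak_type_imp_weak_norm) auto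
        also have "\<dots> < a" by (rule k)
        finally show "weak_norm qc (\<lambda>x. u t x - w t x) < a" .
      qed
    qed simp
  qed
qed

end
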